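(* Assume that $L/K$ is Galois with group $G=\mathrm{Gal}(L/K)$. If $\mathfrak O$ has the finite character property, then there is an isomorphism of monoids $$\mathrm{Reg}\,\mathrm{Cl}(\mathfrak O)/\mathrm{Pic}(\mathfrak O)\simeq\bigoplus_{\mathfrak p\in\mathrm R^\infty_{L/K}(\mathfrak o)}\ \bigoplus_{\sigma D_{\mathfrak p}\in G/D_{\mathfrak p}}\Big(\{0\}\sqcup\mathbb R/v_{\mathfrak p,L}(L^\times)\Big).$$
   Context: Setting: $\mathfrak o$ is a Dedekind domain which is not a field, $K$ its fraction field, $L/K$ an algebraic extension of fields (possibly of infinite degree), and $\mathfrak O$ the integral closure of $\mathfrak o$ in $L$. $\mathfrak O$ has the finite character property if every non-zero element of $\mathfrak O$ is contained in at most finitely many maximal ideals. A fractional ideal of $\mathfrak O$ is a non-zero $\mathfrak O$-submodule $I\subseteq L$ with $dI\subseteq\mathfrak O$ for some $d\in L^\times$; it is invertible if $IJ=\mathfrak O$ for some fractional ideal $J$. $\mathcal F(\mathfrak O)$ is the commutative monoid of fractional ideals under multiplication, $\mathcal I(\mathfrak O)$ the group of invertible ones, $\mathcal P(\mathfrak O)$ the group of principal ones $a\mathfrak O$, $a\in L^\times$. $\mathrm{Cl}(\mathfrak O)=\mathcal F(\mathfrak O)/\mathcal P(\mathfrak O)$, $\mathrm{Pic}(\mathfrak O)=\mathcal I(\mathfrak O)/\mathcal P(\mathfrak O)$. For a commutative monoid $A$ and a submonoid $H$ that is a group, $A/H$ is the quotient monoid of $A$ by the relation: $a\sim b$ iff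 $a=hb$ for some $h\in H$. For a monoid $A$, $\mathrm{Reg}\,A$ is the set of $a\in A$ such that $a=aba$ for some $b\in A$. For each maximal ideal $\mathfrak p$ of $\mathfrak o$ fix a maximal ideal $\mathfrak p_L$ of $\mathfrak O$ above $\mathfrak p$; $D_{\mathfrak p}\subseteq G$ is its decomposition group (the stabilizer of $\mathfrak p_L$). $v_{\mathfrak p,L}\colon L^\times\to\mathbb Q$ is the additive valuation corresponding to $\mathfrak p_L$ normalized by $v_{\mathfrak p,L}(K^\times)=\mathbb Z$, and $V_{\mathfrak p}$ is the closure of $v_{\mathfrak p,L}(L^\times)$ in $\mathbb R$. $\mathrm R^\infty_{L/K}(\mathfrak o)$ is the set of maximal ideals $\mathfrak q$ of $\mathfrak o$ with $v_{\mathfrak q,L}(L^\times)\ne V_{\mathfrak q}$, i.e. such that $v_{\mathfrak q,L}(L^\times)$ is non-discrete (hence dense) in $\mathbb R$. $\{0\}\sqcup\mathbb R/v_{\mathfrak p,L}(L^\times)$ denotes the commutative monoid obtained from the quotient group $\mathbb R/v_{\mathfrak p,L}(L^\times)$ by adjoining a new identity element $0$. A direct sum of commutative monoids consists of the families with all but finitely many components equal to the identity. *)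

theory Defs
  imports "HOL-Algebra.Algebra" "HOL-Analysis.Elementary_Topology"
begin

text \<open>
  All rings live inside one ambient field \<open>L\<close>: subrings of \<open>L\<close> are subsets of \<open>carrier L\<close>, and
  \<open>L\<lparr>carrier := A\<rparr>\<close> is the ring structure on the subring \<open>A\<close>.
\<close>

section \<open>Dedekind domains, integral closure, Galois extensions\<close>

definition fraction_field :: "('a, 'b) ring_scheme \<Rightarrow> 'a set \<Rightarrow> 'a set" where
  "fraction_field L A = {a \<otimes>\<^bsub>L\<^esub> inv\<^bsub>L\<^esub> b | a b. a \<in> A \<and> b \<in> A - {\<zero>\<^bsub>L\<^esub>}}"

definition integral_closure :: "('a, 'b) ring_scheme \<Rightarrow> 'a set \<Rightarrow> 'a set" where
  "integral_closure L A =
     {x \<in> carrier L. \<exists>p. polynomial\<^bsub>L\<^esub> A p \<and> p \<noteq> [] \<and> lead_coeff p = \<one>\<^bsub>L\<^esub> \<and>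
                         ring.eval L p x = \<zero>\<^bsub>L\<^esub>}"

definition dedekind_subring :: "('a, 'b) ring_scheme \<Rightarrow> 'a set \<Rightarrow> bool" where
  "dedekind_subring L A \<longleftrightarrow>
     subring A L \<and>
     noetherian_domain (L\<lparr>carrier := A\<rparr>) \<and>
     integral_closure L A \<inter> fraction_field L A = A \<and>
     (\<forall>P. primeideal P (L\<lparr>carrier := A\<rparr>) \<and> P \<noteq> {\<zero>\<^bsub>L\<^esub>} \<longrightarrow> maximalideal P (L\<lparr>carrier := A\<rparr>))"

text \<open>Automorphisms are extensional, so that they are determined by their values on \<open>carrier L\<close>.\<close>

definition galois_group :: "('a, 'b) ring_scheme \<Rightarrow> 'a set \<Rightarrow> ('a \<Rightarrow> 'a) monoid" where
  "galois_group L K =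
     (BijGroup (carrier L))
       \<lparr>carrier := {\<sigma> \<in> ring_iso L L \<inter> extensional (carrier L). \<forall>x\<in>K. \<sigma> x = x}\<rparr>"

definition algebraic_extension :: "('a, 'b) ring_scheme \<Rightarrow> 'a set \<Rightarrow> bool" where
  "algebraic_extension L K \<longleftrightarrow> subfield K L \<and> (\<forall>x\<in>carrier L. (ring.algebraic L over K) x)"

text \<open>
  A possibly infinite algebraic extension is Galois if \<open>K\<close> is the fixed field of its automorphism
  group (Bourbaki, Algebra, V.10.1).
\<close>

definition galois_extension :: "('a, 'b) ring_scheme \<Rightarrow> 'a set \<Rightarrow> bool" where
  "galois_extension L K \<longleftrightarrow>
     algebraic_extension L K \<and>
     {x \<in> carrier L. \<forall>\<sigma>\<in>carrier (galois_group L K). \<sigma> x = x} = K"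

definition decomposition_group ::
    "('a, 'b) ring_scheme \<Rightarrow> 'a set \<Rightarrow> 'a set \<Rightarrow> ('a \<Rightarrow> 'a) set" where
  "decomposition_group L K P = {\<sigma> \<in> carrier (galois_group L K). \<sigma> ` P = P}"

definition finite_character :: "('a, 'b) ring_scheme \<Rightarrow> bool" where
  "finite_character R \<longleftrightarrow> (\<forall>x \<in> carrier R - {\<zero>\<^bsub>R\<^esub>}. finite {M. maximalideal M R \<and> x \<in> M})"


section \<open>Fractional ideals of a subring of \<open>L\<close> with fraction field \<open>L\<close>\<close>

definition fractional_ideal :: "('a, 'b) ring_scheme \<Rightarrow> 'a set \<Rightarrow> 'a set \<Rightarrow> bool" where
  "fractional_ideal L A I \<longleftrightarrow>
     subgroup I (add_monoid L) \<and>
     (\<forall>a\<in>A. \<forall>x\<in>I. a \<otimes>\<^bsub>L\<^esub> x \<in> I) \<and>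
     I \<noteq> {\<zero>\<^bsub>L\<^esub>} \<and>
     (\<exists>d \<in> carrier L - {\<zero>\<^bsub>L\<^esub>}. \<forall>x\<in>I. d \<otimes>\<^bsub>L\<^esub> x \<in> A)"

text \<open>
  \<open>ideal_prod L I J\<close> closes the products \<open>i \<otimes> j\<close> under addition, which for submodules of \<open>L\<close>
  is the usual product.
\<close>

definition fractional_ideal_monoid :: "('a, 'b) ring_scheme \<Rightarrow> 'a set \<Rightarrow> 'a set monoid" where
  "fractional_ideal_monoid L A =
     \<lparr>carrier = {I. fractional_ideal L A I}, monoid.mult = ideal_prod L, one = A\<rparr>"

definition invertible_ideals :: "('a, 'b) ring_scheme \<Rightarrow> 'a set \<Rightarrow> 'a set set" where
  "invertible_ideals L A =
     {I. fractional_ideal L A I \<and> (\<exists>J. fractional_ideal L A J \<and> ideal_prod L I J = A)}"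

definition principal_ideals :: "('a, 'b) ring_scheme \<Rightarrow> 'a set \<Rightarrow> 'a set set" where
  "principal_ideals L A = {a <#\<^bsub>L\<^esub> A | a. a \<in> carrier L - {\<zero>\<^bsub>L\<^esub>}}"

text \<open>
  For a commutative monoid \<open>M\<close> and a submonoid \<open>H\<close> that is a group, the classes of the relation
  \<open>a \<sim> b \<longleftrightarrow> (\<exists>h\<in>H. a = h \<otimes> b)\<close> are the cosets \<open>H #> b\<close>, and the cosets multiply elementwise; so
  the quotient monoid is the library's \<open>M Mod H\<close>, which does not require \<open>M\<close> to be a group.
\<close>

definition class_monoid :: "('a, 'b) ring_scheme \<Rightarrow> 'a set \<Rightarrow> 'a set set monoid" where
  "class_monoid L A = fractional_ideal_monoid L A Mod principal_ideals L A"

definition picard_group :: "('a, 'b) ring_scheme \<Rightarrow> 'a set \<Rightarrow> 'a set set monoid" where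
  "picard_group L A =
     (fractional_ideal_monoid L A)\<lparr>carrier := invertible_ideals L A\<rparr> Mod principal_ideals L A"


section \<open>Constructions with monoids\<close>

definition regular_part :: "'a monoid \<Rightarrow> 'a monoid" where
  "regular_part M =
     M\<lparr>carrier := {a \<in> carrier M. \<exists>b\<in>carrier M. a = a \<otimes>\<^bsub>M\<^esub> b \<otimes>\<^bsub>M\<^esub> a}\<rparr>"

text \<open>\<open>None\<close> is the new identity element; the old one, \<open>Some \<one>\<close>, stays as a further idempotent.\<close>

definition adjoin_identity :: "('a, 'b) monoid_scheme \<Rightarrow> 'a option monoid" where
  "adjoin_identity M =
     \<lparr>carrier = insert None (Some ` carrier M),
      monoid.mult = (\<lambda>x y. case x of None \<Rightarrow> y
                            | Some a \<Rightarrow> (case y of None \<Rightarrow> x | Some b \<Rightarrow> Some (a \<otimes>\<^bsub>M\<^esub> b))),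
      one = None\<rparr>"

text \<open>The library's \<open>sum_group\<close> is not usable here, since it uses inverses.\<close>

definition sum_monoid :: "'i set \<Rightarrow> ('i \<Rightarrow> ('a, 'b) monoid_scheme) \<Rightarrow> ('i \<Rightarrow> 'a) monoid" where
  "sum_monoid I M =
     (product_group I M)
       \<lparr>carrier := {x \<in> carrier (product_group I M). finite {i \<in> I. x i \<noteq> \<one>\<^bsub>M i\<^esub>}}\<rparr>"

definition real_additive :: "real monoid" where
  "real_additive = \<lparr>carrier = UNIV, monoid.mult = (+), one = 0\<rparr>"


section \<open>Valuations\<close>

text \<open>
  \<open>v\<close> is the valuation of \<open>L\<close> corresponding to the maximal ideal \<open>P\<close> of \<open>B\<close>, that is, its valuation
  ring is the localization of \<open>B\<close> at \<open>P\<close>, and it is normalized by taking precisely the integers as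
  values on \<open>K\<close>. Only the values of \<open>v\<close> on the nonzero elements of \<open>L\<close> matter, and there the
  conditions determine \<open>v\<close>.
\<close>

definition normalized_valuation ::
    "('a, 'b) ring_scheme \<Rightarrow> 'a set \<Rightarrow> 'a set \<Rightarrow> 'a set \<Rightarrow> ('a \<Rightarrow> rat) \<Rightarrow> bool" where
  "normalized_valuation L K B P v \<longleftrightarrow>
     (\<forall>x \<in> carrier L - {\<zero>\<^bsub>L\<^esub>}. \<forall>y \<in> carrier L - {\<zero>\<^bsub>L\<^esub>}. v (x \<otimes>\<^bsub>L\<^esub> y) = v x + v y) \<and>
     (\<forall>x \<in> carrier L - {\<zero>\<^bsub>L\<^esub>}. \<forall>y \<in> carrier L - {\<zero>\<^bsub>L\<^esub>}.
        x \<oplus>\<^bsub>L\<^esub> y \<noteq> \<zero>\<^bsub>L\<^esub> \<longrightarrow> v (x \<oplus>\<^bsub>L\<^esub> y) \<ge> min (v x) (v y)) \<and>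
     {x \<in> carrier L. x = \<zero>\<^bsub>L\<^esub> \<or> v x \<ge> 0} = {a \<otimes>\<^bsub>L\<^esub> inv\<^bsub>L\<^esub> s | a s. a \<in> B \<and> s \<in> B - P} \<and>
     v ` (K - {\<zero>\<^bsub>L\<^esub>}) = \<int>"

definition value_group :: "('a, 'b) ring_scheme \<Rightarrow> ('a \<Rightarrow> rat) \<Rightarrow> real set" where
  "value_group L v = real_of_rat ` v ` (carrier L - {\<zero>\<^bsub>L\<^esub>})"

text \<open>\<open>v \<pp>\<close> is the chosen valuation of \<open>L\<close> above the maximal ideal \<open>\<pp>\<close> of \<open>A\<close>.\<close>

definition nondiscrete_primes ::
    "('a, 'b) ring_scheme \<Rightarrow> 'a set \<Rightarrow> ('a set \<Rightarrow> 'a \<Rightarrow> rat) \<Rightarrow> 'a set set" where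
  "nondiscrete_primes L A v =
     {\<qq>. maximalideal \<qq> (L\<lparr>carrier := A\<rparr>) \<and> value_group L (v \<qq>) \<noteq> closure (value_group L (v \<qq>))}"

end

theory Submission
  imports Defs "HOL-Analysis.Continuum_Not_Denumerable" "HOL-Analysis.Elementary_Metric_Spaces"
begin

text \<open>
  Let \<open>B\<close> be the integral closure. At each maximal ideal \<open>M\<close> of \<open>B\<close> the localization is the valuation ring of a
  real valuation \<open>w M\<close> with value group \<open>\<Gamma>\<close>, and a fractional ideal \<open>I\<close> is the intersection of its
  localizations. So \<open>I\<close> is known as soon as the sets \<open>vals M I\<close> of the values that \<open>w M\<close> takes on \<open>I\<close> are known. Each of
  these is an up-closed subset of \<open>\<Gamma>\<close> that is bounded below, here called a cut, and by finite character it is the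
  set of nonnegative elements of \<open>\<Gamma>\<close> for almost all \<open>M\<close>. Conversely, every such family of cuts comes from a
  fractional ideal, because finite character lets one move the values at finitely many maximal ideals
  without spoiling the others. Products of ideals become sums of cuts, so the monoid of fractional ideals
  is the restricted product of the monoids of cuts.

  A cut with a minimum is a translate of the nonnegative part of \<open>\<Gamma>\<close>; the cuts of this kind are the units, and the
  invertible ideals are the ideals all of whose cuts have minima. A cut without minimum is the set of the
  elements of \<open>\<Gamma>\<close> beyond its infimum, an arbitrary real number if \<open>\<Gamma>\<close> is dense. Hence, modulo translation by \<open>\<Gamma>\<close>, a cut is
  either the class of the cuts with minimum, a new identity element, or the class of its infimum
  in \<open>\<real> / \<Gamma>\<close>. If \<open>\<Gamma>\<close> is a closed subgroup consisting of rational numbers, it is discrete and all its cuts have minima. This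
  computes fractional ideals modulo invertible ones as the direct sum, over the maximal ideals with
  dense value group, of \<open>\<real> / \<Gamma>\<close> with a new identity adjoined (\<open>regular_class_monoid_iso\<close>). Every element of this sum is
  regular, so the whole class monoid is regular, and passing to the quotient in two steps gives the
  same monoid (\<open>regular_part_quotient_iso\<close>).

  It remains to index the maximal ideals of \<open>B\<close> by pairs of a maximal ideal of the Dedekind domain and a coset of a
  decomposition group. That is the transitivity of the Galois action on the maximal ideals above a given one
  (\<open>galois_transitive\<close>). The extension may be infinite, but by finite character only finitely many maximal ideals
  lie above a given nonzero one, and an element of \<open>B\<close> has finitely many conjugates; so the classical
  argument with the product of the conjugates of an element applies.
\<close>

section \<open>Quotients and direct sums of commutative monoids\<close>

text \<open>
  Cosets in a monoid behave as in a group as soon as \<open>P\<close> itself is a group: the factor \<open>p\<close> is removed by an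
  inverse taken in \<open>P\<close>.
\<close>

lemma (in comm_monoid) coset_eq_iff:
  assumes P: "P \<subseteq> carrier G" "\<one> \<in> P" "\<And>p q. p \<in> P \<Longrightarrow> q \<in> P \<Longrightarrow> p \<otimes> q \<in> P"
      "\<And>p. p \<in> P \<Longrightarrow> \<exists>q\<in>P. p \<otimes> q = \<one>"
    and a: "a \<in> carrier G" and b: "b \<in> carrier G"
  shows "P #> a = P #> b \<longleftrightarrow> (\<exists>p\<in>P. a = p \<otimes> b)"
proof
  assume "P #> a = P #> b"
  moreover have "a \<in> P #> a" using P(2) a by (auto simp: r_coset_def intro!: bexI[of _ \<one>])
  ultimately show "\<exists>p\<in>P. a = p \<otimes> b" by (auto simp: r_coset_def)
next
  have sub: "P #> (p \<otimes> c) \<subseteq> P #> c" if "p \<in> P" "c \<in> carrier G" for p c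
  proof
    fix x assume "x \<in> P #> (p \<otimes> c)"
    then obtain q where q: "q \<in> P" "x = q \<otimes> (p \<otimes> c)" by (auto simp: r_coset_def)
    then have "x = (q \<otimes> p) \<otimes> c" using that P(1) by (simp add: m_assoc subset_iff)
    then show "x \<in> P #> c" using P(3)[OF q(1) that(1)] by (auto simp: r_coset_def)
  qed
  assume "\<exists>p\<in>P. a = p \<otimes> b"
  then obtain p where p: "p \<in> P" "a = p \<otimes> b" by blast
  obtain q where q: "q \<in> P" "p \<otimes> q = \<one>" using P(4) p by blast
  have pq: "p \<in> carrier G" "q \<in> carrier G" using p q P(1) by auto
  have "q \<otimes> a = (p \<otimes> q) \<otimes> b" unfolding p(2) using pq b by (simp add: m_ac)
  then have "b = q \<otimes> a" using q(2) b by simp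
  then show "P #> a = P #> b" using sub[OF p(1) b] sub[OF q(1) a] p(2) by auto
qed

lemma (in comm_monoid) coset_mult:
  assumes P: "P \<subseteq> carrier G" "\<one> \<in> P" "\<And>p q. p \<in> P \<Longrightarrow> q \<in> P \<Longrightarrow> p \<otimes> q \<in> P"
    and a: "a \<in> carrier G" and b: "b \<in> carrier G"
  shows "(P #> a) <#> (P #> b) = P #> (a \<otimes> b)"
proof
  have car: "\<And>p. p \<in> P \<Longrightarrow> p \<in> carrier G" using P(1) by blast
  have eq: "(p \<otimes> a) \<otimes> (q \<otimes> b) = (p \<otimes> q) \<otimes> (a \<otimes> b)" if "p \<in> P" "q \<in> P" for p q
    using car[OF that(1)] car[OF that(2)] a b by (simp add: m_ac)
  show "(P #> a) <#> (P #> b) \<subseteq> P #> (a \<otimes> b)"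
    using eq P(3) by (fastforce simp: set_mult_def r_coset_def)
  show "P #> (a \<otimes> b) \<subseteq> (P #> a) <#> (P #> b)"
  proof
    fix x assume "x \<in> P #> (a \<otimes> b)"
    then obtain p where p: "p \<in> P" "x = p \<otimes> (a \<otimes> b)" by (auto simp: r_coset_def)
    then have "x = (p \<otimes> a) \<otimes> (\<one> \<otimes> b)" using car a b by (simp add: m_assoc)
    then show "x \<in> (P #> a) <#> (P #> b)" using p(1) P(2) unfolding set_mult_def r_coset_def by blast
  qed
qed

text \<open>
  The elements of the iterated quotient correspond to the fibres of \<open>\<Phi>\<close>. The quotient by \<open>P\<close> is regular because
  the target is: a pseudo-inverse of \<open>\<Phi> a\<close> lifts to some \<open>b\<close> with \<open>\<Phi> (a b a) = \<Phi> a\<close>, so \<open>a = h a b a\<close> for some \<open>h\<close> in \<open>H\<close>, and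
  \<open>h b\<close> is a pseudo-inverse of \<open>a\<close> itself.
\<close>

theorem (in comm_monoid) regular_part_quotient_iso:
  assumes P: "\<one> \<in> P" "\<And>p q. p \<in> P \<Longrightarrow> q \<in> P \<Longrightarrow> p \<otimes> q \<in> P" "\<And>p. p \<in> P \<Longrightarrow> \<exists>q\<in>P. p \<otimes> q = \<one>"
    and H: "H \<subseteq> carrier G" "\<And>p q. p \<in> H \<Longrightarrow> q \<in> H \<Longrightarrow> p \<otimes> q \<in> H" "\<And>p. p \<in> H \<Longrightarrow> \<exists>q\<in>H. p \<otimes> q = \<one>"
    and PH: "P \<subseteq> H"
    and \<Phi>: "\<Phi> \<in> hom G T" "\<Phi> ` carrier G = carrier T"
    and fibre: "\<And>a b. a \<in> carrier G \<Longrightarrow> b \<in> carrier G \<Longrightarrow> \<Phi> a = \<Phi> b \<longleftrightarrow> (\<exists>h\<in>H. a = h \<otimes> b)"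
    and regular: "\<And>c. c \<in> carrier T \<Longrightarrow> \<exists>d\<in>carrier T. c = c \<otimes>\<^bsub>T\<^esub> d \<otimes>\<^bsub>T\<^esub> c"
  shows "regular_part (G Mod P) Mod carrier (G\<lparr>carrier := H\<rparr> Mod P) \<cong> T"
proof -
  have PG: "P \<subseteq> carrier G" and H1: "\<one> \<in> H" using H(1) PH P(1) by auto
  note eq = coset_eq_iff[OF PG P] and mult = coset_mult[OF PG P(1,2)]
  have Hc: "h \<in> carrier G" if "h \<in> H" for h using H(1) that by blast
  have \<Phi>m: "\<Phi> (a \<otimes> b) = \<Phi> a \<otimes>\<^bsub>T\<^esub> \<Phi> b" if "a \<in> carrier G" "b \<in> carrier G" for a b
    using \<Phi>(1) that by (simp add: hom_def)
  define Q where "Q = regular_part (G Mod P)"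
  have Qm: "W \<otimes>\<^bsub>Q\<^esub> Y = W <#> Y" for W Y by (simp add: Q_def regular_part_def FactGroup_def)
  have reg: "\<exists>b\<in>carrier G. P #> a = ((P #> a) <#> (P #> b)) <#> (P #> a)" if a: "a \<in> carrier G" for a
  proof -
    have "\<Phi> a \<in> carrier T" using \<Phi>(2) a by blast
    then obtain b where b: "b \<in> carrier G" "\<Phi> a = \<Phi> a \<otimes>\<^bsub>T\<^esub> \<Phi> b \<otimes>\<^bsub>T\<^esub> \<Phi> a" using regular \<Phi>(2) by (metis imageE)
    then have "\<Phi> a = \<Phi> (a \<otimes> b \<otimes> a)" using a \<Phi>m by simp
    then obtain h where h: "h \<in> H" "a = h \<otimes> (a \<otimes> b \<otimes> a)" using fibre[of a "a \<otimes> b \<otimes> a"] a b by auto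
    have "h \<otimes> (a \<otimes> b \<otimes> a) = a \<otimes> (h \<otimes> b) \<otimes> a" using Hc[OF h(1)] a b by (simp add: m_ac)
    then have "a = a \<otimes> (h \<otimes> b) \<otimes> a" using h(2) by (rule trans[rotated])
    then have "P #> a = ((P #> a) <#> (P #> (h \<otimes> b))) <#> (P #> a)"
      using mult a b Hc[OF h(1)] by simp
    then show ?thesis using Hc[OF h(1)] b by blast
  qed
  have Qc: "carrier Q = (\<lambda>a. P #> a) ` carrier G"
  proof -
    have "carrier (G Mod P) = (\<lambda>a. P #> a) ` carrier G" by (auto simp: FactGroup_def RCOSETS_def)
    then show ?thesis using reg by (auto simp: Q_def regular_part_def FactGroup_def)
  qed
  define U where "U = carrier (G\<lparr>carrier := H\<rparr> Mod P)"
  have U: "U = (\<lambda>h. P #> h) ` H" by (auto simp: U_def FactGroup_def RCOSETS_def r_coset_def)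
  define W where "W a = U #>\<^bsub>Q\<^esub> (P #> a)" for a
  have W: "W a = (\<lambda>h. P #> (h \<otimes> a)) ` H" if "a \<in> carrier G" for a
    using that mult Hc by (auto simp: W_def r_coset_def[of Q] Qm U)
  have car: "carrier (Q Mod U) = W ` carrier G"
    by (auto simp: FactGroup_def RCOSETS_def Qc W_def)
  have UW: "\<Union>(W a) = (\<lambda>h. h \<otimes> a) ` H" if a: "a \<in> carrier G" for a
  proof
    show "\<Union>(W a) \<subseteq> (\<lambda>h. h \<otimes> a) ` H"
    proof
      fix x assume "x \<in> \<Union>(W a)"
      then obtain h p where hp: "h \<in> H" "p \<in> P" "x = p \<otimes> (h \<otimes> a)"
        unfolding W[OF a] by (auto simp: r_coset_def)
      then have "x = (p \<otimes> h) \<otimes> a" using Hc a PH by (simp add: m_assoc subset_iff)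
      then show "x \<in> (\<lambda>h. h \<otimes> a) ` H" using H(2) hp PH by blast
    qed
    show "(\<lambda>h. h \<otimes> a) ` H \<subseteq> \<Union>(W a)"
    proof
      fix x assume "x \<in> (\<lambda>h. h \<otimes> a) ` H"
      then obtain h where h: "h \<in> H" "x = h \<otimes> a" by blast
      then have "x = \<one> \<otimes> (h \<otimes> a)" using Hc a by simp
      then have "x \<in> P #> (h \<otimes> a)" using P(1) unfolding r_coset_def by blast
      then show "x \<in> \<Union>(W a)" unfolding W[OF a] using h(1) by blast
    qed
  qed
  \<comment> \<open>An element \<open>Y\<close> of the iterated quotient is a set of cosets, whose union is a single \<open>H\<close>-orbit, on which \<open>\<Phi>\<close> is constant.\<close>
  define f where "f Y = the_elem (\<Phi> ` \<Union>Y)" for Y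
  have f: "f (W a) = \<Phi> a" if a: "a \<in> carrier G" for a
  proof -
    have "\<Phi> (h \<otimes> a) = \<Phi> a" if "h \<in> H" for h using fibre[of "h \<otimes> a" a] a Hc that by auto
    then have "(\<lambda>h. \<Phi> (h \<otimes> a)) ` H = (\<lambda>_. \<Phi> a) ` H" by (intro image_cong) auto
    then have "\<Phi> ` \<Union>(W a) = {\<Phi> a}" unfolding UW[OF a] image_image using H1 by auto
    then show ?thesis by (simp add: f_def)
  qed
  have X_eq: "W a = W b" if ab: "a \<in> carrier G" "b \<in> carrier G" "\<Phi> a = \<Phi> b" for a b
  proof -
    have sub: "W a \<subseteq> W b" if ab: "a \<in> carrier G" "b \<in> carrier G" "\<Phi> a = \<Phi> b" for a b
    proof
      fix Y assume "Y \<in> W a"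
      then obtain h where h: "h \<in> H" "Y = P #> (h \<otimes> a)" unfolding W[OF ab(1)] by blast
      obtain k where k: "k \<in> H" "a = k \<otimes> b" using fibre ab by blast
      have "h \<otimes> a = (h \<otimes> k) \<otimes> b" unfolding k(2) using Hc h k ab by (simp add: m_assoc)
      then have "Y = P #> ((h \<otimes> k) \<otimes> b)" using h(2) by simp
      then show "Y \<in> W b" unfolding W[OF ab(2)] using H(2)[OF h(1) k(1)] by blast
    qed
    show ?thesis using sub[OF ab] sub[OF ab(2,1) ab(3)[symmetric]] by (rule equalityI)
  qed
  have Xm: "W a <#>\<^bsub>Q\<^esub> W b = W (a \<otimes> b)" if ab: "a \<in> carrier G" "b \<in> carrier G" for a b
  proof -
    have abc: "a \<otimes> b \<in> carrier G" using ab by simp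
    have e: "(P #> (h \<otimes> a)) <#> (P #> (k \<otimes> b)) = P #> ((h \<otimes> k) \<otimes> (a \<otimes> b))"
      if hk: "h \<in> H" "k \<in> H" for h k
    proof -
      have "(h \<otimes> a) \<otimes> (k \<otimes> b) = (h \<otimes> k) \<otimes> (a \<otimes> b)"
        using Hc[OF hk(1)] Hc[OF hk(2)] ab by (simp add: m_ac)
      then show ?thesis using mult[of "h \<otimes> a" "k \<otimes> b"] Hc[OF hk(1)] Hc[OF hk(2)] ab by simp
    qed
    show ?thesis
    proof
      show "W a <#>\<^bsub>Q\<^esub> W b \<subseteq> W (a \<otimes> b)"
      proof
        fix Y assume "Y \<in> W a <#>\<^bsub>Q\<^esub> W b"
        then obtain Y1 Y2 where "Y1 \<in> W a" "Y2 \<in> W b" "Y = Y1 <#> Y2" unfolding set_mult_def[of Q] Qm by blast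
        then obtain h k where hk: "h \<in> H" "k \<in> H" "Y = (P #> (h \<otimes> a)) <#> (P #> (k \<otimes> b))"
          unfolding W[OF ab(1)] W[OF ab(2)] by blast
        then have "Y = P #> ((h \<otimes> k) \<otimes> (a \<otimes> b))" using e by simp
        then show "Y \<in> W (a \<otimes> b)" unfolding W[OF abc] using H(2)[OF hk(1,2)] by blast
      qed
      show "W (a \<otimes> b) \<subseteq> W a <#>\<^bsub>Q\<^esub> W b"
      proof
        fix Y assume "Y \<in> W (a \<otimes> b)"
        then obtain h where h: "h \<in> H" "Y = P #> (h \<otimes> (a \<otimes> b))" unfolding W[OF abc] by blast
        then have "Y = (P #> (h \<otimes> a)) <#> (P #> (\<one> \<otimes> b))" using e[OF h(1) H1] Hc[OF h(1)] by simp
        moreover have "P #> (h \<otimes> a) \<in> W a" "P #> (\<one> \<otimes> b) \<in> W b"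
          unfolding W[OF ab(1)] W[OF ab(2)] using h(1) H1 by blast+
        ultimately show "Y \<in> W a <#>\<^bsub>Q\<^esub> W b" unfolding set_mult_def[of Q] Qm by blast
      qed
    qed
  qed
  have "f \<in> hom (Q Mod U) T"
  proof (rule homI)
    show "f Y \<in> carrier T" if "Y \<in> carrier (Q Mod U)" for Y
      using that f \<Phi>(2) unfolding car by auto
    show "f (Y \<otimes>\<^bsub>Q Mod U\<^esub> Z) = f Y \<otimes>\<^bsub>T\<^esub> f Z"
      if YZ: "Y \<in> carrier (Q Mod U)" "Z \<in> carrier (Q Mod U)" for Y Z
    proof -
      obtain a b where ab: "a \<in> carrier G" "b \<in> carrier G" "Y = W a" "Z = W b" using YZ unfolding car by blast
      have "Y \<otimes>\<^bsub>Q Mod U\<^esub> Z = W (a \<otimes> b)" using Xm ab by (simp add: FactGroup_def)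
      then show ?thesis using f ab \<Phi>m by simp
    qed
  qed
  moreover have "bij_betw f (carrier (Q Mod U)) (carrier T)"
    unfolding bij_betw_def
  proof
    show "inj_on f (carrier (Q Mod U))"
    proof (rule inj_onI)
      fix Y Z assume YZ: "Y \<in> carrier (Q Mod U)" "Z \<in> carrier (Q Mod U)" "f Y = f Z"
      obtain a b where ab: "a \<in> carrier G" "b \<in> carrier G" "Y = W a" "Z = W b" using YZ unfolding car by blast
      then have "\<Phi> a = \<Phi> b" using YZ(3) f by simp
      then have "W a = W b" by (rule X_eq[OF ab(1,2)])
      then show "Y = Z" unfolding ab(3,4) .
    qed
    have "(\<lambda>a. f (W a)) ` carrier G = \<Phi> ` carrier G" using f by (intro image_cong) auto
    then show "f ` carrier (Q Mod U) = carrier T" unfolding car image_image using \<Phi>(2) by simp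
  qed
  ultimately have "f \<in> iso (Q Mod U) T" by (simp add: iso_def)
  then show ?thesis unfolding is_iso_def Q_def U_def by blast
qed

text \<open>
  Currying is the isomorphism. It respects the finiteness conditions since a finite
  set of pairs has finitely many first components and finite fibres, and conversely.
\<close>

lemma sum_monoid_Sigma_iso:
  fixes N :: "'i \<Rightarrow> ('m, 'n) monoid_scheme" and T :: "'j \<Rightarrow> ('m, 'n) monoid_scheme" and C :: "'j \<Rightarrow> 'k set"
  assumes e: "bij_betw e (Sigma J C) D"
    and N: "\<And>j c. j \<in> J \<Longrightarrow> c \<in> C j \<Longrightarrow> N (e (j, c)) = T j"
  shows "sum_monoid D N \<cong> sum_monoid J (\<lambda>j. sum_monoid (C j) (\<lambda>_. T j))"
proof -
  let ?S = "\<lambda>j. sum_monoid (C j) (\<lambda>_. T j)"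
  let ?R = "sum_monoid J ?S"
  have inj: "inj_on e (Sigma J C)" and im: "e ` Sigma J C = D" using e by (auto simp: bij_betw_def)
  have mem: "e (j, c) \<in> D" if "j \<in> J" "c \<in> C j" for j c using im that by blast
  have S1: "\<one>\<^bsub>?S j\<^esub> = (\<lambda>c\<in>C j. \<one>\<^bsub>T j\<^esub>)" for j by (simp add: sum_monoid_def product_group_def)
  have Sm: "x \<otimes>\<^bsub>?S j\<^esub> y = (\<lambda>c\<in>C j. x c \<otimes>\<^bsub>T j\<^esub> y c)" for j x y by (simp add: sum_monoid_def product_group_def)
  have Sc: "x \<in> carrier (?S j) \<longleftrightarrow> x \<in> (C j \<rightarrow>\<^sub>E carrier (T j)) \<and> finite {c \<in> C j. x c \<noteq> \<one>\<^bsub>T j\<^esub>}" for j x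
    by (simp add: sum_monoid_def product_group_def)
  have Rm: "x \<otimes>\<^bsub>?R\<^esub> y = (\<lambda>j\<in>J. x j \<otimes>\<^bsub>?S j\<^esub> y j)" for x y by (simp add: sum_monoid_def product_group_def)
  have Rc: "x \<in> carrier ?R \<longleftrightarrow> x \<in> (\<Pi>\<^sub>E j\<in>J. carrier (?S j)) \<and> finite {j \<in> J. x j \<noteq> \<one>\<^bsub>?S j\<^esub>}" for x
    by (simp add: sum_monoid_def product_group_def)
  have Dm: "x \<otimes>\<^bsub>sum_monoid D N\<^esub> y = (\<lambda>d\<in>D. x d \<otimes>\<^bsub>N d\<^esub> y d)" for x y by (simp add: sum_monoid_def product_group_def)
  have Dc: "x \<in> carrier (sum_monoid D N) \<longleftrightarrow> x \<in> (\<Pi>\<^sub>E d\<in>D. carrier (N d)) \<and> finite {d \<in> D. x d \<noteq> \<one>\<^bsub>N d\<^esub>}" for x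
    by (simp add: sum_monoid_def product_group_def)
  define f where "f x = (\<lambda>j\<in>J. \<lambda>c\<in>C j. x (e (j, c)))" for x :: "'i \<Rightarrow> 'm"
  have f: "f x j c = x (e (j, c))" if "j \<in> J" "c \<in> C j" for x j c using that by (simp add: f_def)
  have fc: "f x \<in> carrier ?R" if x: "x \<in> carrier (sum_monoid D N)" for x
  proof -
    define E where "E = {q \<in> Sigma J C. x (e q) \<noteq> \<one>\<^bsub>N (e q)\<^esub>}"
    have "e ` E \<subseteq> {d \<in> D. x d \<noteq> \<one>\<^bsub>N d\<^esub>}" using im by (auto simp: E_def)
    then have "finite (e ` E)" using x finite_subset unfolding Dc by blast
    moreover have "inj_on e E" using inj by (rule inj_on_subset) (auto simp: E_def)
    ultimately have E: "finite E" by (rule finite_imageD)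
    have inE: "(j, c) \<in> E" if "j \<in> J" "c \<in> C j" "f x j c \<noteq> \<one>\<^bsub>T j\<^esub>" for j c
      using that f[OF that(1,2)] N[OF that(1,2)] by (simp add: E_def)
    have "f x j \<in> carrier (?S j)" if j: "j \<in> J" for j
    proof -
      have "{c \<in> C j. f x j c \<noteq> \<one>\<^bsub>T j\<^esub>} \<subseteq> snd ` E"
      proof
        fix c assume "c \<in> {c \<in> C j. f x j c \<noteq> \<one>\<^bsub>T j\<^esub>}"
        then have "(j, c) \<in> E" using inE[OF j] by blast
        then show "c \<in> snd ` E" by (rule rev_image_eqI) simp
      qed
      then have fin: "finite {c \<in> C j. f x j c \<noteq> \<one>\<^bsub>T j\<^esub>}" using E by (blast intro: finite_subset)
      have "x (e (j, c)) \<in> carrier (T j)" if "c \<in> C j" for c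
      proof -
        have "x (e (j, c)) \<in> carrier (N (e (j, c)))" using x mem[OF j that] unfolding Dc by auto
        then show ?thesis using N[OF j that] by simp
      qed
      then have "f x j \<in> C j \<rightarrow>\<^sub>E carrier (T j)" using j by (auto simp: f_def)
      then show ?thesis unfolding Sc using fin by blast
    qed
    moreover have "{j \<in> J. f x j \<noteq> \<one>\<^bsub>?S j\<^esub>} \<subseteq> fst ` E"
    proof
      fix j assume "j \<in> {j \<in> J. f x j \<noteq> \<one>\<^bsub>?S j\<^esub>}"
      then have j: "j \<in> J" "f x j \<noteq> (\<lambda>c\<in>C j. \<one>\<^bsub>T j\<^esub>)" by (simp_all add: S1)
      have "\<exists>c\<in>C j. f x j c \<noteq> \<one>\<^bsub>T j\<^esub>"
      proof (rule ccontr)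
        assume "\<not> (\<exists>c\<in>C j. f x j c \<noteq> \<one>\<^bsub>T j\<^esub>)"
        then have "f x j = (\<lambda>c\<in>C j. \<one>\<^bsub>T j\<^esub>)"
          using j(1) by (intro extensionalityI[of _ "C j"]) (auto simp: f_def)
        then show False using j(2) by blast
      qed
      then obtain c where "c \<in> C j" "f x j c \<noteq> \<one>\<^bsub>T j\<^esub>" by blast
      then have "(j, c) \<in> E" using inE[OF j(1)] by blast
      then show "j \<in> fst ` E" by (rule rev_image_eqI) simp
    qed
    then have "finite {j \<in> J. f x j \<noteq> \<one>\<^bsub>?S j\<^esub>}" using E by (blast intro: finite_subset)
    moreover have "f x \<in> extensional J" by (simp add: f_def)
    ultimately show ?thesis unfolding Rc by (simp add: PiE_def Pi_def)
  qed
  have "f \<in> hom (sum_monoid D N) ?R"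
  proof (rule homI[OF fc])
    fix x y
    show "f (x \<otimes>\<^bsub>sum_monoid D N\<^esub> y) = f x \<otimes>\<^bsub>?R\<^esub> f y"
      unfolding Dm Rm Sm
    proof (rule extensionalityI[of _ J])
      fix j assume j: "j \<in> J"
      show "f (\<lambda>d\<in>D. x d \<otimes>\<^bsub>N d\<^esub> y d) j = (\<lambda>j\<in>J. \<lambda>c\<in>C j. f x j c \<otimes>\<^bsub>T j\<^esub> f y j c) j"
      proof (rule extensionalityI[of _ "C j"])
        show "f (\<lambda>d\<in>D. x d \<otimes>\<^bsub>N d\<^esub> y d) j c = (\<lambda>j\<in>J. \<lambda>c\<in>C j. f x j c \<otimes>\<^bsub>T j\<^esub> f y j c) j c" if "c \<in> C j" for c
          using j that f[OF j that] mem[OF j that] N[OF j that] by simp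
      qed (use j in \<open>simp_all add: f_def\<close>)
    qed (simp_all add: f_def)
  qed
  moreover have "inj_on f (carrier (sum_monoid D N))"
  proof (rule inj_onI)
    fix x y assume xy: "x \<in> carrier (sum_monoid D N)" "y \<in> carrier (sum_monoid D N)" "f x = f y"
    show "x = y"
    proof (rule extensionalityI[of _ D])
      show "x \<in> extensional D" "y \<in> extensional D" using xy(1,2) unfolding Dc by (auto simp: PiE_def)
      fix d assume "d \<in> D"
      then obtain j c where jc: "j \<in> J" "c \<in> C j" "d = e (j, c)" using im by blast
      then show "x d = y d" using f[OF jc(1,2), of x] f[OF jc(1,2), of y] xy(3) by simp
    qed
  qed
  moreover have "carrier ?R \<subseteq> f ` carrier (sum_monoid D N)"
  proof
    fix y assume "y \<in> carrier ?R"
    then have y: "y \<in> (\<Pi>\<^sub>E j\<in>J. carrier (?S j))" "finite {j \<in> J. y j \<noteq> \<one>\<^bsub>?S j\<^esub>}" by (auto simp: Rc)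
    have yS: "y j \<in> (C j \<rightarrow>\<^sub>E carrier (T j))" "finite {c \<in> C j. y j c \<noteq> \<one>\<^bsub>T j\<^esub>}" if "j \<in> J" for j
      using y(1) that Sc[of "y j" j] by (auto dest: PiE_mem)
    define x where "x = (\<lambda>d\<in>D. case inv_into (Sigma J C) e d of (j, c) \<Rightarrow> y j c)"
    have x: "x (e (j, c)) = y j c" if "j \<in> J" "c \<in> C j" for j c
      using that mem[OF that] inv_into_f_f[OF inj, of "(j, c)"] by (simp add: x_def)
    have "x \<in> (\<Pi>\<^sub>E d\<in>D. carrier (N d))"
    proof (rule PiE_I)
      fix d assume "d \<in> D"
      then obtain j c where jc: "j \<in> J" "c \<in> C j" "d = e (j, c)" using im by blast
      then show "x d \<in> carrier (N d)" using x[OF jc(1,2)] N[OF jc(1,2)] PiE_mem[OF yS(1)[OF jc(1)] jc(2)] by simp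
    qed (simp add: x_def)
    moreover have "finite {d \<in> D. x d \<noteq> \<one>\<^bsub>N d\<^esub>}"
    proof (rule finite_subset)
      let ?E = "SIGMA j:{j \<in> J. y j \<noteq> \<one>\<^bsub>?S j\<^esub>}. {c \<in> C j. y j c \<noteq> \<one>\<^bsub>T j\<^esub>}"
      show "finite (e ` ?E)" using y(2) yS(2) by (intro finite_imageI finite_SigmaI) auto
      show "{d \<in> D. x d \<noteq> \<one>\<^bsub>N d\<^esub>} \<subseteq> e ` ?E"
      proof
        fix d assume d: "d \<in> {d \<in> D. x d \<noteq> \<one>\<^bsub>N d\<^esub>}"
        then obtain j c where jc: "j \<in> J" "c \<in> C j" "d = e (j, c)" using im by blast
        then have nz: "y j c \<noteq> \<one>\<^bsub>T j\<^esub>" using d x[OF jc(1,2)] N[OF jc(1,2)] by simp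
        then have "y j \<noteq> \<one>\<^bsub>?S j\<^esub>" using jc(2) by (auto simp: S1)
        then show "d \<in> e ` ?E" using jc nz by blast
      qed
    qed
    moreover have "f x = y"
    proof (rule extensionalityI[of _ J])
      show "f x \<in> extensional J" "y \<in> extensional J" using y(1) by (auto simp: f_def PiE_def)
      fix j assume j: "j \<in> J"
      show "f x j = y j"
      proof (rule extensionalityI[of _ "C j"])
        show "f x j \<in> extensional (C j)" "y j \<in> extensional (C j)" using j yS(1)[OF j] by (auto simp: f_def PiE_def)
        show "f x j c = y j c" if "c \<in> C j" for c using f[OF j that] x[OF j that] by simp
      qed
    qed
    ultimately have "y = f x" "x \<in> carrier (sum_monoid D N)" by (simp_all add: Dc)
    then show "y \<in> f ` carrier (sum_monoid D N)" by (rule image_eqI)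
  qed
  moreover have "f ` carrier (sum_monoid D N) \<subseteq> carrier ?R" using fc by (rule image_subsetI)
  ultimately have "f \<in> iso (sum_monoid D N) ?R" unfolding iso_def bij_betw_def by blast
  then show ?thesis by (auto simp: is_iso_def)
qed

section \<open>Cuts in subgroups of the reals\<close>

definition real_subgroup :: "real set \<Rightarrow> bool" where
  "real_subgroup \<Gamma> \<longleftrightarrow> 0 \<in> \<Gamma> \<and> (\<forall>g\<in>\<Gamma>. \<forall>h\<in>\<Gamma>. g - h \<in> \<Gamma>)"

lemma real_subgroupD:
  assumes "real_subgroup \<Gamma>"
  shows "0 \<in> \<Gamma>" "\<And>g h. g \<in> \<Gamma> \<Longrightarrow> h \<in> \<Gamma> \<Longrightarrow> g - h \<in> \<Gamma>"
    "\<And>g. g \<in> \<Gamma> \<Longrightarrow> - g \<in> \<Gamma>" "\<And>g h. g \<in> \<Gamma> \<Longrightarrow> h \<in> \<Gamma> \<Longrightarrow> g + h \<in> \<Gamma>"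
proof -
  show 0: "0 \<in> \<Gamma>" and d: "\<And>g h. g \<in> \<Gamma> \<Longrightarrow> h \<in> \<Gamma> \<Longrightarrow> g - h \<in> \<Gamma>"
    using assms by (auto simp: real_subgroup_def)
  show n: "- g \<in> \<Gamma>" if "g \<in> \<Gamma>" for g using d[OF 0 that] by simp
  show "g + h \<in> \<Gamma>" if "g \<in> \<Gamma>" "h \<in> \<Gamma>" for g h using d[OF that(1) n[OF that(2)]] by simp
qed

lemma real_additive_comm_monoid: "comm_monoid real_additive"
  by (rule comm_monoidI) (auto simp: real_additive_def)

lemma real_coset_eq_iff:
  assumes "real_subgroup \<Gamma>"
  shows "\<Gamma> #>\<^bsub>real_additive\<^esub> a = \<Gamma> #>\<^bsub>real_additive\<^esub> b \<longleftrightarrow> a - b \<in> \<Gamma>"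
proof -
  have inv: "\<exists>q\<in>\<Gamma>. p + q = 0" if "p \<in> \<Gamma>" for p
    using real_subgroupD(3)[OF assms that] by (intro bexI[of _ "- p"]) auto
  have "\<Gamma> #>\<^bsub>real_additive\<^esub> a = \<Gamma> #>\<^bsub>real_additive\<^esub> b \<longleftrightarrow> (\<exists>p\<in>\<Gamma>. a = p + b)"
    using comm_monoid.coset_eq_iff[OF real_additive_comm_monoid, of \<Gamma> a b] real_subgroupD[OF assms] inv
    by (simp add: real_additive_def)
  also have "\<dots> \<longleftrightarrow> a - b \<in> \<Gamma>" by (auto intro!: bexI[of _ "a - b"])
  finally show ?thesis .
qed

lemma real_coset_mult:
  assumes "real_subgroup \<Gamma>"
  shows "(\<Gamma> #>\<^bsub>real_additive\<^esub> a) <#>\<^bsub>real_additive\<^esub> (\<Gamma> #>\<^bsub>real_additive\<^esub> b) = \<Gamma> #>\<^bsub>real_additive\<^esub> (a + b)"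
  using comm_monoid.coset_mult[OF real_additive_comm_monoid, of \<Gamma> a b] real_subgroupD[OF assms]
  by (simp add: real_additive_def)

text \<open>
  The up-closed subsets of \<open>\<Gamma>\<close> that are neither empty nor unbounded below: the value sets of the fractional ideals of a
  valuation ring with value group \<open>\<Gamma>\<close>.
\<close>

definition cut :: "real set \<Rightarrow> real set \<Rightarrow> bool" where
  "cut \<Gamma> S \<longleftrightarrow> S \<subseteq> \<Gamma> \<and> S \<noteq> {} \<and> bdd_below S \<and> (\<forall>g\<in>S. \<forall>h\<in>\<Gamma>. g \<le> h \<longrightarrow> h \<in> S)"

definition has_min :: "real set \<Rightarrow> bool" where
  "has_min S \<longleftrightarrow> (\<exists>m\<in>S. \<forall>s\<in>S. m \<le> s)"

text \<open>
  The class of a cut modulo translation by \<open>\<Gamma>\<close>. If \<open>\<Gamma>\<close> is dense, a cut with a minimum and the cut of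
  the elements beyond this minimum have the same infimum; \<open>None\<close> and \<open>Some\<close> keep them apart.
\<close>

definition cut_class :: "real set \<Rightarrow> real set \<Rightarrow> real set option" where
  "cut_class \<Gamma> S = (if has_min S then None else Some (\<Gamma> #>\<^bsub>real_additive\<^esub> Inf S))"

lemma cutD:
  assumes "cut \<Gamma> S"
  shows "S \<subseteq> \<Gamma>" "S \<noteq> {}" "bdd_below S" "\<And>g h. g \<in> S \<Longrightarrow> h \<in> \<Gamma> \<Longrightarrow> g \<le> h \<Longrightarrow> h \<in> S"
  using assms by (auto simp: cut_def)

lemma Inf_sumset:
  fixes S T :: "real set"
  assumes S: "S \<noteq> {}" "bdd_below S" and T: "T \<noteq> {}" "bdd_below T"
  shows "Inf {s + t | s t. s \<in> S \<and> t \<in> T} = Inf S + Inf T" (is "Inf ?U = _")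
proof (rule antisym)
  have lower: "Inf S + Inf T \<le> u" if "u \<in> ?U" for u
    using that cInf_lower[OF _ S(2)] cInf_lower[OF _ T(2)] by (fastforce intro: add_mono)
  have U: "?U \<noteq> {}" "bdd_below ?U" using S(1) T(1) lower by (auto intro!: bdd_belowI[of _ "Inf S + Inf T"])
  show "Inf S + Inf T \<le> Inf ?U" by (rule cInf_greatest[OF U(1) lower])
  have "Inf ?U - t \<le> Inf S" if "t \<in> T" for t
  proof (rule cInf_greatest[OF S(1)])
    fix s assume "s \<in> S"
    then have "Inf ?U \<le> s + t" using that U(2) by (intro cInf_lower) auto
    then show "Inf ?U - t \<le> s" by simp
  qed
  then have "Inf ?U - Inf S \<le> Inf T" by (intro cInf_greatest[OF T(1)]) (simp add: algebra_simps)
  then show "Inf ?U \<le> Inf S + Inf T" by simp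
qed

lemma has_min_sumset: "has_min {s + t | s t. s \<in> S \<and> t \<in> T} \<longleftrightarrow> has_min S \<and> has_min T"
proof
  assume "has_min {s + t | s t. s \<in> S \<and> t \<in> T}"
  then obtain s t where st: "s \<in> S" "t \<in> T" "\<And>s' t'. s' \<in> S \<Longrightarrow> t' \<in> T \<Longrightarrow> s + t \<le> s' + t'"
    unfolding has_min_def by blast
  have "\<forall>s'\<in>S. s \<le> s'" "\<forall>t'\<in>T. t \<le> t'" using st(3)[of _ t] st(3)[of s] st(1,2) by auto
  then show "has_min S \<and> has_min T" using st unfolding has_min_def by blast
next
  assume "has_min S \<and> has_min T"
  then obtain s t where st: "s \<in> S" "t \<in> T" "\<forall>s'\<in>S. s \<le> s'" "\<forall>t'\<in>T. t \<le> t'" unfolding has_min_def by blast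
  then have "\<forall>u\<in>{s + t | s t. s \<in> S \<and> t \<in> T}. s + t \<le> u" by (auto intro: add_mono)
  then show "has_min {s + t | s t. s \<in> S \<and> t \<in> T}" using st(1,2) unfolding has_min_def by blast
qed

lemma has_min_Inf:
  assumes "has_min S" shows "Inf S \<in> S"
proof -
  obtain m where "m \<in> S" "\<forall>s\<in>S. m \<le> s" using assms by (auto simp: has_min_def)
  then have "Inf S = m" by (intro cInf_eq_minimum) auto
  then show ?thesis using \<open>m \<in> S\<close> by simp
qed

lemma cut_class_carrier: "cut_class \<Gamma> S \<in> carrier (adjoin_identity (real_additive Mod \<Gamma>))"
  by (auto simp: cut_class_def adjoin_identity_def FactGroup_def RCOSETS_def real_additive_def)

text \<open>
  A sum of two cuts has a minimum exactly if both have one. If just one of them has a minimum, this minimum lies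
  in \<open>\<Gamma>\<close> and does not change the coset of the infimum: this is why \<open>None\<close> acts as an identity element that is
  different from the coset \<open>\<Gamma>\<close>.
\<close>

lemma cut_class_sumset:
  assumes \<Gamma>: "real_subgroup \<Gamma>" and S: "cut \<Gamma> S" and T: "cut \<Gamma> T"
  shows "cut_class \<Gamma> {s + t | s t. s \<in> S \<and> t \<in> T} =
    cut_class \<Gamma> S \<otimes>\<^bsub>adjoin_identity (real_additive Mod \<Gamma>)\<^esub> cut_class \<Gamma> T"
proof -
  have i: "Inf {s + t | s t. s \<in> S \<and> t \<in> T} = Inf S + Inf T"
    using cutD(2,3)[OF S] cutD(2,3)[OF T] by (intro Inf_sumset)
  have "Inf S \<in> \<Gamma>" if "has_min S" using has_min_Inf[OF that] cutD(1)[OF S] by blast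
  moreover have "Inf T \<in> \<Gamma>" if "has_min T" using has_min_Inf[OF that] cutD(1)[OF T] by blast
  ultimately show ?thesis
    using real_coset_mult[OF \<Gamma>] real_coset_eq_iff[OF \<Gamma>, of "Inf S + Inf T" "Inf S"]
      real_coset_eq_iff[OF \<Gamma>, of "Inf S + Inf T" "Inf T"]
    by (simp add: cut_class_def has_min_sumset i adjoin_identity_def FactGroup_def)
qed

lemma cut_eq_atLeast:
  assumes "cut \<Gamma> S" "has_min S" shows "S = {g \<in> \<Gamma>. Inf S \<le> g}"
  using cutD(1)[OF assms(1)] cutD(4)[OF assms(1) has_min_Inf[OF assms(2)]] cInf_lower[OF _ cutD(3)[OF assms(1)]]
  by blast

lemma cut_eq_greaterThan:
  assumes S: "cut \<Gamma> S" and "\<not> has_min S" shows "S = {g \<in> \<Gamma>. Inf S < g}"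
proof
  have "Inf S < s" if s: "s \<in> S" for s
  proof -
    obtain t where "t \<in> S" "t < s" using assms(2) s unfolding has_min_def by (meson not_le)
    then show ?thesis using cInf_lower[OF _ cutD(3)[OF S], of t] by simp
  qed
  then show "S \<subseteq> {g \<in> \<Gamma>. Inf S < g}" using cutD(1)[OF S] by blast
  show "{g \<in> \<Gamma>. Inf S < g} \<subseteq> S"
  proof clarify
    fix g assume g: "g \<in> \<Gamma>" "Inf S < g"
    then obtain s where "s \<in> S" "s < g" using cInf_lessD[OF cutD(2)[OF S]] by blast
    then show "g \<in> S" using cutD(4)[OF S, of s g] g by simp
  qed
qed

text \<open>
  A cut is determined by its infimum and by whether it has a minimum, so the difference of the infima is the
  required translation.
\<close>

lemma cut_class_eqD:
  assumes \<Gamma>: "real_subgroup \<Gamma>" and S: "cut \<Gamma> S" and T: "cut \<Gamma> T" and eq: "cut_class \<Gamma> S = cut_class \<Gamma> T"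
  obtains h where "h \<in> \<Gamma>" "S = (\<lambda>t. h + t) ` T"
proof -
  define h where "h = Inf S - Inf T"
  have h: "h \<in> \<Gamma> \<and> (has_min S \<longleftrightarrow> has_min T)"
    using eq has_min_Inf cutD(1)[OF S] cutD(1)[OF T] real_subgroupD(2)[OF \<Gamma>] real_coset_eq_iff[OF \<Gamma>, of "Inf S" "Inf T"]
    by (auto simp: cut_class_def h_def subset_iff split: if_splits)
  \<comment> \<open>One argument for both kinds of cuts, with \<open>R\<close> either of the two order relations.\<close>
  have shift: "(\<lambda>t. h + t) ` {g \<in> \<Gamma>. R (Inf T) g} = {g \<in> \<Gamma>. R (Inf S) g}"
    if R: "\<And>a b c. R (a :: real) b \<Longrightarrow> R (c + a) (c + b)" for R
  proof
    show "(\<lambda>t. h + t) ` {g \<in> \<Gamma>. R (Inf T) g} \<subseteq> {g \<in> \<Gamma>. R (Inf S) g}"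
      using real_subgroupD(4)[OF \<Gamma>] h R[of "Inf T" _ h] by (auto simp: h_def)
    show "{g \<in> \<Gamma>. R (Inf S) g} \<subseteq> (\<lambda>t. h + t) ` {g \<in> \<Gamma>. R (Inf T) g}"
    proof clarify
      fix g assume g: "g \<in> \<Gamma>" "R (Inf S) g"
      have "R (Inf T) (g - h)" using R[OF g(2), of "- h"] by (simp add: h_def algebra_simps)
      moreover have "g - h \<in> \<Gamma>" using real_subgroupD(2)[OF \<Gamma>] g h by blast
      ultimately show "g \<in> (\<lambda>t. h + t) ` {g \<in> \<Gamma>. R (Inf T) g}" by (intro image_eqI[of _ _ "g - h"]) auto
    qed
  qed
  have "S = (\<lambda>t. h + t) ` T"
  proof (cases "has_min S")
    case True
    then show ?thesis using cut_eq_atLeast[OF S] cut_eq_atLeast[OF T] h shift[of "(\<le>)"] by simp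
  next
    case False
    then show ?thesis using cut_eq_greaterThan[OF S] cut_eq_greaterThan[OF T] h shift[of "(<)"] by simp
  qed
  then show thesis using that h by blast
qed

definition order_dense :: "real set \<Rightarrow> bool" where
  "order_dense \<Gamma> \<longleftrightarrow> (\<forall>a b. a < b \<longrightarrow> (\<exists>g\<in>\<Gamma>. a < g \<and> g < b))"

text \<open>
  The integer multiples of a positive element smaller than \<open>b - a\<close> cannot jump over the interval from \<open>a\<close> to \<open>b\<close>.
\<close>

lemma order_dense_of_small:
  assumes \<Gamma>: "real_subgroup \<Gamma>" and small: "\<And>e. e > 0 \<Longrightarrow> \<exists>g\<in>\<Gamma>. 0 < g \<and> g < e"
  shows "order_dense \<Gamma>"
  unfolding order_dense_def
proof (intro allI impI)
  fix a b :: real assume "a < b"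
  then obtain g where g: "g \<in> \<Gamma>" "0 < g" "g < b - a" using small[of "b - a"] by auto
  have nat: "real n * g \<in> \<Gamma>" for n
    by (induction n) (use real_subgroupD(1,4)[OF \<Gamma>] g(1) in \<open>auto simp: algebra_simps\<close>)
  have int: "real_of_int k * g \<in> \<Gamma>" for k
    by (cases k rule: int_cases2) (use nat real_subgroupD(3)[OF \<Gamma>, OF nat] in auto)
  \<comment> \<open>the least multiple of \<open>g\<close> beyond \<open>a\<close>; it is at most \<open>a + g\<close>, hence smaller than \<open>b\<close>\<close>
  define k where "k = \<lfloor>a / g\<rfloor> + 1"
  have "a / g < real_of_int k" "real_of_int k \<le> a / g + 1" unfolding k_def by linarith+
  then have "a < real_of_int k * g" "real_of_int k * g \<le> a + g" using g(2) by (simp_all add: field_simps)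
  then show "\<exists>g\<in>\<Gamma>. a < g \<and> g < b" using int[of k] g(3) by (intro bexI[of _ "real_of_int k * g"]) auto
qed

text \<open>
  Elements of \<open>\<Gamma>\<close> that approach a limit outside \<open>\<Gamma>\<close> have arbitrarily small nonzero differences.
\<close>

lemma not_closed_order_dense:
  assumes \<Gamma>: "real_subgroup \<Gamma>" and nc: "\<Gamma> \<noteq> closure \<Gamma>"
  shows "order_dense \<Gamma>"
proof (rule order_dense_of_small[OF \<Gamma>])
  fix e :: real assume e: "e > 0"
  obtain x where x: "x \<in> closure \<Gamma>" "x \<notin> \<Gamma>" using nc closure_subset by blast
  obtain g where g: "g \<in> \<Gamma>" "dist g x < e / 2" using x(1) e unfolding closure_approachable by (metis half_gt_zero)
  have "0 < dist g x" using g(1) x(2) by (metis zero_less_dist_iff)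
  then obtain h where h: "h \<in> \<Gamma>" "dist h x < dist g x" using x(1) unfolding closure_approachable by blast
  have "g \<noteq> h" "\<bar>g - h\<bar> < e" using h g unfolding dist_real_def by (auto, linarith)
  moreover have "\<bar>g - h\<bar> \<in> \<Gamma>" using real_subgroupD(2)[OF \<Gamma>] g h by (simp add: abs_if)
  ultimately show "\<exists>g\<in>\<Gamma>. 0 < g \<and> g < e" by (intro bexI[of _ "\<bar>g - h\<bar>"]) auto
qed

text \<open>
  Elements of \<open>S\<close> approaching an infimum that is not attained would have arbitrarily small differences. Then \<open>\<Gamma>\<close> would
  be dense and closed, hence all of \<open>\<real>\<close>, although it is countable.
\<close>

lemma closed_rational_has_min:
  assumes \<Gamma>: "real_subgroup \<Gamma>" and closed: "\<Gamma> = closure \<Gamma>" and rat: "\<Gamma> \<subseteq> \<rat>" and S: "cut \<Gamma> S"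
  shows "has_min S"
proof (rule ccontr)
  assume nomin: "\<not> has_min S"
  have "order_dense \<Gamma>"
  proof (rule order_dense_of_small[OF \<Gamma>])
    fix e :: real assume "e > 0"
    then obtain s where s: "s \<in> S" "s < Inf S + e" using cInf_lessD[OF cutD(2)[OF S], of "Inf S + e"] by auto
    obtain t where t: "t \<in> S" "t < s" using nomin s(1) unfolding has_min_def by (meson not_le)
    have "Inf S \<le> t" using cInf_lower[OF t(1) cutD(3)[OF S]] .
    moreover have "s - t \<in> \<Gamma>" using real_subgroupD(2)[OF \<Gamma>] cutD(1)[OF S] s t by blast
    ultimately show "\<exists>g\<in>\<Gamma>. 0 < g \<and> g < e" using s t by (intro bexI[of _ "s - t"]) auto
  qed
  have "x \<in> closure \<Gamma>" for x
    unfolding closure_approachable dist_real_def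
  proof (intro allI impI)
    fix e :: real assume "0 < e"
    then have "x < x + e" by simp
    then obtain g where "g \<in> \<Gamma>" "x < g" "g < x + e"
      using \<open>order_dense \<Gamma>\<close> unfolding order_dense_def by blast
    then show "\<exists>y\<in>\<Gamma>. \<bar>y - x\<bar> < e" by (intro bexI[of _ g]) auto
  qed
  then have "\<rat> = (UNIV :: real set)" using closed rat by blast
  then show False using countable_rat uncountable_UNIV_real by metis
qed

lemma cut_nonneg: "real_subgroup \<Gamma> \<Longrightarrow> cut \<Gamma> {g \<in> \<Gamma>. 0 \<le> g}"
  by (auto simp: cut_def real_subgroup_def intro!: bdd_belowI[of _ 0])

lemma has_min_atLeast: "r \<in> \<Gamma> \<Longrightarrow> has_min {g \<in> \<Gamma>. r \<le> g}"
  by (auto simp: has_min_def)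

text \<open>
  A real \<open>r\<close> is the infimum of the elements of \<open>\<Gamma>\<close> beyond it, without being a minimum; it is here that density is
  used.
\<close>

lemma cut_with_class:
  assumes \<Gamma>: "real_subgroup \<Gamma>" and dense: "order_dense \<Gamma>"
    and c: "c \<in> carrier (adjoin_identity (real_additive Mod \<Gamma>))"
  obtains S where "cut \<Gamma> S" "cut_class \<Gamma> S = c"
proof (cases c)
  case None
  then show thesis using that[OF cut_nonneg[OF \<Gamma>]] has_min_atLeast real_subgroupD(1)[OF \<Gamma>]
    by (simp add: cut_class_def)
next
  case (Some W)
  then obtain r where r: "W = \<Gamma> #>\<^bsub>real_additive\<^esub> r"
    using c by (auto simp: adjoin_identity_def FactGroup_def RCOSETS_def real_additive_def)
  define S where "S = {g \<in> \<Gamma>. r < g}"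
  have near: "\<exists>s\<in>S. s < b" if "r < b" for b
    using dense that unfolding order_dense_def S_def by blast
  have S: "cut \<Gamma> S" using near[of "r + 1"] by (auto simp: cut_def S_def intro!: bdd_belowI[of _ r])
  have "\<not> has_min S" using near by (force simp: has_min_def S_def)
  moreover have "Inf S = r"
  proof (rule cInf_eq_non_empty)
    show "S \<noteq> {}" using cutD(2)[OF S] .
    show "r \<le> s" if "s \<in> S" for s using that by (simp add: S_def)
    show "y \<le> r" if "\<And>s. s \<in> S \<Longrightarrow> y \<le> s" for y
      using near[of y] that by (force simp: not_le)
  qed
  ultimately show thesis using that[OF S] Some r by (simp add: cut_class_def)
qed

text \<open>
  Adding the up-set of \<open>h\<close> is the same as translating by \<open>h\<close>: the cuts with a minimum are units, and for \<open>h = 0\<close> one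
  gets the identity law.
\<close>

lemma sum_atLeast_cut:
  assumes \<Gamma>: "real_subgroup \<Gamma>" and S: "cut \<Gamma> S" and h: "h \<in> \<Gamma>"
  shows "{s + t | s t. s \<in> {g \<in> \<Gamma>. h \<le> g} \<and> t \<in> S} = (\<lambda>t. h + t) ` S"
proof
  show "{s + t | s t. s \<in> {g \<in> \<Gamma>. h \<le> g} \<and> t \<in> S} \<subseteq> (\<lambda>t. h + t) ` S"
  proof clarify
    fix s t assume st: "s \<in> \<Gamma>" "h \<le> s" "t \<in> S"
    have "(s - h) + t \<in> \<Gamma>" using real_subgroupD(2,4)[OF \<Gamma>] st h cutD(1)[OF S] by blast
    then have "(s - h) + t \<in> S" using cutD(4)[OF S st(3)] st(2) by simp
    then show "s + t \<in> (\<lambda>t. h + t) ` S" by (rule rev_image_eqI) simp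
  qed
  show "(\<lambda>t. h + t) ` S \<subseteq> {s + t | s t. s \<in> {g \<in> \<Gamma>. h \<le> g} \<and> t \<in> S}" using h by auto
qed

lemma shift_atLeast:
  assumes \<Gamma>: "real_subgroup \<Gamma>" and h: "h \<in> \<Gamma>"
  shows "(\<lambda>t. h + t) ` {g \<in> \<Gamma>. k \<le> g} = {g \<in> \<Gamma>. h + k \<le> g}"
proof
  show "(\<lambda>t. h + t) ` {g \<in> \<Gamma>. k \<le> g} \<subseteq> {g \<in> \<Gamma>. h + k \<le> g}" using real_subgroupD(4)[OF \<Gamma> h] by auto
  show "{g \<in> \<Gamma>. h + k \<le> g} \<subseteq> (\<lambda>t. h + t) ` {g \<in> \<Gamma>. k \<le> g}"
  proof clarify
    fix g assume "g \<in> \<Gamma>" "h + k \<le> g"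
    then show "g \<in> (\<lambda>t. h + t) ` {g \<in> \<Gamma>. k \<le> g}"
      using real_subgroupD(2)[OF \<Gamma>, of g h] h by (intro image_eqI[of _ _ "g - h"]) auto
  qed
qed

lemma cut_atLeast:
  assumes "r \<in> \<Gamma>" shows "cut \<Gamma> {g \<in> \<Gamma>. r \<le> g}"
  using assms by (auto simp: cut_def intro!: bdd_belowI[of _ r])

text \<open>
  The pseudo-inverse of a coset is its inverse. The last conclusion lets one choose
  pseudo-inverses componentwise without leaving a direct sum.
\<close>

lemma adjoin_identity_regular:
  assumes \<Gamma>: "real_subgroup \<Gamma>" and x: "x \<in> carrier (adjoin_identity (real_additive Mod \<Gamma>))"
  obtains y where "y \<in> carrier (adjoin_identity (real_additive Mod \<Gamma>))"
    "x = x \<otimes>\<^bsub>adjoin_identity (real_additive Mod \<Gamma>)\<^esub> y \<otimes>\<^bsub>adjoin_identity (real_additive Mod \<Gamma>)\<^esub> x"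
    "x = None \<Longrightarrow> y = None"
proof (cases x)
  case None
  then show thesis using that[of None] by (simp add: adjoin_identity_def)
next
  case (Some W)
  then obtain r where r: "W = \<Gamma> #>\<^bsub>real_additive\<^esub> r"
    using x by (auto simp: adjoin_identity_def FactGroup_def RCOSETS_def real_additive_def)
  show thesis
  proof (rule that[of "Some (\<Gamma> #>\<^bsub>real_additive\<^esub> (- r))"])
    show "Some (\<Gamma> #>\<^bsub>real_additive\<^esub> (- r)) \<in> carrier (adjoin_identity (real_additive Mod \<Gamma>))"
      by (auto simp: adjoin_identity_def FactGroup_def RCOSETS_def real_additive_def)
    show "x = x \<otimes>\<^bsub>adjoin_identity (real_additive Mod \<Gamma>)\<^esub> Some (\<Gamma> #>\<^bsub>real_additive\<^esub> (- r))
        \<otimes>\<^bsub>adjoin_identity (real_additive Mod \<Gamma>)\<^esub> x"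
      using real_coset_mult[OF \<Gamma>] by (simp add: Some r adjoin_identity_def FactGroup_def)
  qed (simp add: Some)
qed

section \<open>Maximal ideals of subrings\<close>

text \<open>
  Krull's theorem, by Zorn's lemma.
\<close>

lemma (in cring) proper_ideal_in_maximalideal:
  assumes I: "ideal I R" and proper: "\<one> \<notin> I"
  obtains M where "maximalideal M R" "I \<subseteq> M"
proof -
  define S where "S = {J. ideal J R \<and> I \<subseteq> J \<and> \<one> \<notin> J}"
  have "\<exists>M\<in>S. \<forall>J\<in>S. M \<subseteq> J \<longrightarrow> J = M"
  proof (rule subset_Zorn)
    fix C assume C: "subset.chain S C"
    show "\<exists>U\<in>S. \<forall>J\<in>C. J \<subseteq> U"
    proof (cases "C = {}")
      case True
      then show ?thesis using I proper by (auto simp: S_def)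
    next
      case False
      have CS: "C \<subseteq> S" using C by (simp add: pred_on.chain_def)
      have "subset.chain {J. ideal J R} C"
        using C by (auto simp: pred_on.chain_def S_def)
      from chain_Union_is_ideal[OF this] have "ideal (\<Union>C) R" using False by simp
      then have "\<Union>C \<in> S" using CS False by (fastforce simp: S_def)
      then show ?thesis by blast
    qed
  qed
  then obtain M where M: "M \<in> S" "\<And>J. J \<in> S \<Longrightarrow> M \<subseteq> J \<Longrightarrow> J = M" by blast
  have "maximalideal M R"
  proof (rule maximalidealI)
    show "ideal M R" "carrier R \<noteq> M" using M(1) by (auto simp: S_def)
    show "J = M \<or> J = carrier R" if "ideal J R" "M \<subseteq> J" "J \<subseteq> carrier R" for J
    proof (cases "\<one> \<in> J")
      case True
      then show ?thesis using ideal.one_imp_carrier that(1) by blast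
    next
      case False
      then have "J \<in> S" using that M(1) by (auto simp: S_def)
      then show ?thesis using M(2) that(2) by blast
    qed
  qed
  then show thesis using that M(1) by (auto simp: S_def)
qed

lemma (in cring) subring_is_cring: "subring B R \<Longrightarrow> cring (R\<lparr>carrier := B\<rparr>)"
  using subcringI' subcring_iff subringE(1) by blast

lemma (in cring) ideal_of_subringI:
  assumes B: "subring B R" and "I \<subseteq> B" "\<zero> \<in> I"
    and add: "\<And>a b. a \<in> I \<Longrightarrow> b \<in> I \<Longrightarrow> a \<oplus> b \<in> I"
    and mult: "\<And>a b. a \<in> B \<Longrightarrow> b \<in> I \<Longrightarrow> a \<otimes> b \<in> I"
  shows "ideal I (R\<lparr>carrier := B\<rparr>)"
proof -
  interpret B: cring "R\<lparr>carrier := B\<rparr>" using subring_is_cring[OF B] .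
  have sub: "B \<subseteq> carrier R" and neg1: "\<ominus> \<one> \<in> B" using subringE[OF B] by auto
  have neg: "\<ominus>\<^bsub>R\<lparr>carrier := B\<rparr>\<^esub> x \<in> I" if "x \<in> I" for x
  proof -
    have x: "x \<in> B" "x \<in> carrier R" using that assms(2) sub by auto
    have "\<ominus> x = (\<ominus> \<one>) \<otimes> x" using x by (simp add: l_minus)
    then have "\<ominus> x \<in> I" using mult[OF neg1 that] by simp
    moreover have "\<ominus> x \<in> B" using subringE(5)[OF B x(1)] .
    moreover have "x \<oplus>\<^bsub>R\<lparr>carrier := B\<rparr>\<^esub> (\<ominus> x) = \<zero>\<^bsub>R\<lparr>carrier := B\<rparr>\<^esub>" using x by (simp add: r_neg)
    ultimately show ?thesis using B.sum_zero_eq_neg B.minus_minus B.minus_equality x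
      by (metis B.add.m_comm partial_object.select_convs(1) partial_object.surjective partial_object.update_convs(1))
  qed
  show ?thesis
  proof (rule idealI)
    show "ring (R\<lparr>carrier := B\<rparr>)" by (rule B.ring_axioms)
    show "subgroup I (add_monoid (R\<lparr>carrier := B\<rparr>))"
      by (rule B.add.subgroupI) (use assms neg in \<open>auto simp: a_inv_def\<close>)
    show "x \<otimes>\<^bsub>R\<lparr>carrier := B\<rparr>\<^esub> a \<in> I" "a \<otimes>\<^bsub>R\<lparr>carrier := B\<rparr>\<^esub> x \<in> I"
      if "a \<in> I" "x \<in> carrier (R\<lparr>carrier := B\<rparr>)" for a x
    proof -
      show "x \<otimes>\<^bsub>R\<lparr>carrier := B\<rparr>\<^esub> a \<in> I" using that mult by simp
      moreover have "a \<otimes>\<^bsub>R\<lparr>carrier := B\<rparr>\<^esub> x = x \<otimes>\<^bsub>R\<lparr>carrier := B\<rparr>\<^esub> a"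
        using that assms(2) B.m_comm by auto
      ultimately show "a \<otimes>\<^bsub>R\<lparr>carrier := B\<rparr>\<^esub> x \<in> I" by simp
    qed
  qed
qed

lemma (in cring) ideal_of_subringE:
  assumes B: "subring B R" and I: "ideal I (R\<lparr>carrier := B\<rparr>)"
  shows "I \<subseteq> B" "\<zero> \<in> I"
    and "\<And>a b. a \<in> I \<Longrightarrow> b \<in> I \<Longrightarrow> a \<oplus> b \<in> I"
    and "\<And>a b. a \<in> B \<Longrightarrow> b \<in> I \<Longrightarrow> a \<otimes> b \<in> I"
proof -
  interpret I: ideal I "R\<lparr>carrier := B\<rparr>" by (rule I)
  show "I \<subseteq> B" "\<zero> \<in> I" using I.a_subset additive_subgroup.zero_closed[OF I.additive_subgroup_axioms] by auto
  show "a \<oplus> b \<in> I" if "a \<in> I" "b \<in> I" for a b using additive_subgroup.a_closed[OF I.additive_subgroup_axioms] that by simp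
  show "a \<otimes> b \<in> I" if "a \<in> B" "b \<in> I" for a b using I.I_l_closed that by simp
qed

text \<open>
  Together with the converse below, this describes maximal ideals by the operations of the ambient ring
  only: the quotient is a field. In this form they are easily transported by automorphisms.
\<close>

lemma (in cring) maximalideal_of_subringE:
  assumes B: "subring B R" and M: "maximalideal M (R\<lparr>carrier := B\<rparr>)"
  shows "\<one> \<notin> M"
    and "\<And>a. a \<in> B \<Longrightarrow> a \<notin> M \<Longrightarrow> \<exists>b\<in>B. \<exists>m\<in>M. \<one> = b \<otimes> a \<oplus> m"
    and "\<And>a b. a \<in> B \<Longrightarrow> b \<in> B \<Longrightarrow> a \<otimes> b \<in> M \<Longrightarrow> a \<in> M \<or> b \<in> M"
proof -
  interpret B: cring "R\<lparr>carrier := B\<rparr>" using subring_is_cring[OF B] .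
  interpret M: maximalideal M "R\<lparr>carrier := B\<rparr>" by (rule M)
  note ME = ideal_of_subringE[OF B M.ideal_axioms]
  note sub = subringE[OF B]
  show "\<one> \<notin> M" using M.I_notcarr M.one_imp_carrier by auto
  show "\<exists>b\<in>B. \<exists>m\<in>M. \<one> = b \<otimes> a \<oplus> m" if a: "a \<in> B" "a \<notin> M" for a
  proof -
    \<comment> \<open>the ideal generated by \<open>a\<close> and \<open>M\<close>\<close>
    define J where "J = {b \<otimes> a \<oplus> m | b m. b \<in> B \<and> m \<in> M}"
    have JI: "b \<otimes> a \<oplus> m \<in> J" if "b \<in> B" "m \<in> M" for b m using that by (auto simp: J_def)
    have JE: "\<exists>b\<in>B. \<exists>m\<in>M. x = b \<otimes> a \<oplus> m" if "x \<in> J" for x using that by (auto simp: J_def)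
    have car: "\<And>x. x \<in> B \<Longrightarrow> x \<in> carrier R" "\<And>x. x \<in> M \<Longrightarrow> x \<in> carrier R" using sub ME by auto
    have J: "ideal J (R\<lparr>carrier := B\<rparr>)"
    proof (rule ideal_of_subringI[OF B])
      show "J \<subseteq> B" using a sub(6,7) ME(1) by (auto simp: J_def)
      show "\<zero> \<in> J" using JI[OF sub(2) ME(2)] a car by simp
      show "x \<oplus> y \<in> J" if xy: "x \<in> J" "y \<in> J" for x y
      proof -
        obtain b m c n where e: "x = b \<otimes> a \<oplus> m" "y = c \<otimes> a \<oplus> n" "b \<in> B" "c \<in> B" "m \<in> M" "n \<in> M"
          using JE[OF xy(1)] JE[OF xy(2)] by blast
        have "x \<oplus> y = (b \<oplus> c) \<otimes> a \<oplus> (m \<oplus> n)" using e a car by (simp add: l_distr a_ac)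
        then show ?thesis using e sub(7) ME(3) JI by simp
      qed
      show "x \<otimes> y \<in> J" if xy: "x \<in> B" "y \<in> J" for x y
      proof -
        obtain c n where e: "y = c \<otimes> a \<oplus> n" "c \<in> B" "n \<in> M" using JE[OF xy(2)] by blast
        have "x \<otimes> y = (x \<otimes> c) \<otimes> a \<oplus> (x \<otimes> n)" using xy e a car by (simp add: r_distr m_ac)
        then show ?thesis using e xy sub(6) ME(4) JI by simp
      qed
    qed
    have "M \<subseteq> J"
    proof
      fix m assume "m \<in> M"
      moreover from this have "m = \<zero> \<otimes> a \<oplus> m" using car a by simp
      ultimately show "m \<in> J" using JI[OF sub(2), of m] by simp
    qed
    moreover have "a \<in> J"
    proof -
      have "a = \<one> \<otimes> a \<oplus> \<zero>" using a car by simp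
      then show ?thesis using JI[OF sub(3) ME(2)] by simp
    qed
    moreover have "J \<subseteq> B" using ideal_of_subringE(1)[OF B J] .
    ultimately have "J = B" using M.I_maximal[OF J] a by auto
    then show ?thesis using JE[of \<one>] sub(3) by blast
  qed
  show "a \<in> M \<or> b \<in> M" if "a \<in> B" "b \<in> B" "a \<otimes> b \<in> M" for a b
    using B.maximalideal_prime[OF M] that primeideal.I_prime[of M "R\<lparr>carrier := B\<rparr>" a b] by auto
qed

lemma (in cring) maximalideal_of_subringI:
  assumes B: "subring B R" and M: "ideal M (R\<lparr>carrier := B\<rparr>)" and one: "\<one> \<notin> M"
    and inv: "\<And>a. a \<in> B \<Longrightarrow> a \<notin> M \<Longrightarrow> \<exists>b\<in>B. \<exists>m\<in>M. \<one> = b \<otimes> a \<oplus> m"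
  shows "maximalideal M (R\<lparr>carrier := B\<rparr>)"
proof (rule maximalidealI[OF M])
  show "carrier (R\<lparr>carrier := B\<rparr>) \<noteq> M" using one subringE(3)[OF B] by auto
  fix J assume J: "ideal J (R\<lparr>carrier := B\<rparr>)" "M \<subseteq> J" "J \<subseteq> carrier (R\<lparr>carrier := B\<rparr>)"
  show "J = M \<or> J = carrier (R\<lparr>carrier := B\<rparr>)"
  proof (cases "J = M")
    case False
    then obtain a where a: "a \<in> J" "a \<notin> M" using J(2) by blast
    then obtain b m where b: "b \<in> B" "m \<in> M" "\<one> = b \<otimes> a \<oplus> m" using inv J(3) by auto blast
    have "\<one> \<in> J" using ideal_of_subringE[OF B J(1)] b a J(2) by auto
    then show ?thesis using ideal.one_imp_carrier[OF J(1)] by simp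
  qed simp
qed

section \<open>Fractional ideals and their local values\<close>

lemma (in cring) fractional_idealI:
  assumes B: "subring B R" and "I \<subseteq> carrier R" "\<zero> \<in> I"
    and add: "\<And>x y. x \<in> I \<Longrightarrow> y \<in> I \<Longrightarrow> x \<oplus> y \<in> I"
    and mult: "\<And>a x. a \<in> B \<Longrightarrow> x \<in> I \<Longrightarrow> a \<otimes> x \<in> I"
    and "x \<in> I" "x \<noteq> \<zero>" "d \<in> carrier R - {\<zero>}" "\<And>x. x \<in> I \<Longrightarrow> d \<otimes> x \<in> B"
  shows "fractional_ideal R B I"
proof -
  have "\<ominus> x \<in> I" if "x \<in> I" for x
  proof -
    have "x \<in> carrier R" using that assms(2) by auto
    then have "\<ominus> x = (\<ominus> \<one>) \<otimes> x" by (simp add: l_minus)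
    then show ?thesis using mult[OF subringE(5)[OF B subringE(3)[OF B]] that] by simp
  qed
  then have "subgroup I (add_monoid R)"
    by (intro add.subgroupI) (use assms in \<open>auto simp: a_inv_def\<close>)
  then show ?thesis using assms unfolding fractional_ideal_def by blast
qed

lemma (in cring) fractional_idealE:
  assumes "fractional_ideal R B I"
  shows "I \<subseteq> carrier R" "\<zero> \<in> I"
    and "\<And>x y. x \<in> I \<Longrightarrow> y \<in> I \<Longrightarrow> x \<oplus> y \<in> I"
    and "\<And>a x. a \<in> B \<Longrightarrow> x \<in> I \<Longrightarrow> a \<otimes> x \<in> I"
    and "\<exists>x\<in>I. x \<noteq> \<zero>" "\<exists>d\<in>carrier R - {\<zero>}. \<forall>x\<in>I. d \<otimes> x \<in> B"
proof -
  have s: "subgroup I (add_monoid R)" using assms by (simp add: fractional_ideal_def)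
  show "I \<subseteq> carrier R" "\<zero> \<in> I" "\<And>x y. x \<in> I \<Longrightarrow> y \<in> I \<Longrightarrow> x \<oplus> y \<in> I"
    using subgroup.subset[OF s] subgroup.one_closed[OF s] subgroup.m_closed[OF s] by auto
  have "I \<noteq> {\<zero>}" using assms by (simp add: fractional_ideal_def)
  then show "\<exists>x\<in>I. x \<noteq> \<zero>" using \<open>\<zero> \<in> I\<close> by blast
  show "\<And>a x. a \<in> B \<Longrightarrow> x \<in> I \<Longrightarrow> a \<otimes> x \<in> I" "\<exists>d\<in>carrier R - {\<zero>}. \<forall>x\<in>I. d \<otimes> x \<in> B"
    using assms by (simp_all add: fractional_ideal_def)
qed

text \<open>
  A domain of finite character all of whose localizations at maximal ideals are valuation rings of rank
  one; \<open>w M\<close> is a valuation with the localization at \<open>M\<close> as its valuation ring.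
\<close>

locale rank_one_finite_character = field L for L (structure) +
  fixes B :: "'a set" and w :: "'a set \<Rightarrow> 'a \<Rightarrow> real"
  assumes subring_B: "subring B L"
    and max_nonzero: "maximalideal M (L\<lparr>carrier := B\<rparr>) \<Longrightarrow> M \<noteq> {\<zero>}"
    and finite_char: "finite_character (L\<lparr>carrier := B\<rparr>)"
    and w_mult: "maximalideal M (L\<lparr>carrier := B\<rparr>) \<Longrightarrow> x \<in> carrier L - {\<zero>} \<Longrightarrow> y \<in> carrier L - {\<zero>} \<Longrightarrow>
                   w M (x \<otimes> y) = w M x + w M y"
    and w_add: "maximalideal M (L\<lparr>carrier := B\<rparr>) \<Longrightarrow> x \<in> carrier L - {\<zero>} \<Longrightarrow> y \<in> carrier L - {\<zero>} \<Longrightarrow>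
                   x \<oplus> y \<noteq> \<zero> \<Longrightarrow> min (w M x) (w M y) \<le> w M (x \<oplus> y)"
    and w_ring: "maximalideal M (L\<lparr>carrier := B\<rparr>) \<Longrightarrow>
                   {x \<in> carrier L. x = \<zero> \<or> w M x \<ge> 0} = {a \<otimes> inv s | a s. a \<in> B \<and> s \<in> B - M}"
begin

definition max_ideals :: "'a set set" where
  "max_ideals = {M. maximalideal M (L\<lparr>carrier := B\<rparr>)}"

definition vals :: "'a set \<Rightarrow> 'a set \<Rightarrow> real set" where
  "vals M I = w M ` (I - {\<zero>})"

abbreviation value_grp :: "'a set \<Rightarrow> real set" where
  "value_grp M \<equiv> vals M (carrier L)"

lemmas B_sub = subringE[OF subring_B]

lemma B_carrier: "x \<in> B \<Longrightarrow> x \<in> carrier L"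
  using B_sub(1) by blast

lemma max_ideal:
  assumes "M \<in> max_ideals"
  shows "M \<subseteq> B" "\<zero> \<in> M" "\<one> \<notin> M"
    and "\<And>a b. a \<in> M \<Longrightarrow> b \<in> M \<Longrightarrow> a \<oplus> b \<in> M"
    and "\<And>a b. a \<in> B \<Longrightarrow> b \<in> M \<Longrightarrow> a \<otimes> b \<in> M"
    and "\<And>a b. a \<in> B \<Longrightarrow> b \<in> B \<Longrightarrow> a \<otimes> b \<in> M \<Longrightarrow> a \<in> M \<or> b \<in> M"
proof -
  have M: "maximalideal M (L\<lparr>carrier := B\<rparr>)" using assms by (simp add: max_ideals_def)
  note I = maximalideal.axioms(1)[OF M]
  show "M \<subseteq> B" "\<zero> \<in> M" "\<one> \<notin> M"
    "\<And>a b. a \<in> M \<Longrightarrow> b \<in> M \<Longrightarrow> a \<oplus> b \<in> M" "\<And>a b. a \<in> B \<Longrightarrow> b \<in> M \<Longrightarrow> a \<otimes> b \<in> M"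
    "\<And>a b. a \<in> B \<Longrightarrow> b \<in> B \<Longrightarrow> a \<otimes> b \<in> M \<Longrightarrow> a \<in> M \<or> b \<in> M"
    using ideal_of_subringE[OF subring_B I] maximalideal_of_subringE[OF subring_B M] by auto
qed

lemma proper_in_max_ideal:
  assumes "ideal I (L\<lparr>carrier := B\<rparr>)" "\<one> \<notin> I"
  obtains M where "M \<in> max_ideals" "I \<subseteq> M"
  using cring.proper_ideal_in_maximalideal[OF subring_is_cring[OF subring_B] assms(1)] assms(2)
  by (auto simp: max_ideals_def)

lemma max_ideals_nonempty: "max_ideals \<noteq> {}"
proof -
  have "ideal {\<zero>} (L\<lparr>carrier := B\<rparr>)"
    using B_carrier B_sub by (intro ideal_of_subringI[OF subring_B]) auto
  then show ?thesis using proper_in_max_ideal[of "{\<zero>}"] by (metis empty_iff one_not_zero singletonD)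
qed

lemma max_ideal_antichain:
  assumes "M \<in> max_ideals" "N \<in> max_ideals" "N \<subseteq> M"
  shows "N = M"
proof -
  have N: "maximalideal N (L\<lparr>carrier := B\<rparr>)" and M: "maximalideal M (L\<lparr>carrier := B\<rparr>)"
    using assms by (auto simp: max_ideals_def)
  have "M = N \<or> M = B"
    using maximalideal.I_maximal[OF N maximalideal.axioms(1)[OF M] assms(3)] max_ideal(1)[OF assms(1)] by simp
  then show ?thesis using max_ideal(3)[OF assms(1)] B_sub(3) by auto
qed

lemma mult_nonzero: "x \<in> carrier L - {\<zero>} \<Longrightarrow> y \<in> carrier L - {\<zero>} \<Longrightarrow> x \<otimes> y \<in> carrier L - {\<zero>}"
  using integral_iff by auto

lemma inv_nonzero: "x \<in> carrier L - {\<zero>} \<Longrightarrow> inv x \<in> carrier L - {\<zero>}"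
  using field_Units Units_inv_Units by blast

lemma mult_inv: "x \<in> carrier L - {\<zero>} \<Longrightarrow> x \<otimes> inv x = \<one>"
  using field_Units Units_r_inv by blast

context
  fixes M assumes M: "M \<in> max_ideals"
begin

lemma val_mult: "x \<in> carrier L - {\<zero>} \<Longrightarrow> y \<in> carrier L - {\<zero>} \<Longrightarrow> w M (x \<otimes> y) = w M x + w M y"
  using w_mult M by (simp add: max_ideals_def)

lemma val_add: "x \<in> carrier L - {\<zero>} \<Longrightarrow> y \<in> carrier L - {\<zero>} \<Longrightarrow> x \<oplus> y \<noteq> \<zero> \<Longrightarrow>
    min (w M x) (w M y) \<le> w M (x \<oplus> y)"
  using w_add M by (simp add: max_ideals_def)

lemma val_nonneg_iff:
  "x \<in> carrier L - {\<zero>} \<Longrightarrow> 0 \<le> w M x \<longleftrightarrow> (\<exists>a\<in>B. \<exists>s\<in>B - M. x = a \<otimes> inv s)"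
proof -
  assume x: "x \<in> carrier L - {\<zero>}"
  have "x \<in> {x \<in> carrier L. x = \<zero> \<or> w M x \<ge> 0} \<longleftrightarrow> x \<in> {a \<otimes> inv s | a s. a \<in> B \<and> s \<in> B - M}"
    using w_ring[of M] M by (simp add: max_ideals_def)
  then show ?thesis using x by blast
qed

lemma val_one: "w M \<one> = 0"
  using val_mult[of \<one> \<one>] by simp

lemma val_inv: "x \<in> carrier L - {\<zero>} \<Longrightarrow> w M (inv x) = - w M x"
  using val_mult[of x "inv x"] inv_nonzero[of x] mult_inv[of x] val_one by simp

lemma val_B_nonneg:
  assumes "b \<in> B" "b \<noteq> \<zero>" shows "0 \<le> w M b"
proof -
  have "b = b \<otimes> inv \<one>" using B_carrier assms by simp
  then show ?thesis using val_nonneg_iff[of b] assms B_carrier B_sub(3) max_ideal(3)[OF M] by blast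
qed

lemma val_unit:
  assumes "s \<in> B - M" shows "w M s = 0"
proof -
  have s: "s \<in> carrier L - {\<zero>}" using assms B_carrier max_ideal(2)[OF M] by auto
  have "inv s = \<one> \<otimes> inv s" using inv_nonzero[OF s] by simp
  then have "0 \<le> w M (inv s)" using val_nonneg_iff[OF inv_nonzero[OF s]] assms B_sub(3) by blast
  moreover have "0 \<le> w M s" using val_B_nonneg assms s by auto
  ultimately show ?thesis using val_inv[OF s] by simp
qed

text \<open>
  If \<open>w M m = 0\<close>, then \<open>inv m\<close> lies in the localization, so \<open>m\<close> times some \<open>a\<close> in \<open>B\<close> is a denominator \<open>s\<close> outside \<open>M\<close>.
\<close>

lemma val_pos:
  assumes "m \<in> M" "m \<noteq> \<zero>" shows "0 < w M m"
proof (rule ccontr)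
  have m: "m \<in> carrier L - {\<zero>}" "m \<in> B" using assms B_carrier max_ideal(1)[OF M] by auto
  assume "\<not> 0 < w M m"
  then have "0 \<le> w M (inv m)" using val_inv[OF m(1)] by simp
  then obtain a s where as: "a \<in> B" "s \<in> B - M" "inv m = a \<otimes> inv s"
    using val_nonneg_iff[OF inv_nonzero[OF m(1)]] by blast
  have s: "s \<in> carrier L - {\<zero>}" using as B_carrier max_ideal(2)[OF M] by auto
  have "s = m \<otimes> inv m \<otimes> s" using mult_inv[OF m(1)] s by simp
  also have "\<dots> = a \<otimes> m \<otimes> (s \<otimes> inv s)" unfolding as(3)
    using as(1) m(1) s B_carrier inv_nonzero[OF s] by (simp add: m_ac)
  also have "\<dots> = a \<otimes> m" using mult_inv[OF s] as(1) m(1) B_carrier by simp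
  finally have "s = a \<otimes> m" .
  then have "s \<in> M" using max_ideal(5)[OF M as(1) assms(1)] by (rule ssubst)
  then show False using as(2) by blast
qed

lemma value_grp_zero: "0 \<in> value_grp M"
  unfolding vals_def using val_one by (auto intro!: image_eqI[of _ _ \<one>])

lemma value_grp_add:
  assumes "g \<in> value_grp M" "h \<in> value_grp M" shows "g + h \<in> value_grp M"
proof -
  obtain x y where xy: "x \<in> carrier L - {\<zero>}" "y \<in> carrier L - {\<zero>}" "g = w M x" "h = w M y"
    using assms unfolding vals_def by blast
  then have "g + h = w M (x \<otimes> y)" using val_mult by simp
  then show ?thesis unfolding vals_def using mult_nonzero[OF xy(1,2)] by blast
qed

lemma value_grp_uminus:
  assumes "g \<in> value_grp M" shows "- g \<in> value_grp M"
proof -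
  obtain x where x: "x \<in> carrier L - {\<zero>}" "g = w M x" using assms unfolding vals_def by blast
  then have "- g = w M (inv x)" using val_inv by simp
  then show ?thesis unfolding vals_def using inv_nonzero[OF x(1)] by blast
qed

text \<open>
  Since \<open>y / x\<close> lies in the localization at \<open>M\<close>, a multiple of \<open>y\<close> by an element outside \<open>M\<close> is a multiple of \<open>x\<close>.
\<close>

lemma local_unit_multiple:
  assumes I: "fractional_ideal L B I" and x: "x \<in> I" "x \<noteq> \<zero>" and y: "y \<in> carrier L - {\<zero>}"
    and le: "w M x \<le> w M y"
  obtains s where "s \<in> B - M" "s \<otimes> y \<in> I"
proof -
  have x': "x \<in> carrier L - {\<zero>}" using x fractional_idealE(1)[OF I] by auto
  have "0 \<le> w M (y \<otimes> inv x)" using val_mult[OF y inv_nonzero[OF x']] val_inv[OF x'] le by simp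
  then obtain a s where as: "a \<in> B" "s \<in> B - M" "y \<otimes> inv x = a \<otimes> inv s"
    using val_nonneg_iff[OF mult_nonzero[OF y inv_nonzero[OF x']]] by blast
  have s: "s \<in> carrier L - {\<zero>}" using as B_carrier max_ideal(2)[OF M] by auto
  have "s \<otimes> y = s \<otimes> (y \<otimes> (inv x \<otimes> x))"
    using mult_inv[OF x'] x' y s inv_nonzero[OF x'] by (simp add: m_comm)
  also have "\<dots> = s \<otimes> (y \<otimes> inv x) \<otimes> x"
    using x' y s inv_nonzero[OF x'] by (simp add: m_assoc)
  also have "\<dots> = (s \<otimes> inv s) \<otimes> (a \<otimes> x)" unfolding as(3)
    using x' s inv_nonzero[OF s] as B_carrier by (simp add: m_ac)
  also have "\<dots> = a \<otimes> x" using mult_inv[OF s] x' as B_carrier by simp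
  finally have "s \<otimes> y \<in> I" using fractional_idealE(4)[OF I as(1) x(1)] by simp
  then show thesis using that as(2) by blast
qed

lemma vals_up_closed:
  assumes I: "fractional_ideal L B I" and g: "g \<in> vals M I" "h \<in> value_grp M" "g \<le> h"
  shows "h \<in> vals M I"
proof -
  obtain x y where xy: "x \<in> I" "x \<noteq> \<zero>" "g = w M x" "y \<in> carrier L - {\<zero>}" "h = w M y"
    using g by (auto simp: vals_def)
  then obtain s where s: "s \<in> B - M" "s \<otimes> y \<in> I" using local_unit_multiple[OF I] g(3) by metis
  have s': "s \<in> carrier L - {\<zero>}" using s B_carrier max_ideal(2)[OF M] by auto
  have "w M (s \<otimes> y) = h" using val_mult[OF s' xy(4)] val_unit[OF s(1)] xy by simp
  then show ?thesis unfolding vals_def using s(2) mult_nonzero[OF s' xy(4)] by blast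
qed

end

text \<open>
  A fractional ideal is the intersection of its localizations: the ideal of all \<open>b\<close> with \<open>b x\<close> in \<open>I\<close> is contained in
  no maximal ideal, so it contains \<open>\<one>\<close>.
\<close>

lemma mem_iff_vals:
  assumes I: "fractional_ideal L B I" and x: "x \<in> carrier L - {\<zero>}"
  shows "x \<in> I \<longleftrightarrow> (\<forall>M\<in>max_ideals. w M x \<in> vals M I)"
proof
  show "x \<in> I \<Longrightarrow> \<forall>M\<in>max_ideals. w M x \<in> vals M I" using x by (auto simp: vals_def)
  assume loc: "\<forall>M\<in>max_ideals. w M x \<in> vals M I"
  note IE = fractional_idealE[OF I]
  define Q where "Q = {b \<in> B. b \<otimes> x \<in> I}"
  have "ideal Q (L\<lparr>carrier := B\<rparr>)"
  proof (rule ideal_of_subringI[OF subring_B])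
    show "Q \<subseteq> B" "\<zero> \<in> Q" using x IE(2) B_sub(2) by (auto simp: Q_def)
    show "a \<oplus> b \<in> Q" if "a \<in> Q" "b \<in> Q" for a b
      using that x IE(3) B_sub(7) B_carrier by (simp add: Q_def l_distr)
    show "a \<otimes> b \<in> Q" if "a \<in> B" "b \<in> Q" for a b
      using that x IE(4) B_sub(6) B_carrier by (simp add: Q_def m_assoc)
  qed
  moreover have "\<not> Q \<subseteq> M" if M: "M \<in> max_ideals" for M
  proof -
    have "w M x \<in> vals M I" using loc M by blast
    then obtain y where "y \<in> I - {\<zero>}" "w M x = w M y" unfolding vals_def by (rule imageE)
    then have "y \<in> I" "y \<noteq> \<zero>" "w M y \<le> w M x" by auto
    then obtain s where "s \<in> B - M" "s \<otimes> x \<in> I" using local_unit_multiple[OF M I _ _ x] by metis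
    then show ?thesis by (auto simp: Q_def)
  qed
  ultimately have "\<one> \<in> Q" using proper_in_max_ideal by metis
  then show "x \<in> I" using x by (simp add: Q_def)
qed

lemma fractional_ideal_eqI:
  assumes I: "fractional_ideal L B I" and J: "fractional_ideal L B J"
    and eq: "\<And>M. M \<in> max_ideals \<Longrightarrow> vals M I = vals M J"
  shows "I = J"
proof -
  have "x \<in> I \<longleftrightarrow> x \<in> J" if "x \<in> carrier L - {\<zero>}" for x
    using mem_iff_vals[OF I that] mem_iff_vals[OF J that] eq by simp
  then show ?thesis
    using fractional_idealE(1,2)[OF I] fractional_idealE(1,2)[OF J] by blast
qed

lemma fractional_ideal_B: "fractional_ideal L B B"
  by (rule fractional_idealI[OF subring_B B_sub(1,2,7,6), of \<one> \<one>]) (use B_sub(3) B_carrier in auto)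

lemma vals_B:
  assumes M: "M \<in> max_ideals" shows "vals M B = {g \<in> value_grp M. 0 \<le> g}"
proof
  show "vals M B \<subseteq> {g \<in> value_grp M. 0 \<le> g}"
    using val_B_nonneg[OF M] B_carrier by (auto simp: vals_def)
  have "0 \<in> vals M B" unfolding vals_def using val_one[OF M] B_sub(3) by (auto intro!: image_eqI[of _ _ \<one>])
  then show "{g \<in> value_grp M. 0 \<le> g} \<subseteq> vals M B"
    using vals_up_closed[OF M fractional_ideal_B] by blast
qed

lemma mem_B_iff:
  assumes "x \<in> carrier L - {\<zero>}" shows "x \<in> B \<longleftrightarrow> (\<forall>M\<in>max_ideals. 0 \<le> w M x)"
  using mem_iff_vals[OF fractional_ideal_B assms] vals_B assms by (auto simp: vals_def)

text \<open>
  Every element is a quotient of two elements of \<open>B\<close>, or its inverse is, since any one of the valuation rings contains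
  it or its inverse; and an element of \<open>B\<close> has nonzero value only at the maximal ideals that contain it.
\<close>

lemma finite_val_nonzero:
  assumes x: "x \<in> carrier L - {\<zero>}" shows "finite {M \<in> max_ideals. w M x \<noteq> 0}"
proof -
  have fin: "finite {M \<in> max_ideals. b \<in> M}" if "b \<in> B" "b \<noteq> \<zero>" for b
    using finite_char that by (simp add: finite_character_def max_ideals_def)
  have *: "finite {M \<in> max_ideals. w M y \<noteq> 0}"
    if y: "y \<in> carrier L - {\<zero>}" "M \<in> max_ideals" "0 \<le> w M y" for y M
  proof -
    obtain a s where as: "a \<in> B" "s \<in> B - M" "y = a \<otimes> inv s"
      using val_nonneg_iff y by blast
    have s: "s \<in> carrier L - {\<zero>}" using as B_carrier max_ideal(2)[OF y(2)] by auto
    have a: "a \<in> carrier L - {\<zero>}" using as y(1) B_carrier inv_nonzero[OF s] by auto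
    have "w N y = 0" if "N \<in> max_ideals" "a \<notin> N" "s \<notin> N" for N
      using val_mult[OF that(1) a inv_nonzero[OF s]] val_inv[OF that(1) s]
        val_unit[OF that(1)] that as by simp
    then have "{M \<in> max_ideals. w M y \<noteq> 0} \<subseteq> {M \<in> max_ideals. a \<in> M} \<union> {M \<in> max_ideals. s \<in> M}"
      by blast
    moreover have "finite \<dots>" using fin[of a] fin[of s] as(1,2) a s by simp
    ultimately show ?thesis by (rule finite_subset)
  qed
  obtain M where M: "M \<in> max_ideals" using max_ideals_nonempty by blast
  show ?thesis
  proof (cases "0 \<le> w M x")
    case False
    then have "finite {N \<in> max_ideals. w N (inv x) \<noteq> 0}"
      using *[OF inv_nonzero[OF x] M] val_inv[OF M x] by simp
    moreover have "{N \<in> max_ideals. w N (inv x) \<noteq> 0} = {N \<in> max_ideals. w N x \<noteq> 0}"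
      using val_inv[OF _ x] by auto
    ultimately show ?thesis by simp
  qed (use *[OF x M] in simp)
qed

text \<open>
  A product of high powers of elements of the given maximal ideals. The predicate \<open>Q\<close> keeps control of the
  factors elsewhere: it will be true of everything, or say that an element is outside one further maximal ideal.
\<close>

lemma large_values:
  assumes E: "finite E" "E \<subseteq> max_ideals"
    and Q: "Q \<one>" "\<And>a b. a \<in> B \<Longrightarrow> b \<in> B \<Longrightarrow> Q a \<Longrightarrow> Q b \<Longrightarrow> Q (a \<otimes> b)"
    and gen: "\<And>N. N \<in> E \<Longrightarrow> \<exists>b\<in>N. b \<noteq> \<zero> \<and> Q b"
  shows "\<exists>b\<in>B - {\<zero>}. Q b \<and> (\<forall>N\<in>E. c \<le> w N b)"
  using E gen
proof (induction E)
  case empty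
  then show ?case using Q(1) B_sub(3) by (intro bexI[of _ \<one>]) auto
next
  case (insert N E)
  then obtain b where b: "b \<in> B - {\<zero>}" "Q b" "\<forall>N\<in>E. c \<le> w N b" by auto
  have N: "N \<in> max_ideals" using insert by simp
  obtain m where m: "m \<in> N" "m \<noteq> \<zero>" "Q m" using insert.prems by blast
  have mB: "m \<in> B" using m max_ideal(1)[OF N] by auto
  have pos: "0 < w N m" using val_pos[OF N] m by simp
  \<comment> \<open>powers of \<open>m\<close>, whose values are unbounded because \<open>w N m\<close> is positive and the reals are archimedean\<close>
  have powers: "\<exists>b\<in>B - {\<zero>}. Q b \<and> real n * w N m \<le> w N b" for n
  proof (induction n)
    case 0
    then show ?case using Q(1) B_sub(3) val_one[OF N] by (intro bexI[of _ \<one>]) auto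
  next
    case (Suc n)
    then obtain b where b: "b \<in> B - {\<zero>}" "Q b" "real n * w N m \<le> w N b" by blast
    then have "w N (m \<otimes> b) = w N m + w N b" using val_mult[OF N, of m b] m mB B_carrier by auto
    moreover have "m \<otimes> b \<in> B - {\<zero>}"
      using B_sub(6)[OF mB, of b] mult_nonzero[of m b] b m mB B_carrier by auto
    ultimately show ?case using b Q(2)[OF mB _ m(3) b(2)] by (intro bexI[of _ "m \<otimes> b"]) (auto simp: algebra_simps)
  qed
  obtain n where "c < real n * w N m" using pos reals_Archimedean3 by blast
  with powers[of n] obtain p where p: "p \<in> B - {\<zero>}" "Q p" "c \<le> w N p"
    by (meson less_eq_real_def order_trans)
  have car: "p \<in> carrier L - {\<zero>}" "b \<in> carrier L - {\<zero>}" using p b B_carrier by auto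
  have val: "w N' (p \<otimes> b) = w N' p + w N' b" "0 \<le> w N' p" "0 \<le> w N' b" if "N' \<in> max_ideals" for N'
    using val_mult[OF that car] val_B_nonneg[OF that] p b by auto
  have "c \<le> w N' (p \<otimes> b)" if "N' \<in> insert N E" for N'
  proof -
    have "N' \<in> max_ideals" using that insert.prems by auto
    from val[OF this] show ?thesis using that p(3) b(3) by auto
  qed
  moreover have "p \<otimes> b \<in> B - {\<zero>}" using B_sub(6) p b mult_nonzero[OF car] by auto
  ultimately show ?case using Q(2) p b by blast
qed

section \<open>Fractional ideals as families of cuts\<close>


definition cut_family :: "('a set \<Rightarrow> real set) \<Rightarrow> bool" where
  "cut_family S \<longleftrightarrow>
     (\<forall>M\<in>max_ideals. cut (value_grp M) (S M)) \<and> finite {M \<in> max_ideals. S M \<noteq> vals M B}"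

definition cut_ideal :: "('a set \<Rightarrow> real set) \<Rightarrow> 'a set" where
  "cut_ideal S = {x \<in> carrier L. x = \<zero> \<or> (\<forall>M\<in>max_ideals. w M x \<in> S M)}"

lemma cut_familyD:
  assumes "cut_family S" "M \<in> max_ideals"
  shows "S M \<subseteq> value_grp M" "S M \<noteq> {}" "bdd_below (S M)"
    and "\<And>g h. g \<in> S M \<Longrightarrow> h \<in> value_grp M \<Longrightarrow> g \<le> h \<Longrightarrow> h \<in> S M"
  using assms by (auto simp: cut_family_def cut_def)

lemma nonzero_in_max_ideal:
  assumes "M \<in> max_ideals" obtains m where "m \<in> M" "m \<noteq> \<zero>"
  using max_nonzero[of M] max_ideal(2)[OF assms] assms by (auto simp: max_ideals_def)

lemma fractional_ideal_vals_bound: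
  assumes I: "fractional_ideal L B I"
  obtains d where "d \<in> carrier L - {\<zero>}" "\<And>M g. M \<in> max_ideals \<Longrightarrow> g \<in> vals M I \<Longrightarrow> - w M d \<le> g"
proof -
  obtain d where d: "d \<in> carrier L - {\<zero>}" "\<And>x. x \<in> I \<Longrightarrow> d \<otimes> x \<in> B"
    using fractional_idealE(6)[OF I] by blast
  have "- w M d \<le> g" if M: "M \<in> max_ideals" and g: "g \<in> vals M I" for M g
  proof -
    obtain x where x: "x \<in> I" "x \<noteq> \<zero>" "g = w M x" using g by (auto simp: vals_def)
    have car: "x \<in> carrier L - {\<zero>}" using x fractional_idealE(1)[OF I] by auto
    have "0 \<le> w M (d \<otimes> x)" using val_B_nonneg[OF M d(2)[OF x(1)]] mult_nonzero[OF d(1) car] by blast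
    then show ?thesis using val_mult[OF M d(1) car] x(3) by simp
  qed
  then show thesis using that d(1) by blast
qed

text \<open>
  With \<open>x\<close> in \<open>I\<close> and \<open>d I\<close> contained in \<open>B\<close>, the cut of \<open>I\<close> is trivial wherever \<open>x\<close> and \<open>d\<close> both have value \<open>0\<close>.
\<close>

lemma cut_family_vals:
  assumes I: "fractional_ideal L B I" shows "cut_family (\<lambda>M. vals M I)"
  unfolding cut_family_def cut_def
proof (intro conjI ballI impI)
  obtain d where d: "d \<in> carrier L - {\<zero>}" "\<And>M g. M \<in> max_ideals \<Longrightarrow> g \<in> vals M I \<Longrightarrow> - w M d \<le> g"
    by (rule fractional_ideal_vals_bound[OF I]) blast
  obtain x where x: "x \<in> I" "x \<noteq> \<zero>" using fractional_idealE(5)[OF I] by blast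
  fix M assume M: "M \<in> max_ideals"
  show "vals M I \<subseteq> value_grp M" using fractional_idealE(1)[OF I] by (auto simp: vals_def)
  show "vals M I \<noteq> {}" using x by (auto simp: vals_def)
  show "bdd_below (vals M I)" using d(2)[OF M] by (rule bdd_belowI)
  show "h \<in> vals M I" if "g \<in> vals M I" "h \<in> value_grp M" "g \<le> h" for g h
    using vals_up_closed[OF M I that] .
next
  obtain d where d: "d \<in> carrier L - {\<zero>}" "\<And>M g. M \<in> max_ideals \<Longrightarrow> g \<in> vals M I \<Longrightarrow> - w M d \<le> g"
    by (rule fractional_ideal_vals_bound[OF I]) blast
  obtain x where x: "x \<in> I" "x \<noteq> \<zero>" using fractional_idealE(5)[OF I] by blast
  have car: "x \<in> carrier L - {\<zero>}" using x fractional_idealE(1)[OF I] by auto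
  have "vals M I = vals M B" if M: "M \<in> max_ideals" and 0: "w M d = 0" "w M x = 0" for M
  proof -
    have "0 \<in> vals M I" unfolding vals_def using x 0(2) by (auto intro!: image_eqI[of _ _ x])
    then have "{g \<in> value_grp M. 0 \<le> g} \<subseteq> vals M I" using vals_up_closed[OF M I] by blast
    moreover have "vals M I \<subseteq> {g \<in> value_grp M. 0 \<le> g}"
      using d(2)[OF M] 0(1) fractional_idealE(1)[OF I] by (auto simp: vals_def)
    ultimately show ?thesis using vals_B[OF M] by simp
  qed
  then have "{M \<in> max_ideals. vals M I \<noteq> vals M B} \<subseteq>
      {M \<in> max_ideals. w M d \<noteq> 0} \<union> {M \<in> max_ideals. w M x \<noteq> 0}" by blast
  then show "finite {M \<in> max_ideals. vals M I \<noteq> vals M B}"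
    by (rule finite_subset) (use finite_val_nonzero d(1) car in simp)
qed

text \<open>
  An element \<open>x\<close> with \<open>w M x = g\<close> violates the conditions at only finitely many other maximal ideals. Multiplying
  it by an element \<open>b\<close> of \<open>B\<close> that lies outside \<open>M\<close> and has large values there repairs this: the value at \<open>M\<close> stays the
  same, and no other value decreases.
\<close>

lemma element_with_values:
  assumes S: "cut_family S" and M: "M \<in> max_ideals" and g: "g \<in> S M"
  obtains x where "x \<in> cut_ideal S" "x \<noteq> \<zero>" "w M x = g"
proof -
  obtain x where x: "x \<in> carrier L - {\<zero>}" "g = w M x"
    using cut_familyD(1)[OF S M] g by (auto simp: vals_def)
  define E where "E = {N \<in> max_ideals - {M}. w N x \<notin> S N}"
  have "w N x \<in> S N" if N: "N \<in> max_ideals" "w N x = 0" "S N = vals N B" for N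
    using that value_grp_zero[OF N(1)] vals_B[OF N(1)] by simp
  then have "E \<subseteq> {N \<in> max_ideals. w N x \<noteq> 0} \<union> {N \<in> max_ideals. S N \<noteq> vals N B}"
    by (auto simp: E_def)
  then have E: "finite E" "E \<subseteq> max_ideals"
    using finite_val_nonzero[OF x(1)] S by (auto simp: cut_family_def E_def intro: finite_subset)
  define t where "t N = (SOME t. t \<in> S N)" for N
  have t: "t N \<in> S N" if "N \<in> max_ideals" for N
    unfolding t_def using cut_familyD(2)[OF S that] by (simp add: some_in_eq)
  \<comment> \<open>one bound that is large enough at all exceptional \<open>N\<close>\<close>
  define c where "c = (\<Sum>N\<in>E. \<bar>t N - w N x\<bar>)"
  have "\<exists>b\<in>N. b \<noteq> \<zero> \<and> b \<notin> M" if N: "N \<in> E" for N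
  proof -
    have "\<not> N \<subseteq> M" using max_ideal_antichain[OF M, of N] N by (auto simp: E_def)
    then obtain b where "b \<in> N" "b \<notin> M" by blast
    then show ?thesis using max_ideal(2)[OF M] by metis
  qed
  then obtain b where b: "b \<in> B - {\<zero>}" "b \<notin> M" "\<forall>N\<in>E. c \<le> w N b"
    using large_values[OF E, of "\<lambda>b. b \<notin> M" c] max_ideal(3,6)[OF M] by metis
  have bc: "b \<in> carrier L - {\<zero>}" using b(1) B_carrier by auto
  have "w N (b \<otimes> x) \<in> S N" if N: "N \<in> max_ideals" for N
  proof -
    have w: "w N (b \<otimes> x) = w N b + w N x" "0 \<le> w N b" using val_mult[OF N bc x(1)] val_B_nonneg[OF N] b by auto
    have "w N (b \<otimes> x) \<in> value_grp N" unfolding vals_def using mult_nonzero[OF bc x(1)] by blast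
    moreover have "\<exists>s\<in>S N. s \<le> w N (b \<otimes> x)"
    proof (cases "N \<in> E")
      case True
      have "\<bar>t N - w N x\<bar> \<le> c" unfolding c_def by (rule member_le_sum) (use True E in auto)
      then have "t N \<le> w N (b \<otimes> x)" using b(3) True w(1) by fastforce
      then show ?thesis using t[OF N] by blast
    next
      case False
      then have "w N x \<in> S N" using g x(2) N by (auto simp: E_def)
      then show ?thesis using w by (intro bexI[of _ "w N x"]) auto
    qed
    ultimately show ?thesis using cut_familyD(4)[OF S N] by blast
  qed
  then have "b \<otimes> x \<in> cut_ideal S" using mult_nonzero[OF bc x(1)] by (auto simp: cut_ideal_def)
  moreover have "w M (b \<otimes> x) = g" using val_mult[OF M bc x(1)] val_unit[OF M, of b] b x(2) by simp
  ultimately show thesis using that mult_nonzero[OF bc x(1)] by blast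
qed

text \<open>
  A common denominator \<open>d\<close> needs large values only at the finitely many places with a nontrivial cut.
\<close>

lemma fractional_ideal_cut_ideal:
  assumes S: "cut_family S" shows "fractional_ideal L B (cut_ideal S)"
proof -
  obtain M where M: "M \<in> max_ideals" using max_ideals_nonempty by blast
  then obtain x where x: "x \<in> cut_ideal S" "x \<noteq> \<zero>"
    using element_with_values[OF S M] cut_familyD(2)[OF S M] by blast
  define E where "E = {N \<in> max_ideals. S N \<noteq> vals N B}"
  have E: "finite E" "E \<subseteq> max_ideals" using S by (auto simp: E_def cut_family_def)
  define c where "c = (\<Sum>N\<in>E. \<bar>Inf (S N)\<bar>)"
  obtain d where d: "d \<in> B - {\<zero>}" "\<forall>N\<in>E. c \<le> w N d"
    using large_values[OF E, of "\<lambda>_. True" c] nonzero_in_max_ideal E(2) by (metis subsetD)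
  have dc: "d \<in> carrier L - {\<zero>}" using d B_carrier by auto
  have w: "w N (y \<otimes> z) = w N y + w N z"
    if "N \<in> max_ideals" "y \<in> carrier L - {\<zero>}" "z \<in> carrier L - {\<zero>}" for N y z
    using val_mult that by blast
  show ?thesis
  proof (rule fractional_idealI[OF subring_B _ _ _ _ x dc])
    show "cut_ideal S \<subseteq> carrier L" "\<zero> \<in> cut_ideal S" by (auto simp: cut_ideal_def)
    show "y \<oplus> z \<in> cut_ideal S" if "y \<in> cut_ideal S" "z \<in> cut_ideal S" for y z
    proof (cases "y = \<zero> \<or> z = \<zero> \<or> y \<oplus> z = \<zero>")
      case True
      then show ?thesis using that by (auto simp: cut_ideal_def)
    next
      case False
      then have yz: "y \<in> carrier L - {\<zero>}" "z \<in> carrier L - {\<zero>}" "y \<oplus> z \<in> carrier L - {\<zero>}"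
        using that by (auto simp: cut_ideal_def)
      have "w N (y \<oplus> z) \<in> S N" if N: "N \<in> max_ideals" for N
      proof (rule cut_familyD(4)[OF S N, of "min (w N y) (w N z)"])
        show "min (w N y) (w N z) \<in> S N"
          using \<open>y \<in> cut_ideal S\<close> \<open>z \<in> cut_ideal S\<close> yz N by (auto simp: cut_ideal_def min_def)
        show "w N (y \<oplus> z) \<in> value_grp N" unfolding vals_def using yz by blast
        show "min (w N y) (w N z) \<le> w N (y \<oplus> z)" using val_add[OF N yz(1,2)] False by blast
      qed
      then show ?thesis using yz by (auto simp: cut_ideal_def)
    qed
    show "a \<otimes> y \<in> cut_ideal S" if "a \<in> B" "y \<in> cut_ideal S" for a y
    proof (cases "a = \<zero> \<or> y = \<zero>")
      case True
      then show ?thesis using that B_carrier by (auto simp: cut_ideal_def)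
    next
      case False
      then have c: "a \<in> carrier L - {\<zero>}" "y \<in> carrier L - {\<zero>}"
        using that B_carrier by (auto simp: cut_ideal_def)
      have "w N (a \<otimes> y) \<in> S N" if N: "N \<in> max_ideals" for N
      proof (rule cut_familyD(4)[OF S N, of "w N y"])
        show "w N y \<in> S N" using \<open>y \<in> cut_ideal S\<close> c N by (auto simp: cut_ideal_def)
        show "w N (a \<otimes> y) \<in> value_grp N" unfolding vals_def using mult_nonzero[OF c] by blast
        show "w N y \<le> w N (a \<otimes> y)" using w[OF N c] val_B_nonneg[OF N \<open>a \<in> B\<close>] c by simp
      qed
      then show ?thesis using mult_nonzero[OF c] by (auto simp: cut_ideal_def)
    qed
    show "d \<otimes> y \<in> B" if y: "y \<in> cut_ideal S" for y
    proof (cases "y = \<zero>")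
      case True
      then show ?thesis using dc B_sub(2) by simp
    next
      case False
      then have yc: "y \<in> carrier L - {\<zero>}" using y by (auto simp: cut_ideal_def)
      have "0 \<le> w N (d \<otimes> y)" if N: "N \<in> max_ideals" for N
      proof (cases "N \<in> E")
        case True
        have "\<bar>Inf (S N)\<bar> \<le> c" unfolding c_def by (rule member_le_sum) (use True E in auto)
        moreover have "Inf (S N) \<le> w N y"
          using cut_familyD(3)[OF S N] y yc N by (intro cInf_lower) (auto simp: cut_ideal_def)
        ultimately show ?thesis using w[OF N dc yc] d(2) True by fastforce
      next
        case False
        then have "w N y \<in> vals N B" using y yc N by (auto simp: E_def cut_ideal_def)
        then show ?thesis using w[OF N dc yc] vals_B[OF N] val_B_nonneg[OF N, of d] d by auto
      qed
      then show ?thesis using mem_B_iff[OF mult_nonzero[OF dc yc]] by blast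
    qed
  qed
qed

lemma vals_cut_ideal:
  assumes S: "cut_family S" and M: "M \<in> max_ideals" shows "vals M (cut_ideal S) = S M"
proof
  show "vals M (cut_ideal S) \<subseteq> S M" using M by (auto simp: vals_def cut_ideal_def)
  show "S M \<subseteq> vals M (cut_ideal S)"
  proof
    fix g assume "g \<in> S M"
    then obtain x where "x \<in> cut_ideal S" "x \<noteq> \<zero>" "w M x = g" using element_with_values[OF S M] by blast
    then show "g \<in> vals M (cut_ideal S)" unfolding vals_def by blast
  qed
qed

lemma fractional_ideal_prod:
  assumes I: "fractional_ideal L B I" and J: "fractional_ideal L B J"
  shows "fractional_ideal L B (ideal_prod L I J)"
proof -
  note IE = fractional_idealE[OF I] and JE = fractional_idealE[OF J]
  obtain x y where x: "x \<in> I" "x \<noteq> \<zero>" and y: "y \<in> J" "y \<noteq> \<zero>" using IE(5) JE(5) by blast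
  have xy: "x \<in> carrier L - {\<zero>}" "y \<in> carrier L - {\<zero>}" using x y IE(1) JE(1) by auto
  obtain d e where d: "d \<in> carrier L - {\<zero>}" "\<forall>x\<in>I. d \<otimes> x \<in> B" and e: "e \<in> carrier L - {\<zero>}" "\<forall>x\<in>J. e \<otimes> x \<in> B"
    using IE(6) JE(6) by blast
  have car: "z \<in> carrier L" if "z \<in> ideal_prod L I J" for z
    using that by induction (use IE(1) JE(1) in auto)
  show ?thesis
  proof (rule fractional_idealI[OF subring_B])
    show "ideal_prod L I J \<subseteq> carrier L" using car by blast
    show "\<zero> \<in> ideal_prod L I J" using ideal_prod.prod[OF IE(2) JE(2), of L] by simp
    show "a \<oplus> b \<in> ideal_prod L I J" if "a \<in> ideal_prod L I J" "b \<in> ideal_prod L I J" for a b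
      using that by (rule ideal_prod.sum)
    show "a \<otimes> z \<in> ideal_prod L I J" if a: "a \<in> B" and z: "z \<in> ideal_prod L I J" for a z
      using z
    proof induction
      case (prod i j)
      then have "a \<otimes> (i \<otimes> j) = (a \<otimes> i) \<otimes> j" using a B_carrier IE(1) JE(1) by (simp add: m_assoc subset_iff)
      then show ?case using ideal_prod.prod[OF IE(4)[OF a prod(1)] prod(2), of L] by simp
    next
      case (sum s t)
      then show ?case using ideal_prod.sum[OF sum(3,4)] car a B_carrier by (simp add: r_distr)
    qed
    show "x \<otimes> y \<in> ideal_prod L I J" using x y by (intro ideal_prod.prod)
    show "x \<otimes> y \<noteq> \<zero>" "d \<otimes> e \<in> carrier L - {\<zero>}" using mult_nonzero[OF xy] mult_nonzero[OF d(1) e(1)] by auto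
    show "(d \<otimes> e) \<otimes> z \<in> B" if z: "z \<in> ideal_prod L I J" for z
      using z
    proof induction
      case (prod i j)
      have "(d \<otimes> e) \<otimes> (i \<otimes> j) = (d \<otimes> i) \<otimes> (e \<otimes> j)"
        using d(1) e(1) subsetD[OF IE(1) prod(1)] subsetD[OF JE(1) prod(2)] by (simp add: m_ac)
      then show ?case using B_sub(6) d(2) e(2) prod by simp
    next
      case (sum s t)
      then show ?case using B_sub(7)[OF sum(3,4)] car d e by (simp add: r_distr)
    qed
  qed
qed

text \<open>
  An element of the product is a sum of products, so by the ultrametric inequality its value is at least the
  value of one of the summands; the rest is up-closedness.
\<close>

lemma vals_prod:
  assumes I: "fractional_ideal L B I" and J: "fractional_ideal L B J" and M: "M \<in> max_ideals"
  shows "vals M (ideal_prod L I J) = {g + h | g h. g \<in> vals M I \<and> h \<in> vals M J}"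
proof
  note IE = fractional_idealE[OF I] and JE = fractional_idealE[OF J]
  note P = fractional_ideal_prod[OF I J]
  show "{g + h | g h. g \<in> vals M I \<and> h \<in> vals M J} \<subseteq> vals M (ideal_prod L I J)"
  proof clarify
    fix g h assume "g \<in> vals M I" "h \<in> vals M J"
    then obtain x y where x: "x \<in> I - {\<zero>}" "g = w M x" and y: "y \<in> J - {\<zero>}" "h = w M y"
      by (auto simp: vals_def)
    then have c: "x \<in> carrier L - {\<zero>}" "y \<in> carrier L - {\<zero>}" using IE(1) JE(1) by auto
    have "x \<otimes> y \<in> ideal_prod L I J - {\<zero>}" using ideal_prod.prod[of x I y J L] x y mult_nonzero[OF c] by simp
    moreover have "g + h = w M (x \<otimes> y)" using val_mult[OF M c] x y by simp
    ultimately show "g + h \<in> vals M (ideal_prod L I J)" unfolding vals_def by blast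
  qed
  have bound: "z = \<zero> \<or> (\<exists>g\<in>vals M I. \<exists>h\<in>vals M J. g + h \<le> w M z)" if "z \<in> ideal_prod L I J" for z
    using that
  proof induction
    case (prod i j)
    show ?case
    proof (cases "i = \<zero> \<or> j = \<zero>")
      case True
      then show ?thesis using subsetD[OF IE(1) prod(1)] subsetD[OF JE(1) prod(2)] by auto
    next
      case False
      then have "i \<in> carrier L - {\<zero>}" "j \<in> carrier L - {\<zero>}" using prod IE(1) JE(1) by auto
      then have "w M i + w M j \<le> w M (i \<otimes> j)" using val_mult[OF M] by simp
      moreover have "w M i \<in> vals M I" "w M j \<in> vals M J" using False prod by (auto simp: vals_def)
      ultimately show ?thesis by blast
    qed
  next
    case (sum s t)
    have c: "s \<in> carrier L" "t \<in> carrier L" using sum fractional_idealE(1)[OF P] by auto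
    show ?case
    proof (cases "s = \<zero> \<or> t = \<zero> \<or> s \<oplus> t = \<zero>")
      case True
      then show ?thesis using sum.IH c by auto
    next
      case False
      then have "min (w M s) (w M t) \<le> w M (s \<oplus> t)" using val_add[OF M, of s t] c by simp
      moreover have "\<exists>g\<in>vals M I. \<exists>h\<in>vals M J. g + h \<le> w M s" "\<exists>g\<in>vals M I. \<exists>h\<in>vals M J. g + h \<le> w M t"
        using False sum.IH by auto
      ultimately show ?thesis by (metis min_def order_trans)
    qed
  qed
  show "vals M (ideal_prod L I J) \<subseteq> {g + h | g h. g \<in> vals M I \<and> h \<in> vals M J}"
  proof
    fix k assume "k \<in> vals M (ideal_prod L I J)"
    then obtain z where z: "z \<in> ideal_prod L I J - {\<zero>}" "k = w M z" unfolding vals_def by (rule imageE)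
    then obtain g h where gh: "g \<in> vals M I" "h \<in> vals M J" "g + h \<le> k" using bound by blast
    have "vals M I \<subseteq> value_grp M" using IE(1) by (auto simp: vals_def)
    moreover have "k \<in> value_grp M" unfolding vals_def using z fractional_idealE(1)[OF P] by auto
    ultimately have "k + - g \<in> value_grp M" using value_grp_add[OF M] value_grp_uminus[OF M] gh(1) by blast
    then have "k - g \<in> vals M J" using vals_up_closed[OF M J gh(2)] gh(3) by simp
    moreover have "k = g + (k - g)" by simp
    ultimately show "k \<in> {g + h | g h. g \<in> vals M I \<and> h \<in> vals M J}" using gh(1) by blast
  qed
qed

lemma value_grp_subgroup: "M \<in> max_ideals \<Longrightarrow> real_subgroup (value_grp M)"
  using value_grp_zero value_grp_add value_grp_uminus
  by (metis diff_conv_add_uminus real_subgroup_def)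

lemma cut_vals: "fractional_ideal L B I \<Longrightarrow> M \<in> max_ideals \<Longrightarrow> cut (value_grp M) (vals M I)"
  using cut_family_vals unfolding cut_family_def by blast

lemma vals_B_prod:
  assumes "fractional_ideal L B I" "M \<in> max_ideals"
  shows "vals M (ideal_prod L B I) = vals M I"
  using vals_prod[OF fractional_ideal_B assms] vals_B[OF assms(2)]
    sum_atLeast_cut[OF value_grp_subgroup[OF assms(2)] cut_vals[OF assms] value_grp_zero[OF assms(2)]]
  by simp

text \<open>
  As ideals are determined by their cuts, the laws are inherited from the addition of sets of reals.
\<close>

lemma comm_monoid_fractional_ideals: "comm_monoid (fractional_ideal_monoid L B)"
proof (rule comm_monoidI, unfold fractional_ideal_monoid_def, simp_all add: fractional_ideal_prod fractional_ideal_B)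
  fix I J assume I: "fractional_ideal L B I" and J: "fractional_ideal L B J"
  show "ideal_prod L I J = ideal_prod L J I"
    by (rule fractional_ideal_eqI[OF fractional_ideal_prod[OF I J] fractional_ideal_prod[OF J I]])
      (auto simp: vals_prod I J, metis add.commute, metis add.commute)
  show "ideal_prod L B I = I"
    by (rule fractional_ideal_eqI[OF fractional_ideal_prod[OF fractional_ideal_B I] I vals_B_prod[OF I]])
  fix Q assume Q: "fractional_ideal L B Q"
  show "ideal_prod L (ideal_prod L I J) Q = ideal_prod L I (ideal_prod L J Q)"
  proof (rule fractional_ideal_eqI)
    note f = fractional_ideal_prod
    show "fractional_ideal L B (ideal_prod L (ideal_prod L I J) Q)" "fractional_ideal L B (ideal_prod L I (ideal_prod L J Q))"
      using f I J Q by blast+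
    fix M assume M: "M \<in> max_ideals"
    show "vals M (ideal_prod L (ideal_prod L I J) Q) = vals M (ideal_prod L I (ideal_prod L J Q))"
      unfolding vals_prod[OF f[OF I J] Q M] vals_prod[OF I J M] vals_prod[OF I f[OF J Q] M] vals_prod[OF J Q M]
      by (auto, metis add.assoc, metis add.assoc)
  qed
qed

text \<open>
  Value families play the role of divisors, and this is the fractional ideal attached to a divisor.
\<close>

definition value_ideal :: "('a set \<Rightarrow> real) \<Rightarrow> 'a set" where
  "value_ideal h = cut_ideal (\<lambda>M. {g \<in> value_grp M. h M \<le> g})"

definition value_family :: "('a set \<Rightarrow> real) \<Rightarrow> bool" where
  "value_family h \<longleftrightarrow> (\<forall>M\<in>max_ideals. h M \<in> value_grp M) \<and> finite {M \<in> max_ideals. h M \<noteq> 0}"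

lemma value_ideal:
  assumes h: "value_family h"
  shows "fractional_ideal L B (value_ideal h)"
    and "M \<in> max_ideals \<Longrightarrow> vals M (value_ideal h) = {g \<in> value_grp M. h M \<le> g}"
proof -
  have "{M \<in> max_ideals. {g \<in> value_grp M. h M \<le> g} \<noteq> vals M B} \<subseteq> {M \<in> max_ideals. h M \<noteq> 0}"
    using vals_B by auto
  then have "cut_family (\<lambda>M. {g \<in> value_grp M. h M \<le> g})"
    using h cut_atLeast unfolding cut_family_def value_family_def by (blast intro: finite_subset)
  then show "fractional_ideal L B (value_ideal h)"
    and "M \<in> max_ideals \<Longrightarrow> vals M (value_ideal h) = {g \<in> value_grp M. h M \<le> g}"
    unfolding value_ideal_def using fractional_ideal_cut_ideal vals_cut_ideal by auto
qed

lemma vals_value_ideal_prod: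
  assumes h: "value_family h" and I: "fractional_ideal L B I" and M: "M \<in> max_ideals"
  shows "vals M (ideal_prod L (value_ideal h) I) = (\<lambda>t. h M + t) ` vals M I"
  using h M sum_atLeast_cut[OF value_grp_subgroup[OF M] cut_vals[OF I M], of "h M"]
  unfolding vals_prod[OF value_ideal(1)[OF h] I M] value_ideal(2)[OF h M] value_family_def by blast

lemma value_ideal_prod:
  assumes h: "value_family h" and k: "value_family k"
  shows "value_family (\<lambda>M. h M + k M)"
    and "ideal_prod L (value_ideal h) (value_ideal k) = value_ideal (\<lambda>M. h M + k M)"
proof -
  have "{M \<in> max_ideals. h M + k M \<noteq> 0} \<subseteq> {M \<in> max_ideals. h M \<noteq> 0} \<union> {M \<in> max_ideals. k M \<noteq> 0}" by auto
  then show hk: "value_family (\<lambda>M. h M + k M)"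
    using h k value_grp_add unfolding value_family_def by (blast intro: finite_subset)
  show "ideal_prod L (value_ideal h) (value_ideal k) = value_ideal (\<lambda>M. h M + k M)"
  proof (rule fractional_ideal_eqI[OF fractional_ideal_prod])
    fix M assume M: "M \<in> max_ideals"
    have "h M \<in> value_grp M" using h M by (simp add: value_family_def)
    then show "vals M (ideal_prod L (value_ideal h) (value_ideal k)) = vals M (value_ideal (\<lambda>M. h M + k M))"
      using vals_value_ideal_prod[OF h value_ideal(1)[OF k] M] shift_atLeast[OF value_grp_subgroup[OF M], of "h M" "k M"]
        value_ideal(2)[OF k M] value_ideal(2)[OF hk M] by simp
  qed (use value_ideal(1) h k hk in auto)
qed

lemma value_ideal_zero: "value_family (\<lambda>M. 0)" "value_ideal (\<lambda>M. 0) = B"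
proof -
  show z: "value_family (\<lambda>M. 0)" using value_grp_zero by (simp add: value_family_def)
  show "value_ideal (\<lambda>M. 0) = B"
    by (rule fractional_ideal_eqI[OF value_ideal(1)[OF z] fractional_ideal_B]) (simp add: value_ideal(2)[OF z] vals_B)
qed

lemma value_family_uminus: "value_family h \<Longrightarrow> value_family (\<lambda>M. - h M)"
  using value_grp_uminus by (simp add: value_family_def)

text \<open>
  If \<open>I J = B\<close>, the cuts of \<open>I\<close> and \<open>J\<close> add up to cuts with a minimum, so those of \<open>I\<close> have minima themselves, and these
  minima form the family \<open>h\<close>.
\<close>

lemma invertible_iff_value_ideal:
  "invertible_ideals L B = {value_ideal h | h. value_family h}"
proof
  show "{value_ideal h | h. value_family h} \<subseteq> invertible_ideals L B"
  proof clarify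
    fix h assume h: "value_family h"
    have "ideal_prod L (value_ideal h) (value_ideal (\<lambda>M. - h M)) = B"
      using value_ideal_prod(2)[OF h value_family_uminus[OF h]] value_ideal_zero(2) by simp
    then show "value_ideal h \<in> invertible_ideals L B"
      unfolding invertible_ideals_def using value_ideal(1) h value_family_uminus[OF h] by blast
  qed
  show "invertible_ideals L B \<subseteq> {value_ideal h | h. value_family h}"
  proof
    fix I assume "I \<in> invertible_ideals L B"
    then obtain J where I: "fractional_ideal L B I" and J: "fractional_ideal L B J" and IJ: "ideal_prod L I J = B"
      by (auto simp: invertible_ideals_def)
    define h where "h M = Inf (vals M I)" for M
    have min: "has_min (vals M I)" if M: "M \<in> max_ideals" for M
    proof -
      have "has_min (vals M B)" using vals_B[OF M] has_min_atLeast[OF value_grp_zero[OF M]] by simp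
      then show ?thesis using vals_prod[OF I J M] IJ has_min_sumset by simp
    qed
    have vals: "vals M I = {g \<in> value_grp M. h M \<le> g}" if M: "M \<in> max_ideals" for M
      using cut_eq_atLeast[OF cut_vals[OF I M] min[OF M]] by (simp add: h_def)
    have hM: "h M \<in> vals M I" if "M \<in> max_ideals" for M
      using has_min_Inf[OF min[OF that]] by (simp add: h_def)
    have "h M = 0" if M: "M \<in> max_ideals" "vals M I = vals M B" for M
    proof -
      have "0 \<le> h M" using hM[OF M(1)] vals_B[OF M(1)] M(2) by simp
      moreover have "0 \<in> vals M I" using value_grp_zero[OF M(1)] vals_B[OF M(1)] M(2) by simp
      ultimately show ?thesis using vals[OF M(1)] by simp
    qed
    then have "{M \<in> max_ideals. h M \<noteq> 0} \<subseteq> {M \<in> max_ideals. vals M I \<noteq> vals M B}" by blast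
    then have h: "value_family h"
      using cut_family_vals[OF I] hM cutD(1)[OF cut_vals[OF I]] unfolding value_family_def cut_family_def
      by (blast intro: finite_subset)
    have "I = value_ideal h"
      by (rule fractional_ideal_eqI[OF I value_ideal(1)[OF h]]) (simp add: vals value_ideal(2)[OF h])
    then show "I \<in> {value_ideal h | h. value_family h}" using h by blast
  qed
qed

lemma principal_value_ideal:
  assumes a: "a \<in> carrier L - {\<zero>}"
  shows "value_family (\<lambda>M. w M a)" "a <# B = value_ideal (\<lambda>M. w M a)"
proof -
  show f: "value_family (\<lambda>M. w M a)"
    using finite_val_nonzero[OF a] a by (auto simp: value_family_def vals_def)
  show "a <# B = value_ideal (\<lambda>M. w M a)"
  proof (rule Set.set_eqI)
    fix x
    show "x \<in> a <# B \<longleftrightarrow> x \<in> value_ideal (\<lambda>M. w M a)"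
    proof (cases "x \<in> carrier L - {\<zero>}")
      case x: True
      have m: "inv a \<otimes> x \<in> carrier L - {\<zero>}" using mult_nonzero inv_nonzero a x by blast
      have "x \<in> a <# B \<longleftrightarrow> inv a \<otimes> x \<in> B"
      proof
        assume "x \<in> a <# B"
        then obtain b where b: "b \<in> B" "x = a \<otimes> b" by (auto simp: l_coset_def)
        then have "inv a \<otimes> x = (a \<otimes> inv a) \<otimes> b" using a inv_nonzero[OF a] B_carrier by (simp add: m_ac)
        then show "inv a \<otimes> x \<in> B" using mult_inv[OF a] b B_carrier by simp
      next
        assume "inv a \<otimes> x \<in> B"
        moreover have "x = a \<otimes> (inv a \<otimes> x)"
          using mult_inv[OF a] a x inv_nonzero[OF a] by (simp add: m_assoc[symmetric])
        ultimately show "x \<in> a <# B" unfolding l_coset_def by blast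
      qed
      also have "\<dots> \<longleftrightarrow> (\<forall>M\<in>max_ideals. w M a \<le> w M x)"
        using mem_B_iff[OF m] val_mult[OF _ inv_nonzero[OF a] x] val_inv[OF _ a] by simp
      also have "\<dots> \<longleftrightarrow> x \<in> value_ideal (\<lambda>M. w M a)"
        using x by (auto simp: value_ideal_def cut_ideal_def vals_def)
      finally show ?thesis .
    next
      case False
      have "\<zero> \<in> a <# B" using B_sub(2) a by (auto simp: l_coset_def intro!: bexI[of _ \<zero>])
      moreover have "a <# B \<subseteq> carrier L" using a B_carrier by (auto simp: l_coset_def)
      moreover have "\<zero> \<in> value_ideal (\<lambda>M. w M a)" "value_ideal (\<lambda>M. w M a) \<subseteq> carrier L"
        by (auto simp: value_ideal_def cut_ideal_def)
      ultimately show ?thesis using False by blast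
    qed
  qed
qed

lemma principal_ideals_eq:
  "principal_ideals L B = {value_ideal (\<lambda>M. w M a) | a. a \<in> carrier L - {\<zero>}}"
  using principal_value_ideal(2) unfolding principal_ideals_def by auto

lemma value_ideal_cong: "(\<And>M. M \<in> max_ideals \<Longrightarrow> h M = k M) \<Longrightarrow> value_ideal h = value_ideal k"
  by (simp add: value_ideal_def cut_ideal_def)

text \<open>
  The map \<open>\<Phi>\<close> sends an ideal to the classes of its cuts at the places in \<open>D\<close>. At the other places all cuts have a
  minimum and carry no information modulo translations. Two ideals with equal images differ at each place by
  a translation, almost everywhere trivial, that is, by an invertible ideal.
\<close>

theorem regular_class_monoid_iso:
  assumes D: "D \<subseteq> max_ideals" "\<And>M. M \<in> D \<Longrightarrow> order_dense (value_grp M)"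
    and nD: "\<And>M S. M \<in> max_ideals - D \<Longrightarrow> cut (value_grp M) S \<Longrightarrow> has_min S"
  shows "regular_part (class_monoid L B) Mod carrier (picard_group L B) \<cong>
         sum_monoid D (\<lambda>M. adjoin_identity (real_additive Mod value_grp M))"
proof -
  let ?F = "fractional_ideal_monoid L B"
  let ?A = "\<lambda>M. adjoin_identity (real_additive Mod value_grp M)"
  let ?T = "sum_monoid D ?A"
  define \<Phi> where "\<Phi> I = (\<lambda>M\<in>D. cut_class (value_grp M) (vals M I))" for I
  interpret F: comm_monoid ?F by (rule comm_monoid_fractional_ideals)
  have Fc: "I \<in> carrier ?F \<longleftrightarrow> fractional_ideal L B I" for I by (simp add: fractional_ideal_monoid_def)
  have Fm: "I \<otimes>\<^bsub>?F\<^esub> J = ideal_prod L I J" for I J by (simp add: fractional_ideal_monoid_def)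
  have F1: "\<one>\<^bsub>?F\<^esub> = B" by (simp add: fractional_ideal_monoid_def)
  have A1: "\<one>\<^bsub>?A M\<^esub> = None" for M by (simp add: adjoin_identity_def)
  have Tm: "x \<otimes>\<^bsub>?T\<^esub> y = (\<lambda>M\<in>D. x M \<otimes>\<^bsub>?A M\<^esub> y M)" for x y
    by (simp add: sum_monoid_def product_group_def)
  have Tc: "x \<in> carrier ?T \<longleftrightarrow> x \<in> (\<Pi>\<^sub>E M\<in>D. carrier (?A M)) \<and> finite {M \<in> D. x M \<noteq> None}" for x
    by (simp add: sum_monoid_def product_group_def A1)
  have cls: "cut_class (value_grp M) (vals M (ideal_prod L I J)) =
      cut_class (value_grp M) (vals M I) \<otimes>\<^bsub>?A M\<^esub> cut_class (value_grp M) (vals M J)"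
    if "fractional_ideal L B I" "fractional_ideal L B J" "M \<in> max_ideals" for I J M
    using cut_class_sumset[OF value_grp_subgroup cut_vals cut_vals] vals_prod that by simp
  have Bcls: "cut_class (value_grp M) (vals M B) = None" if "M \<in> max_ideals" for M
    using vals_B[OF that] has_min_atLeast[OF value_grp_zero[OF that]] by (simp add: cut_class_def)
  have hom: "\<Phi> \<in> hom ?F ?T"
  proof (rule homI)
    fix I assume "I \<in> carrier ?F"
    then have I: "fractional_ideal L B I" by (simp add: Fc)
    have "{M \<in> D. \<Phi> I M \<noteq> None} \<subseteq> {M \<in> max_ideals. vals M I \<noteq> vals M B}"
      using D(1) Bcls by (auto simp: \<Phi>_def)
    then have "finite {M \<in> D. \<Phi> I M \<noteq> None}"
      using cut_family_vals[OF I] unfolding cut_family_def by (blast intro: finite_subset)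
    then show "\<Phi> I \<in> carrier ?T" unfolding Tc by (auto simp: \<Phi>_def cut_class_carrier)
    fix J assume "J \<in> carrier ?F"
    then have J: "fractional_ideal L B J" by (simp add: Fc)
    show "\<Phi> (I \<otimes>\<^bsub>?F\<^esub> J) = \<Phi> I \<otimes>\<^bsub>?T\<^esub> \<Phi> J"
      unfolding Tm Fm \<Phi>_def using cls[OF I J] D(1) by (auto intro!: restrict_ext)
  qed
  have surj: "\<Phi> ` carrier ?F = carrier ?T"
  proof
    show "\<Phi> ` carrier ?F \<subseteq> carrier ?T" using hom by (auto simp: hom_def)
    show "carrier ?T \<subseteq> \<Phi> ` carrier ?F"
    proof
      fix x assume "x \<in> carrier ?T"
      then have x: "x \<in> (\<Pi>\<^sub>E M\<in>D. carrier (?A M))" "finite {M \<in> D. x M \<noteq> None}" by (auto simp: Tc)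
      have "\<exists>S. cut (value_grp M) S \<and> (M \<in> D \<longrightarrow> cut_class (value_grp M) S = x M) \<and>
          (M \<in> D \<and> x M \<noteq> None \<or> S = vals M B)" if M: "M \<in> max_ideals" for M
      proof (cases "M \<in> D \<and> x M \<noteq> None")
        case True
        then have "x M \<in> carrier (?A M)" using x(1) by auto
        then obtain S where "cut (value_grp M) S" "cut_class (value_grp M) S = x M"
          using cut_with_class[OF value_grp_subgroup[OF M] D(2)] True by metis
        then show ?thesis using True by blast
      next
        case False
        then show ?thesis using Bcls[OF M] cut_vals[OF fractional_ideal_B M] by (intro exI[of _ "vals M B"]) auto
      qed
      then obtain S where S: "\<And>M. M \<in> max_ideals \<Longrightarrow> cut (value_grp M) (S M) \<and>
          (M \<in> D \<longrightarrow> cut_class (value_grp M) (S M) = x M) \<and> (M \<in> D \<and> x M \<noteq> None \<or> S M = vals M B)"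
        by metis
      have "{M \<in> max_ideals. S M \<noteq> vals M B} \<subseteq> {M \<in> D. x M \<noteq> None}" using S by blast
      then have fam: "cut_family S" using S x(2) unfolding cut_family_def by (blast intro: finite_subset)
      have "\<Phi> (cut_ideal S) = x"
      proof (rule extensionalityI[of _ D])
        show "\<Phi> (cut_ideal S) \<in> extensional D" "x \<in> extensional D" using x(1) by (auto simp: \<Phi>_def PiE_def)
        fix M assume M: "M \<in> D"
        then have "M \<in> max_ideals" using D(1) by blast
        then show "\<Phi> (cut_ideal S) M = x M" using M S vals_cut_ideal[OF fam] by (simp add: \<Phi>_def)
      qed
      moreover have "cut_ideal S \<in> carrier ?F" using fractional_ideal_cut_ideal[OF fam] by (simp add: Fc)
      ultimately show "x \<in> \<Phi> ` carrier ?F" by blast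
    qed
  qed
  have fibre: "\<Phi> I = \<Phi> J \<longleftrightarrow> (\<exists>H\<in>invertible_ideals L B. I = H \<otimes>\<^bsub>?F\<^esub> J)"
    if "I \<in> carrier ?F" "J \<in> carrier ?F" for I J
  proof
    have I: "fractional_ideal L B I" and J: "fractional_ideal L B J" using that by (auto simp: Fc)
    {
      assume "\<exists>H\<in>invertible_ideals L B. I = H \<otimes>\<^bsub>?F\<^esub> J"
      then obtain h where h: "value_family h" "I = ideal_prod L (value_ideal h) J"
        by (auto simp: invertible_iff_value_ideal Fm)
      show "\<Phi> I = \<Phi> J"
      proof (unfold \<Phi>_def, rule restrict_ext)
        fix M assume "M \<in> D"
        then have M: "M \<in> max_ideals" using D(1) by blast
        have "h M \<in> value_grp M" using h(1) M by (simp add: value_family_def)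
        then have "cut_class (value_grp M) (vals M (value_ideal h)) = None"
          using has_min_atLeast[of "h M" "value_grp M"] value_ideal(2)[OF h(1) M] by (simp add: cut_class_def)
        then show "cut_class (value_grp M) (vals M I) = cut_class (value_grp M) (vals M J)"
          unfolding h(2) cls[OF value_ideal(1)[OF h(1)] J M] by (simp add: adjoin_identity_def)
      qed
    }
    assume eq: "\<Phi> I = \<Phi> J"
    \<comment> \<open>The second conjunct makes \<open>h\<close> vanish at almost all places, so that it defines an ideal.\<close>
    have "\<exists>h\<in>value_grp M. vals M I = (\<lambda>t. h + t) ` vals M J \<and> (vals M I = vals M J \<longrightarrow> h = 0)"
      if M: "M \<in> max_ideals" for M
    proof (cases "vals M I = vals M J")
      case True
      then show ?thesis using value_grp_zero[OF M] by auto
    next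
      case False
      have "cut_class (value_grp M) (vals M I) = cut_class (value_grp M) (vals M J)"
      proof (cases "M \<in> D")
        case True
        then show ?thesis using fun_cong[OF eq, of M] by (simp add: \<Phi>_def)
      next
        case False
        then show ?thesis using nD[of M] cut_vals[OF I M] cut_vals[OF J M] M by (simp add: cut_class_def)
      qed
      then show ?thesis
        using cut_class_eqD[OF value_grp_subgroup[OF M] cut_vals[OF I M] cut_vals[OF J M]] False by metis
    qed
    then obtain h where h: "\<And>M. M \<in> max_ideals \<Longrightarrow> h M \<in> value_grp M \<and> vals M I = (\<lambda>t. h M + t) ` vals M J \<and>
        (vals M I = vals M J \<longrightarrow> h M = 0)" by metis
    have "{M \<in> max_ideals. h M \<noteq> 0} \<subseteq>
        {M \<in> max_ideals. vals M I \<noteq> vals M B} \<union> {M \<in> max_ideals. vals M J \<noteq> vals M B}" using h by auto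
    then have fam: "value_family h"
      using h cut_family_vals[OF I] cut_family_vals[OF J] unfolding value_family_def cut_family_def
      by (auto intro: finite_subset)
    have "I = ideal_prod L (value_ideal h) J"
      by (rule fractional_ideal_eqI[OF I fractional_ideal_prod[OF value_ideal(1)[OF fam] J]])
        (use h vals_value_ideal_prod[OF fam J] in auto)
    then show "\<exists>H\<in>invertible_ideals L B. I = H \<otimes>\<^bsub>?F\<^esub> J"
      using fam by (auto simp: invertible_iff_value_ideal Fm)
  qed
  have regular: "\<exists>d\<in>carrier ?T. c = c \<otimes>\<^bsub>?T\<^esub> d \<otimes>\<^bsub>?T\<^esub> c" if "c \<in> carrier ?T" for c
  proof -
    have c: "c \<in> (\<Pi>\<^sub>E M\<in>D. carrier (?A M))" "finite {M \<in> D. c M \<noteq> None}" using that by (auto simp: Tc)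
    have "\<exists>y\<in>carrier (?A M). c M = c M \<otimes>\<^bsub>?A M\<^esub> y \<otimes>\<^bsub>?A M\<^esub> c M \<and> (c M = None \<longrightarrow> y = None)"
      if "M \<in> D" for M
    proof -
      have "M \<in> max_ideals" "c M \<in> carrier (?A M)" using that D(1) c(1) by auto
      then show ?thesis using adjoin_identity_regular[OF value_grp_subgroup] by metis
    qed
    then obtain d where d: "\<And>M. M \<in> D \<Longrightarrow> d M \<in> carrier (?A M) \<and>
        c M = c M \<otimes>\<^bsub>?A M\<^esub> d M \<otimes>\<^bsub>?A M\<^esub> c M \<and> (c M = None \<longrightarrow> d M = None)" by metis
    have dc: "d M \<in> carrier (?A M)" if "M \<in> D" for M using d[OF that] by (rule conjunct1)
    have dN: "d M = None" if "M \<in> D" "c M = None" for M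
      using d[OF that(1), THEN conjunct2, THEN conjunct2] that(2) by (rule mp)
    have "{M \<in> D. restrict d D M \<noteq> None} \<subseteq> {M \<in> D. c M \<noteq> None}"
    proof (rule subsetI)
      fix M assume M: "M \<in> {M \<in> D. restrict d D M \<noteq> None}"
      then have MD: "M \<in> D" by simp
      have dM: "d M \<noteq> None" using M MD by simp
      have "c M \<noteq> None" using dN[OF MD] dM by (rule contrapos_nn[rotated])
      then show "M \<in> {M \<in> D. c M \<noteq> None}" using MD by simp
    qed
    then have "finite {M \<in> D. restrict d D M \<noteq> None}" using c(2) by (rule finite_subset)
    then have "restrict d D \<in> carrier ?T" unfolding Tc using dc by simp
    moreover have "c = c \<otimes>\<^bsub>?T\<^esub> restrict d D \<otimes>\<^bsub>?T\<^esub> c"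
    proof (rule extensionalityI[of _ D])
      show "c \<in> extensional D" using c(1) by (simp add: PiE_def)
      show "c M = (c \<otimes>\<^bsub>?T\<^esub> restrict d D \<otimes>\<^bsub>?T\<^esub> c) M" if "M \<in> D" for M
        unfolding Tm using d[OF that, THEN conjunct2, THEN conjunct1] that by simp
    qed (simp add: Tm)
    ultimately show ?thesis by blast
  qed
  have pr: "value_ideal (\<lambda>M. w M a) \<in> principal_ideals L B" if "a \<in> carrier L - {\<zero>}" for a
    using that principal_ideals_eq by blast
  have pm: "ideal_prod L (value_ideal (\<lambda>M. w M a)) (value_ideal (\<lambda>M. w M b)) = value_ideal (\<lambda>M. w M (a \<otimes> b))"
    if ab: "a \<in> carrier L - {\<zero>}" "b \<in> carrier L - {\<zero>}" for a b
    unfolding value_ideal_prod(2)[OF principal_value_ideal(1)[OF ab(1)] principal_value_ideal(1)[OF ab(2)]]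
    by (rule value_ideal_cong) (simp only: val_mult[OF _ ab])
  have p1: "value_ideal (\<lambda>M. w M \<one>) = B"
  proof -
    have "value_ideal (\<lambda>M. w M \<one>) = value_ideal (\<lambda>M. 0)" by (rule value_ideal_cong) (rule val_one)
    then show ?thesis by (simp only: value_ideal_zero(2))
  qed
  show ?thesis unfolding class_monoid_def picard_group_def
  proof (rule F.regular_part_quotient_iso[where P = "principal_ideals L B" and H = "invertible_ideals L B" and \<Phi> = \<Phi> and T = ?T])
    show "\<Phi> \<in> hom ?F ?T" by (rule hom)
    show "\<Phi> ` carrier ?F = carrier ?T" by (rule surj)
    show "\<Phi> I = \<Phi> J \<longleftrightarrow> (\<exists>H\<in>invertible_ideals L B. I = H \<otimes>\<^bsub>?F\<^esub> J)"
      if "I \<in> carrier ?F" "J \<in> carrier ?F" for I J using that by (rule fibre)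
    show "\<exists>d\<in>carrier ?T. c = c \<otimes>\<^bsub>?T\<^esub> d \<otimes>\<^bsub>?T\<^esub> c" if "c \<in> carrier ?T" for c
      using that by (rule regular)
    show "\<one>\<^bsub>?F\<^esub> \<in> principal_ideals L B" using pr[of \<one>] unfolding F1 p1 by simp
    show "I \<otimes>\<^bsub>?F\<^esub> J \<in> principal_ideals L B" if IJ: "I \<in> principal_ideals L B" "J \<in> principal_ideals L B" for I J
    proof -
      obtain a b where a: "a \<in> carrier L - {\<zero>}" "I = value_ideal (\<lambda>M. w M a)"
        and b: "b \<in> carrier L - {\<zero>}" "J = value_ideal (\<lambda>M. w M b)"
        using IJ unfolding principal_ideals_eq by blast
      show ?thesis unfolding Fm a(2) b(2) pm[OF a(1) b(1)] by (rule pr[OF mult_nonzero[OF a(1) b(1)]])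
    qed
    show "\<exists>J\<in>principal_ideals L B. I \<otimes>\<^bsub>?F\<^esub> J = \<one>\<^bsub>?F\<^esub>" if I: "I \<in> principal_ideals L B" for I
    proof -
      obtain a where a: "a \<in> carrier L - {\<zero>}" "I = value_ideal (\<lambda>M. w M a)" using I unfolding principal_ideals_eq by blast
      have "I \<otimes>\<^bsub>?F\<^esub> value_ideal (\<lambda>M. w M (inv a)) = \<one>\<^bsub>?F\<^esub>"
        unfolding a(2) Fm F1 pm[OF a(1) inv_nonzero[OF a(1)]] mult_inv[OF a(1)] by (rule p1)
      then show ?thesis using pr[OF inv_nonzero[OF a(1)]] by blast
    qed
    show "invertible_ideals L B \<subseteq> carrier ?F"
      unfolding invertible_ideals_def fractional_ideal_monoid_def by (rule subsetI) simp
    show "I \<otimes>\<^bsub>?F\<^esub> J \<in> invertible_ideals L B" if IJ: "I \<in> invertible_ideals L B" "J \<in> invertible_ideals L B" for I J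
    proof -
      obtain h k where h: "value_family h" "I = value_ideal h" and k: "value_family k" "J = value_ideal k"
        using IJ unfolding invertible_iff_value_ideal by blast
      show ?thesis unfolding Fm h(2) k(2) value_ideal_prod(2)[OF h(1) k(1)] invertible_iff_value_ideal
        using value_ideal_prod(1)[OF h(1) k(1)] by blast
    qed
    show "\<exists>J\<in>invertible_ideals L B. I \<otimes>\<^bsub>?F\<^esub> J = \<one>\<^bsub>?F\<^esub>" if I: "I \<in> invertible_ideals L B" for I
    proof -
      obtain h where h: "value_family h" "I = value_ideal h" using I unfolding invertible_iff_value_ideal by blast
      have "I \<otimes>\<^bsub>?F\<^esub> value_ideal (\<lambda>M. - h M) = \<one>\<^bsub>?F\<^esub>"
        unfolding h(2) Fm F1 value_ideal_prod(2)[OF h(1) value_family_uminus[OF h(1)]] right_minus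
        by (rule value_ideal_zero(2))
      then show ?thesis using value_family_uminus[OF h(1)] unfolding invertible_iff_value_ideal by blast
    qed
    show "principal_ideals L B \<subseteq> invertible_ideals L B"
      using principal_value_ideal(1) unfolding principal_ideals_eq invertible_iff_value_ideal by blast
  qed
qed

end

section \<open>The Galois action on the maximal ideals\<close>

text \<open>
  The ring \<open>B\<close> is assumed to be a subring; in the application this follows from the existence of a maximal
  ideal of \<open>B\<close>.
\<close>

locale galois_integral_closure = field L for L (structure) +
  fixes A K B :: "'a set"
  assumes dedekind: "dedekind_subring L A"
    and A_not_field: "\<not> field (L\<lparr>carrier := A\<rparr>)"
    and K_eq: "K = fraction_field L A"
    and galois: "galois_extension L K"
    and B_eq: "B = integral_closure L A"
    and subring_B: "subring B L"
    and finite_char: "finite_character (L\<lparr>carrier := B\<rparr>)"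
begin

abbreviation G :: "('a \<Rightarrow> 'a) set" where
  "G \<equiv> carrier (galois_group L K)"

lemma subring_A: "subring A L"
  using dedekind by (simp add: dedekind_subring_def)

lemmas A_sub = subringE[OF subring_A]
lemmas B_sub = subringE[OF subring_B]

lemma B_carrier: "x \<in> B \<Longrightarrow> x \<in> carrier L"
  using B_sub(1) by blast

lemma B_Int_K: "B \<inter> K = A"
  using dedekind by (simp add: dedekind_subring_def B_eq K_eq)

lemma A_subset_B: "A \<subseteq> B" and A_subset_K: "A \<subseteq> K"
  using B_Int_K by auto

lemma automorphism:
  assumes "\<alpha> \<in> G"
  shows "\<alpha> \<in> ring_iso L L" "\<alpha> \<in> extensional (carrier L)" "\<And>x. x \<in> K \<Longrightarrow> \<alpha> x = x"
  using assms by (auto simp: galois_group_def)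

text \<open>
  Elements of the Galois group are extensional, so an automorphism has to be restricted to the carrier first.
\<close>

lemma automorphismI:
  assumes "\<alpha> \<in> ring_iso L L" "\<And>x. x \<in> K \<Longrightarrow> \<alpha> x = x" "K \<subseteq> carrier L"
  shows "restrict \<alpha> (carrier L) \<in> G"
  using assms ring_iso_restrict[OF assms(1), of "restrict \<alpha> (carrier L)"]
  by (auto simp: galois_group_def)

lemma K_carrier: "K \<subseteq> carrier L"
  using galois unfolding galois_extension_def by blast

lemma fixed_in_K:
  assumes "x \<in> carrier L" "\<And>\<alpha>. \<alpha> \<in> G \<Longrightarrow> \<alpha> x = x" shows "x \<in> K"
  using galois assms unfolding galois_extension_def by blast

lemma automorphism_hom:
  assumes "\<alpha> \<in> G"
  shows "\<And>x. x \<in> carrier L \<Longrightarrow> \<alpha> x \<in> carrier L"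
    and "\<And>x y. x \<in> carrier L \<Longrightarrow> y \<in> carrier L \<Longrightarrow> \<alpha> (x \<otimes> y) = \<alpha> x \<otimes> \<alpha> y"
    and "\<And>x y. x \<in> carrier L \<Longrightarrow> y \<in> carrier L \<Longrightarrow> \<alpha> (x \<oplus> y) = \<alpha> x \<oplus> \<alpha> y"
    and "\<alpha> \<one> = \<one>" "\<alpha> \<zero> = \<zero>"
    and "bij_betw \<alpha> (carrier L) (carrier L)"
  using ring_iso_memE[OF automorphism(1)[OF assms]] A_sub(2,3) A_subset_K automorphism(3)[OF assms] by auto

lemma identity_automorphism: "(\<lambda>x\<in>carrier L. x) \<in> G"
  using automorphismI[of "\<lambda>x. x"] ring_iso_set_refl[of L] K_carrier by (simp add: id_def)

lemma compose_automorphism: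
  assumes "\<alpha> \<in> G" "\<beta> \<in> G" shows "compose (carrier L) \<alpha> \<beta> \<in> G"
proof -
  have "\<alpha> \<circ> \<beta> \<in> ring_iso L L" using automorphism(1) assms ring_iso_set_trans by blast
  then show ?thesis
    using automorphismI[of "\<alpha> \<circ> \<beta>"] automorphism(3)[OF assms(1)] automorphism(3)[OF assms(2)] K_carrier
    by (simp add: compose_def comp_def)
qed

lemma inverse_automorphism:
  assumes \<alpha>: "\<alpha> \<in> G"
  obtains \<beta> where "\<beta> \<in> G" "\<And>x. x \<in> carrier L \<Longrightarrow> \<beta> (\<alpha> x) = x" "\<And>x. x \<in> carrier L \<Longrightarrow> \<alpha> (\<beta> x) = x"
proof -
  let ?i = "inv_into (carrier L) \<alpha>"
  note bij = automorphism_hom(6)[OF \<alpha>]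
  have l: "?i (\<alpha> x) = x" if "x \<in> carrier L" for x
    using bij that by (simp add: bij_betw_def)
  have r: "\<alpha> (?i x) = x" if "x \<in> carrier L" for x
    using bij that by (simp add: bij_betw_def f_inv_into_f)
  have "?i x = x" if "x \<in> K" for x
    using l[of x] that K_carrier automorphism(3)[OF \<alpha>] by auto
  then have "restrict ?i (carrier L) \<in> G"
    using automorphismI ring_iso_set_sym[OF ring_axioms automorphism(1)[OF \<alpha>]] K_carrier by blast
  then show thesis
    using that[of "restrict ?i (carrier L)"] l r automorphism_hom(1)[OF \<alpha>] by simp
qed

lemma automorphism_inj:
  assumes "\<alpha> \<in> G" "x \<in> carrier L" "y \<in> carrier L" "\<alpha> x = \<alpha> y" shows "x = y"
  using automorphism_hom(6)[OF assms(1)] assms(2-) by (auto simp: bij_betw_def inj_on_def)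

lemma automorphism_eval:
  assumes \<alpha>: "\<alpha> \<in> G" and p: "set p \<subseteq> K" and x: "x \<in> carrier L"
  shows "\<alpha> (eval p x) = eval p (\<alpha> x)"
proof -
  interpret \<alpha>: ring_hom_ring L L \<alpha>
    using automorphism(1)[OF \<alpha>] ring_axioms by (intro ring_hom_ringI2) (auto simp: ring_iso_def)
  have "map \<alpha> p = p" using p automorphism(3)[OF \<alpha>] by (intro map_idI) auto
  then show ?thesis using \<alpha>.eval_hom'[OF x, of p] p K_carrier by auto
qed

lemma integral_equation:
  assumes "x \<in> B"
  obtains p where "polynomial A p" "p \<noteq> []" "lead_coeff p = \<one>" "eval p x = \<zero>"
  using assms unfolding B_eq integral_closure_def by blast

lemma automorphism_B:
  assumes \<alpha>: "\<alpha> \<in> G" and x: "x \<in> B" shows "\<alpha> x \<in> B"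
proof -
  obtain p where p: "polynomial A p" "p \<noteq> []" "lead_coeff p = \<one>" "eval p x = \<zero>"
    using integral_equation[OF x] .
  have "set p \<subseteq> K" using p(1) A_subset_K by (auto simp: polynomial_def)
  then have "eval p (\<alpha> x) = \<zero>"
    using automorphism_eval[OF \<alpha> _ B_carrier[OF x]] p(4) automorphism_hom(5)[OF \<alpha>] by metis
  then show ?thesis
    using p automorphism_hom(1)[OF \<alpha> B_carrier[OF x]] unfolding B_eq integral_closure_def by blast
qed

lemma maximalideal_B:
  assumes "maximalideal M (L\<lparr>carrier := B\<rparr>)"
  shows "M \<subseteq> B" "\<zero> \<in> M" "\<one> \<notin> M"
    and "\<And>a b. a \<in> M \<Longrightarrow> b \<in> M \<Longrightarrow> a \<oplus> b \<in> M"
    and "\<And>a b. a \<in> B \<Longrightarrow> b \<in> M \<Longrightarrow> a \<otimes> b \<in> M"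
    and "\<And>a b. a \<in> B \<Longrightarrow> b \<in> B \<Longrightarrow> a \<otimes> b \<in> M \<Longrightarrow> a \<in> M \<or> b \<in> M"
    and "\<And>a. a \<in> B \<Longrightarrow> a \<notin> M \<Longrightarrow> \<exists>b\<in>B. \<exists>m\<in>M. \<one> = b \<otimes> a \<oplus> m"
  using ideal_of_subringE[OF subring_B maximalideal.axioms(1)[OF assms]]
    maximalideal_of_subringE[OF subring_B assms] by auto

lemma maximalideal_image:
  assumes \<alpha>: "\<alpha> \<in> G" and M: "maximalideal M (L\<lparr>carrier := B\<rparr>)"
  shows "maximalideal (\<alpha> ` M) (L\<lparr>carrier := B\<rparr>)"
proof -
  note ME = maximalideal_B[OF M] and h = automorphism_hom[OF \<alpha>]
  obtain \<beta> where \<beta>: "\<beta> \<in> G" "\<And>x. x \<in> carrier L \<Longrightarrow> \<beta> (\<alpha> x) = x" "\<And>x. x \<in> carrier L \<Longrightarrow> \<alpha> (\<beta> x) = x"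
    by (rule inverse_automorphism[OF \<alpha>]) blast
  have car: "x \<in> carrier L" if "x \<in> M" for x using that ME(1) B_carrier by blast
  have mem: "x \<in> \<alpha> ` M \<longleftrightarrow> \<beta> x \<in> M" if "x \<in> B" for x
  proof
    show "x \<in> \<alpha> ` M \<Longrightarrow> \<beta> x \<in> M" using \<beta>(2) car by auto
    show "\<beta> x \<in> M \<Longrightarrow> x \<in> \<alpha> ` M" using \<beta>(3)[of x] that B_carrier by (intro image_eqI[of _ _ "\<beta> x"]) auto
  qed
  show ?thesis
  proof (rule maximalideal_of_subringI[OF subring_B ideal_of_subringI[OF subring_B]])
    show "\<alpha> ` M \<subseteq> B" using automorphism_B[OF \<alpha>] ME(1) by auto
    show "\<zero> \<in> \<alpha> ` M" using ME(2) h(5) by (intro image_eqI[of _ _ \<zero>]) auto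
    show "a \<oplus> b \<in> \<alpha> ` M" if ab: "a \<in> \<alpha> ` M" "b \<in> \<alpha> ` M" for a b
    proof -
      obtain x y where "x \<in> M" "y \<in> M" "a = \<alpha> x" "b = \<alpha> y" using ab by blast
      then have "a \<oplus> b = \<alpha> (x \<oplus> y)" "x \<oplus> y \<in> M" using h(3) car ME(4) by auto
      then show ?thesis by blast
    qed
    show "a \<otimes> b \<in> \<alpha> ` M" if ab: "a \<in> B" "b \<in> \<alpha> ` M" for a b
    proof -
      obtain y where y: "y \<in> M" "b = \<alpha> y" using ab by blast
      have "a \<otimes> b = \<alpha> (\<beta> a \<otimes> y)"
        using h(2)[of "\<beta> a" y] \<beta>(3)[of a] ab(1) y B_carrier car automorphism_hom(1)[OF \<beta>(1)] by simp
      moreover have "\<beta> a \<otimes> y \<in> M" using ME(5) automorphism_B[OF \<beta>(1) ab(1)] y(1) by blast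
      ultimately show ?thesis by blast
    qed
    show "\<one> \<notin> \<alpha> ` M" using mem[OF B_sub(3)] ME(3) automorphism_hom(4)[OF \<beta>(1)] by simp
    show "\<exists>b\<in>B. \<exists>m\<in>\<alpha> ` M. \<one> = b \<otimes> a \<oplus> m" if a: "a \<in> B" "a \<notin> \<alpha> ` M" for a
    proof -
      obtain b m where b: "b \<in> B" "m \<in> M" "\<one> = b \<otimes> \<beta> a \<oplus> m"
        using ME(7)[OF automorphism_B[OF \<beta>(1) a(1)]] mem[OF a(1)] a(2) by blast
      have "\<one> = \<alpha> (b \<otimes> \<beta> a \<oplus> m)" using h(4) b(3) by simp
      also have "\<dots> = \<alpha> b \<otimes> a \<oplus> \<alpha> m"
        using h(2,3) b(1,2) B_carrier car \<beta>(3) automorphism_hom(1)[OF \<beta>(1)] a(1) by simp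
      finally show ?thesis using automorphism_B[OF \<alpha> b(1)] b(2) by blast
    qed
  qed
qed

definition orbit :: "'a \<Rightarrow> 'a set" where
  "orbit x = (\<lambda>\<alpha>. \<alpha> x) ` G"

text \<open>
  A substitute for the norm that makes sense in infinite extensions: in a finite Galois extension, the
  norm of \<open>x\<close> is a power of the product of its distinct conjugates.
\<close>

definition orbit_norm :: "'a \<Rightarrow> 'a" where
  "orbit_norm x = (\<Otimes>z\<in>orbit x. z)"

lemma orbit_subset_B: "x \<in> B \<Longrightarrow> orbit x \<subseteq> B"
  unfolding orbit_def using automorphism_B by blast

lemma finite_orbit:
  assumes x: "x \<in> B" shows "finite (orbit x)"
proof -
  obtain p where p: "polynomial A p" "p \<noteq> []" "eval p x = \<zero>"
    using integral_equation[OF x] by blast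
  have pA: "set p \<subseteq> A" using p(1) by (auto simp: polynomial_def)
  have "p \<in> carrier (poly_ring L)"
    using p(1) A_sub(1) by (auto simp: univ_poly_carrier[symmetric] polynomial_def)
  then have "finite {z. is_root p z}" by (rule finite_number_of_roots)
  moreover have "orbit x \<subseteq> {z. is_root p z}"
  proof
    fix z assume "z \<in> orbit x"
    then obtain \<alpha> where \<alpha>: "\<alpha> \<in> G" "z = \<alpha> x" unfolding orbit_def by blast
    have "set p \<subseteq> K" using pA A_subset_K by blast
    then have "eval p z = \<zero>"
      using automorphism_eval[OF \<alpha>(1) _ B_carrier[OF x]] p(3) automorphism_hom(5)[OF \<alpha>(1)] \<alpha>(2) by metis
    then show "z \<in> {z. is_root p z}"
      using p(2) \<alpha>(2) automorphism_hom(1)[OF \<alpha>(1) B_carrier[OF x]] by (simp add: is_root_def)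
  qed
  ultimately show ?thesis by (rule rev_finite_subset)
qed

lemma automorphism_orbit:
  assumes \<alpha>: "\<alpha> \<in> G" and x: "x \<in> B" shows "\<alpha> ` orbit x = orbit x"
proof -
  have sub: "\<alpha> ` orbit x \<subseteq> orbit x" if \<alpha>: "\<alpha> \<in> G" for \<alpha>
  proof
    fix z assume "z \<in> \<alpha> ` orbit x"
    then obtain \<rho> where \<rho>: "\<rho> \<in> G" "z = \<alpha> (\<rho> x)" unfolding orbit_def by blast
    then have "z = compose (carrier L) \<alpha> \<rho> x" using B_carrier[OF x] by (simp add: compose_def)
    then show "z \<in> orbit x" unfolding orbit_def using compose_automorphism[OF \<alpha> \<rho>(1)] by blast
  qed
  obtain \<beta> where \<beta>: "\<beta> \<in> G" "\<And>x. x \<in> carrier L \<Longrightarrow> \<alpha> (\<beta> x) = x" by (rule inverse_automorphism[OF \<alpha>]) blast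
  have "orbit x \<subseteq> \<alpha> ` orbit x"
  proof
    fix z assume z: "z \<in> orbit x"
    then have "\<beta> z \<in> orbit x" using sub[OF \<beta>(1)] by blast
    moreover have "z = \<alpha> (\<beta> z)" using \<beta>(2) z orbit_subset_B[OF x] B_carrier by auto
    ultimately show "z \<in> \<alpha> ` orbit x" by blast
  qed
  then show ?thesis using sub[OF \<alpha>] by blast
qed

lemma automorphism_finprod:
  assumes \<alpha>: "\<alpha> \<in> G" and S: "finite S" "S \<subseteq> carrier L"
  shows "\<alpha> (\<Otimes>z\<in>S. z) = (\<Otimes>z\<in>S. \<alpha> z)"
  using S
proof (induction S)
  case empty
  then show ?case using automorphism_hom(4)[OF \<alpha>] by simp
next
  case (insert z S)
  have S: "(\<lambda>z. z) \<in> S \<rightarrow> carrier L" "\<alpha> \<in> S \<rightarrow> carrier L" "z \<in> carrier L" "\<alpha> z \<in> carrier L"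
    using insert.prems automorphism_hom(1)[OF \<alpha>] by auto
  then have "(\<Otimes>z\<in>S. z) \<in> carrier L" by (intro finprod_closed)
  then show ?case using insert S automorphism_hom(2)[OF \<alpha>] by simp
qed

text \<open>
  The product is fixed by all automorphisms, so it lies in \<open>K\<close>; being integral, it lies in the integrally closed domain \<open>A\<close>.
\<close>

lemma orbit_norm_A:
  assumes x: "x \<in> B" shows "orbit_norm x \<in> A"
proof -
  note fin = finite_orbit[OF x] and sub = orbit_subset_B[OF x]
  have B: "(\<Otimes>z\<in>S. z) \<in> B" if "finite S" "S \<subseteq> B" for S
    using that
  proof (induction S)
    case empty
    then show ?case using B_sub(3) by simp
  next
    case (insert z S)
    have "(\<lambda>z. z) \<in> S \<rightarrow> carrier L" "z \<in> carrier L" using insert.prems B_carrier by auto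
    then show ?case using insert B_sub(6) by simp
  qed
  have car: "orbit x \<subseteq> carrier L" using sub B_carrier by blast
  have "\<alpha> (orbit_norm x) = orbit_norm x" if \<alpha>: "\<alpha> \<in> G" for \<alpha>
  proof -
    have inj: "inj_on \<alpha> (orbit x)" using automorphism_inj[OF \<alpha>] car by (auto simp: inj_on_def)
    have "\<alpha> (orbit_norm x) = (\<Otimes>z\<in>orbit x. \<alpha> z)"
      unfolding orbit_norm_def by (rule automorphism_finprod[OF \<alpha> fin car])
    also have "\<dots> = (\<Otimes>z\<in>\<alpha> ` orbit x. z)"
      using automorphism_orbit[OF \<alpha> x] car by (intro finprod_reindex[OF _ inj, symmetric]) auto
    finally show ?thesis unfolding automorphism_orbit[OF \<alpha> x] orbit_norm_def .
  qed
  then have "orbit_norm x \<in> K" using fixed_in_K B[OF fin sub] B_carrier unfolding orbit_norm_def by blast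
  then show ?thesis using B[OF fin sub] B_Int_K unfolding orbit_norm_def by blast
qed

lemma orbit_norm_nonzero:
  assumes x: "x \<in> B" "x \<noteq> \<zero>" shows "orbit_norm x \<noteq> \<zero>"
proof -
  have "(\<Otimes>z\<in>S. z) \<noteq> \<zero>" if "finite S" "S \<subseteq> carrier L - {\<zero>}" for S
    using that
  proof (induction S)
    case (insert z S)
    have "(\<lambda>z. z) \<in> S \<rightarrow> carrier L" "z \<in> carrier L" "z \<noteq> \<zero>" using insert.prems by auto
    then show ?case using insert integral_iff by simp
  qed simp
  moreover have "orbit x \<subseteq> carrier L - {\<zero>}"
  proof -
    have nz: "\<alpha> x \<noteq> \<zero>" if \<alpha>: "\<alpha> \<in> G" for \<alpha>
      using automorphism_inj[OF \<alpha> B_carrier[OF x(1)] zero_closed] automorphism_hom(5)[OF \<alpha>] x(2) by metis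
    show ?thesis
    proof
      fix z assume "z \<in> orbit x"
      then obtain \<alpha> where \<alpha>: "\<alpha> \<in> G" "z = \<alpha> x" unfolding orbit_def by blast
      show "z \<in> carrier L - {\<zero>}"
        unfolding \<alpha>(2) using nz[OF \<alpha>(1)] automorphism_hom(1)[OF \<alpha>(1) B_carrier[OF x(1)]] by simp
    qed
  qed
  ultimately show ?thesis unfolding orbit_norm_def using finite_orbit[OF x(1)] by blast
qed

lemma orbit_norm_mem:
  assumes M: "maximalideal M (L\<lparr>carrier := B\<rparr>)" and x: "x \<in> B"
  shows "orbit_norm x \<in> M \<longleftrightarrow> (\<exists>\<alpha>\<in>G. \<alpha> x \<in> M)"
proof -
  note ME = maximalideal_B[OF M]
  have "(\<Otimes>z\<in>S. z) \<in> B \<and> ((\<Otimes>z\<in>S. z) \<in> M \<longleftrightarrow> (\<exists>z\<in>S. z \<in> M))" if "finite S" "S \<subseteq> B" for S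
    using that
  proof (induction S)
    case empty
    then show ?case using B_sub(3) ME(3) by simp
  next
    case (insert z S)
    then have IH: "(\<Otimes>z\<in>S. z) \<in> B" "(\<Otimes>z\<in>S. z) \<in> M \<longleftrightarrow> (\<exists>z\<in>S. z \<in> M)" by auto
    have z: "z \<in> B" "z \<in> carrier L" using insert.prems B_carrier by auto
    have e: "(\<Otimes>z\<in>insert z S. z) = z \<otimes> (\<Otimes>z\<in>S. z)"
      using insert B_carrier by (intro finprod_insert) auto
    have "z \<otimes> (\<Otimes>z\<in>S. z) \<in> M \<longleftrightarrow> z \<in> M \<or> (\<Otimes>z\<in>S. z) \<in> M"
      using ME(6)[OF z(1) IH(1)] ME(5)[OF z(1)] ME(5)[OF IH(1), of z] m_comm[OF z(2) B_carrier[OF IH(1)]] by metis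
    then show ?case unfolding e using IH B_sub(6)[OF z(1) IH(1)] by auto
  qed
  from this[OF finite_orbit[OF x] orbit_subset_B[OF x]] show ?thesis
    unfolding orbit_norm_def by (auto simp: orbit_def)
qed

text \<open>
  Otherwise \<open>B\<close> would be a field; then the inverse of a nonzero element of \<open>A\<close> would be integral and in \<open>K\<close>, hence in \<open>A\<close>.
\<close>

lemma maximalideal_nonzero:
  assumes M: "maximalideal M (L\<lparr>carrier := B\<rparr>)" shows "M \<noteq> {\<zero>}"
proof
  assume "M = {\<zero>}"
  note ME = maximalideal_B[OF M, unfolded this]
  interpret A: cring "L\<lparr>carrier := A\<rparr>" using subring_is_cring[OF subring_A] .
  have "maximalideal {\<zero>} (L\<lparr>carrier := A\<rparr>)"
  proof (rule maximalideal_of_subringI[OF subring_A ideal_of_subringI[OF subring_A]])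
    show "{\<zero>} \<subseteq> A" "\<zero> \<in> {\<zero>}" "\<one> \<notin> {\<zero>}" using A_sub(2) by auto
    show "a \<oplus> b \<in> {\<zero>}" if "a \<in> {\<zero>}" "b \<in> {\<zero>}" for a b using that by simp
    show "a \<otimes> b \<in> {\<zero>}" if "a \<in> A" "b \<in> {\<zero>}" for a b using that A_sub(1) by auto
    show "\<exists>b\<in>A. \<exists>m\<in>{\<zero>}. \<one> = b \<otimes> a \<oplus> m" if a: "a \<in> A" "a \<notin> {\<zero>}" for a
    proof -
      have "a \<in> B" using a(1) A_subset_B by blast
      then obtain b m where "b \<in> B" "m \<in> {\<zero>}" "\<one> = b \<otimes> a \<oplus> m" using ME(7) a(2) by blast
      then have b: "b \<in> B" "\<one> = b \<otimes> a" using B_carrier \<open>a \<in> B\<close> by auto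
      have ac: "a \<in> carrier L" "b \<in> carrier L" using b(1) \<open>a \<in> B\<close> B_carrier by auto
      have "inv a = b" using b(2) ac by (intro comm_inv_char) (auto simp: m_comm)
      then have "b = \<one> \<otimes> inv a" using ac by simp
      then have "b \<in> K" unfolding K_eq fraction_field_def using a A_sub(3) by blast
      then have "b \<in> A" using b(1) B_Int_K by blast
      then show ?thesis using b(2) ac by (intro bexI[of _ b] bexI[of _ \<zero>]) auto
    qed
  qed
  then have "field (L\<lparr>carrier := A\<rparr>)" using A.zeromaximalideal_fieldI by simp
  then show False using A_not_field by blast
qed

text \<open>
  The product of the conjugates of a nonzero element of \<open>M\<close> is such an element.
\<close>

lemma contraction_nonzero:
  assumes M: "maximalideal M (L\<lparr>carrier := B\<rparr>)"
  obtains a where "a \<in> M \<inter> A" "a \<noteq> \<zero>"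
proof -
  note ME = maximalideal_B[OF M]
  obtain x where x: "x \<in> M" "x \<noteq> \<zero>" using maximalideal_nonzero[OF M] ME(2) by blast
  have xB: "x \<in> B" using x ME(1) by blast
  have "\<exists>\<alpha>\<in>G. \<alpha> x \<in> M"
    using identity_automorphism x B_carrier[OF xB] by (intro bexI[of _ "\<lambda>x\<in>carrier L. x"]) auto
  then have "orbit_norm x \<in> M" using orbit_norm_mem[OF M xB] by blast
  then show thesis using that orbit_norm_A[OF xB] orbit_norm_nonzero[OF xB x(2)] by blast
qed

lemma contraction_maximal:
  assumes M: "maximalideal M (L\<lparr>carrier := B\<rparr>)"
  shows "maximalideal (M \<inter> A) (L\<lparr>carrier := A\<rparr>)"
proof -
  note ME = maximalideal_B[OF M]
  have I: "ideal (M \<inter> A) (L\<lparr>carrier := A\<rparr>)"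
    by (rule ideal_of_subringI[OF subring_A]) (use ME A_sub A_subset_B in auto)
  have "primeideal (M \<inter> A) (L\<lparr>carrier := A\<rparr>)"
  proof (rule primeidealI[OF I subring_is_cring[OF subring_A]])
    show "carrier (L\<lparr>carrier := A\<rparr>) \<noteq> M \<inter> A" using ME(3) A_sub(3) by auto
    show "a \<in> M \<inter> A \<or> b \<in> M \<inter> A"
      if ab: "a \<in> carrier (L\<lparr>carrier := A\<rparr>)" "b \<in> carrier (L\<lparr>carrier := A\<rparr>)" "a \<otimes>\<^bsub>L\<lparr>carrier := A\<rparr>\<^esub> b \<in> M \<inter> A" for a b
    proof -
      have "a \<in> A" "b \<in> A" "a \<in> B" "b \<in> B" "a \<otimes> b \<in> M" using ab A_subset_B by auto
      then show ?thesis using ME(6) by blast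
    qed
  qed
  moreover have "M \<inter> A \<noteq> {\<zero>}" using contraction_nonzero[OF M] by blast
  ultimately show ?thesis using dedekind unfolding dedekind_subring_def by blast
qed

lemma image_Int_A:
  assumes \<alpha>: "\<alpha> \<in> G" and M: "M \<subseteq> B" shows "\<alpha> ` M \<inter> A = M \<inter> A"
proof -
  have fixed: "\<alpha> a = a" if "a \<in> A" for a using that A_subset_K automorphism(3)[OF \<alpha>] by blast
  have inj: "x = a" if "x \<in> M" "a \<in> A" "\<alpha> x = a" for x a
  proof (rule automorphism_inj[OF \<alpha>])
    show "x \<in> carrier L" "a \<in> carrier L" using that M B_carrier A_sub(1) by auto
    show "\<alpha> x = \<alpha> a" using that(3) fixed[OF that(2)] by simp
  qed
  show ?thesis
  proof
    show "\<alpha> ` M \<inter> A \<subseteq> M \<inter> A"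
    proof
      fix a assume "a \<in> \<alpha> ` M \<inter> A"
      then obtain x where x: "x \<in> M" "\<alpha> x = a" "a \<in> A" by blast
      then show "a \<in> M \<inter> A" using inj[OF x(1,3,2)] by simp
    qed
    show "M \<inter> A \<subseteq> \<alpha> ` M \<inter> A" using fixed by (metis IntE IntI image_eqI subsetI)
  qed
qed

text \<open>
  By the Chinese remainder theorem there is an element of \<open>Q\<close> congruent to \<open>\<one>\<close> modulo each \<open>N\<close> in \<open>S\<close>, so that it avoids all
  of them.
\<close>

lemma avoid_maximal_ideals:
  assumes Q: "maximalideal Q (L\<lparr>carrier := B\<rparr>)" and S: "finite S"
    "\<And>N. N \<in> S \<Longrightarrow> maximalideal N (L\<lparr>carrier := B\<rparr>) \<and> N \<noteq> Q"
  shows "\<exists>m\<in>B. \<exists>q\<in>Q. \<one> = m \<oplus> q \<and> (\<forall>N\<in>S. m \<in> N)"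
  using S
proof (induction S)
  case empty
  then show ?case using B_sub(3) maximalideal_B(2)[OF Q] by (intro bexI[of _ \<one>] bexI[of _ \<zero>]) auto
next
  case (insert N S)
  note QE = maximalideal_B[OF Q]
  have N: "maximalideal N (L\<lparr>carrier := B\<rparr>)" "N \<noteq> Q" using insert.prems by auto
  note NE = maximalideal_B[OF N(1)]
  obtain m q where m: "m \<in> B" "q \<in> Q" "\<one> = m \<oplus> q" "\<forall>N\<in>S. m \<in> N" using insert by auto
  have "\<not> N \<subseteq> Q"
    using maximalideal.I_maximal[OF N(1) maximalideal.axioms(1)[OF Q]] QE(1,3) B_sub(3) N(2) by auto
  then obtain a where a: "a \<in> N" "a \<notin> Q" by blast
  then obtain b p where b: "b \<in> B" "p \<in> Q" "\<one> = b \<otimes> a \<oplus> p" using QE(7) NE(1) by blast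
  define n where "n = b \<otimes> a"
  have n: "n \<in> N" "n \<in> B" using NE(1,5) a b by (auto simp: n_def)
  have car: "m \<in> carrier L" "q \<in> carrier L" "n \<in> carrier L" "p \<in> carrier L"
    using m n b QE(1) B_carrier by auto
  have np: "n \<oplus> p = \<one>" and mq: "m \<oplus> q = \<one>" using b(3) m(3) by (simp_all add: n_def)
  have "\<one> = (m \<oplus> q) \<otimes> (n \<oplus> p)" unfolding np mq by simp
  also have "\<dots> = n \<otimes> m \<oplus> (n \<otimes> q \<oplus> (m \<oplus> q) \<otimes> p)" using car by (simp add: l_distr r_distr m_ac a_ac)
  also have "(m \<oplus> q) \<otimes> p = p" unfolding mq using car by simp
  finally have "\<one> = n \<otimes> m \<oplus> (n \<otimes> q \<oplus> p)" .
  moreover have "n \<otimes> q \<oplus> p \<in> Q" using QE(4,5) n m b by blast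
  moreover have "n \<otimes> m \<in> B" using B_sub(6) n m by blast
  moreover have "\<forall>N'\<in>insert N S. n \<otimes> m \<in> N'"
  proof
    fix N' assume N': "N' \<in> insert N S"
    have *: "n \<otimes> m = m \<otimes> n" using car m_comm by blast
    show "n \<otimes> m \<in> N'"
    proof (cases "N' = N")
      case True
      then show ?thesis using NE(5)[OF m(1) n(1)] * by simp
    next
      case False
      then have "maximalideal N' (L\<lparr>carrier := B\<rparr>)" "m \<in> N'" using N' insert.prems m(4) by auto
      then show ?thesis using maximalideal_B(5) n(2) by blast
    qed
  qed
  ultimately show ?case by blast
qed

text \<open>
  If \<open>Q\<close> is not in the orbit of \<open>P\<close>, which is finite by finite character, some \<open>x\<close> in \<open>Q\<close> avoids all members of
  this orbit. The product of the conjugates of \<open>x\<close> lies in \<open>Q\<close> and \<open>A\<close>, hence in \<open>P\<close>, so that some conjugate of \<open>x\<close> lies in \<open>P\<close>, and \<open>x\<close>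
  in a member of the orbit.
\<close>

theorem galois_transitive:
  assumes P: "maximalideal P (L\<lparr>carrier := B\<rparr>)" and Q: "maximalideal Q (L\<lparr>carrier := B\<rparr>)"
    and PQ: "P \<inter> A = Q \<inter> A"
  obtains \<alpha> where "\<alpha> \<in> G" "\<alpha> ` P = Q"
proof (rule ccontr)
  assume "\<not> thesis"
  then have neq: "\<alpha> ` P \<noteq> Q" if "\<alpha> \<in> G" for \<alpha> using that \<open>\<And>\<alpha>. \<alpha> \<in> G \<Longrightarrow> \<alpha> ` P = Q \<Longrightarrow> thesis\<close> by blast
  define S where "S = (\<lambda>\<alpha>. \<alpha> ` P) ` G"
  note PE = maximalideal_B[OF P] and QE = maximalideal_B[OF Q]
  have S: "maximalideal N (L\<lparr>carrier := B\<rparr>) \<and> N \<noteq> Q" if "N \<in> S" for N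
    using that neq maximalideal_image[OF _ P] unfolding S_def by blast
  obtain a where a: "a \<in> P \<inter> A" "a \<noteq> \<zero>" using contraction_nonzero[OF P] by blast
  have "a \<in> N" if "N \<in> S" for N
    using that image_Int_A[OF _ PE(1)] a(1) unfolding S_def by blast
  then have "S \<subseteq> {N. maximalideal N (L\<lparr>carrier := B\<rparr>) \<and> a \<in> N}" using S by blast
  moreover have "finite \<dots>" using finite_char a A_subset_B by (auto simp: finite_character_def)
  ultimately have "finite S" by (rule finite_subset)
  then obtain m x where m: "m \<in> B" "x \<in> Q" "\<one> = m \<oplus> x" "\<forall>N\<in>S. m \<in> N"
    using avoid_maximal_ideals[OF Q _ S] by blast
  have xB: "x \<in> B" using m(2) QE(1) by blast
  have "\<exists>\<alpha>\<in>G. \<alpha> x \<in> Q"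
    using identity_automorphism m(2) B_carrier[OF xB] by (intro bexI[of _ "\<lambda>x\<in>carrier L. x"]) auto
  then have "orbit_norm x \<in> Q" using orbit_norm_mem[OF Q xB] by blast
  then have "orbit_norm x \<in> P" using orbit_norm_A[OF xB] PQ by blast
  then obtain \<alpha> where \<alpha>: "\<alpha> \<in> G" "\<alpha> x \<in> P" using orbit_norm_mem[OF P xB] by blast
  obtain \<beta> where \<beta>: "\<beta> \<in> G" "\<And>x. x \<in> carrier L \<Longrightarrow> \<beta> (\<alpha> x) = x" by (rule inverse_automorphism[OF \<alpha>(1)]) blast
  have "\<beta> ` P \<in> S" using \<beta>(1) by (auto simp: S_def)
  moreover have "x \<in> \<beta> ` P" using \<beta>(2)[OF B_carrier[OF xB]] \<alpha>(2) by (intro image_eqI[of _ _ "\<alpha> x"]) auto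
  ultimately have "\<one> \<in> \<beta> ` P" using m(3,4) S maximalideal_B(4)[of "\<beta> ` P" m x] by simp
  then show False using S[OF \<open>\<beta> ` P \<in> S\<close>] maximalideal_B(3) by blast
qed

text \<open>
  A coset of a stabilizer is a fibre of the orbit map, so these cosets correspond to the ideals in the orbit
  of \<open>P\<close>.
\<close>

lemma decomposition_coset:
  assumes \<alpha>: "\<alpha> \<in> G" and P: "P \<subseteq> carrier L"
  shows "\<alpha> <#\<^bsub>galois_group L K\<^esub> decomposition_group L K P = {\<beta> \<in> G. \<beta> ` P = \<alpha> ` P}"
proof -
  have bij: "\<alpha> \<in> Bij (carrier L)" if "\<alpha> \<in> G" for \<alpha>
    using automorphism_hom(6)[OF that] automorphism(2)[OF that] by (simp add: Bij_def)
  have mult: "\<alpha> \<otimes>\<^bsub>galois_group L K\<^esub> \<beta> = compose (carrier L) \<alpha> \<beta>" if "\<alpha> \<in> G" "\<beta> \<in> G" for \<alpha> \<beta>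
    using bij[OF that(1)] bij[OF that(2)] by (simp add: galois_group_def BijGroup_def)
  have im: "compose (carrier L) \<rho> \<beta> ` P = \<rho> ` \<beta> ` P" for \<rho> \<beta> :: "'a \<Rightarrow> 'a"
    using P by (auto simp: compose_def image_image subset_iff intro!: image_cong)
  obtain \<rho> where \<rho>: "\<rho> \<in> G" "\<And>x. x \<in> carrier L \<Longrightarrow> \<rho> (\<alpha> x) = x" "\<And>x. x \<in> carrier L \<Longrightarrow> \<alpha> (\<rho> x) = x"
    by (rule inverse_automorphism[OF \<alpha>]) blast
  have \<rho>\<alpha>: "\<rho> ` \<alpha> ` P = P" using \<rho>(2) P by (auto simp: image_image subset_iff)
  show ?thesis
  proof
    show "\<alpha> <#\<^bsub>galois_group L K\<^esub> decomposition_group L K P \<subseteq> {\<beta> \<in> G. \<beta> ` P = \<alpha> ` P}"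
    proof
      fix \<beta> assume "\<beta> \<in> \<alpha> <#\<^bsub>galois_group L K\<^esub> decomposition_group L K P"
      then obtain \<delta> where \<delta>: "\<delta> \<in> G" "\<delta> ` P = P" "\<beta> = compose (carrier L) \<alpha> \<delta>"
        using mult[OF \<alpha>] by (auto simp: l_coset_def decomposition_group_def)
      then show "\<beta> \<in> {\<beta> \<in> G. \<beta> ` P = \<alpha> ` P}" using compose_automorphism[OF \<alpha> \<delta>(1)] im by simp
    qed
    show "{\<beta> \<in> G. \<beta> ` P = \<alpha> ` P} \<subseteq> \<alpha> <#\<^bsub>galois_group L K\<^esub> decomposition_group L K P"
    proof clarify
      fix \<beta> assume \<beta>: "\<beta> \<in> G" "\<beta> ` P = \<alpha> ` P"
      define \<delta> where "\<delta> = compose (carrier L) \<rho> \<beta>"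
      have \<delta>: "\<delta> \<in> G" unfolding \<delta>_def by (rule compose_automorphism[OF \<rho>(1) \<beta>(1)])
      moreover have "\<delta> ` P = P" unfolding \<delta>_def im \<beta>(2) by (rule \<rho>\<alpha>)
      moreover have "\<beta> = \<alpha> \<otimes>\<^bsub>galois_group L K\<^esub> \<delta>"
        unfolding mult[OF \<alpha> \<delta>]
      proof (rule extensionalityI[OF automorphism(2)[OF \<beta>(1)]])
        show "compose (carrier L) \<alpha> \<delta> \<in> extensional (carrier L)" by (simp add: compose_def)
        show "\<beta> x = compose (carrier L) \<alpha> \<delta> x" if "x \<in> carrier L" for x
          using that \<rho>(3) automorphism_hom(1)[OF \<beta>(1)] by (simp add: \<delta>_def compose_def)
      qed
      ultimately show "\<beta> \<in> \<alpha> <#\<^bsub>galois_group L K\<^esub> decomposition_group L K P"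
        by (auto simp: l_coset_def decomposition_group_def)
    qed
  qed
qed

lemma automorphism_inv:
  assumes \<alpha>: "\<alpha> \<in> G" and x: "x \<in> carrier L - {\<zero>}" shows "\<alpha> (inv x) = inv (\<alpha> x)"
proof -
  have i: "inv x \<in> carrier L" "x \<otimes> inv x = \<one>" using x field_Units by auto
  then have "\<alpha> x \<otimes> \<alpha> (inv x) = \<one>" using automorphism_hom(2,4)[OF \<alpha>] x by (metis DiffD1)
  then show ?thesis using comm_inv_char[of "\<alpha> x" "\<alpha> (inv x)"] automorphism_hom(1)[OF \<alpha>] x i by simp
qed

text \<open>
  Transport of structure: if \<open>v\<close> belongs to \<open>P\<close>, then \<open>v \<circ> \<beta>\<close>, where \<open>\<beta>\<close> is the inverse of \<open>\<alpha>\<close>, belongs to \<open>\<alpha> ` P\<close> and has the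
  same value group.
\<close>

lemma conjugate_valuation:
  assumes \<alpha>: "\<alpha> \<in> G" and \<beta>: "\<beta> \<in> G" "\<And>x. x \<in> carrier L \<Longrightarrow> \<beta> (\<alpha> x) = x" "\<And>x. x \<in> carrier L \<Longrightarrow> \<alpha> (\<beta> x) = x"
    and P: "P \<subseteq> B" "\<zero> \<in> P" and v: "normalized_valuation L K B P v"
  defines "u \<equiv> \<lambda>x. real_of_rat (v (\<beta> x))"
  shows "x \<in> carrier L - {\<zero>} \<Longrightarrow> y \<in> carrier L - {\<zero>} \<Longrightarrow> u (x \<otimes> y) = u x + u y"
    and "x \<in> carrier L - {\<zero>} \<Longrightarrow> y \<in> carrier L - {\<zero>} \<Longrightarrow> x \<oplus> y \<noteq> \<zero> \<Longrightarrow> min (u x) (u y) \<le> u (x \<oplus> y)"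
    and "{x \<in> carrier L. x = \<zero> \<or> u x \<ge> 0} = {a \<otimes> inv s | a s. a \<in> B \<and> s \<in> B - \<alpha> ` P}"
    and "u ` (carrier L - {\<zero>}) = value_group L v"
proof -
  note ha = automorphism_hom[OF \<alpha>] and hb = automorphism_hom[OF \<beta>(1)]
  have nz: "\<beta> x \<in> carrier L - {\<zero>}" if "x \<in> carrier L - {\<zero>}" for x
    using that hb(1)[of x] automorphism_inj[OF \<beta>(1), of x \<zero>] hb(5) by auto
  have nza: "\<alpha> x \<in> carrier L - {\<zero>}" if "x \<in> carrier L - {\<zero>}" for x
    using that ha(1)[of x] automorphism_inj[OF \<alpha>, of x \<zero>] ha(5) by auto
  note v' = v[unfolded normalized_valuation_def]
  have vm: "v (x \<otimes> y) = v x + v y" if "x \<in> carrier L - {\<zero>}" "y \<in> carrier L - {\<zero>}" for x y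
    using v'[THEN conjunct1, rule_format, OF that] .
  have va: "min (v x) (v y) \<le> v (x \<oplus> y)"
    if "x \<in> carrier L - {\<zero>}" "y \<in> carrier L - {\<zero>}" "x \<oplus> y \<noteq> \<zero>" for x y
    using v'[THEN conjunct2, THEN conjunct1, rule_format, OF that] .
  have vr: "{x \<in> carrier L. x = \<zero> \<or> v x \<ge> 0} = {a \<otimes> inv s | a s. a \<in> B \<and> s \<in> B - P}"
    using v'[THEN conjunct2, THEN conjunct2, THEN conjunct1] .
  show "u (x \<otimes> y) = u x + u y" if xy: "x \<in> carrier L - {\<zero>}" "y \<in> carrier L - {\<zero>}" for x y
    using xy vm[OF nz[OF xy(1)] nz[OF xy(2)]] hb(2)[of x y] by (simp add: u_def of_rat_add)
  show "min (u x) (u y) \<le> u (x \<oplus> y)"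
    if xy: "x \<in> carrier L - {\<zero>}" "y \<in> carrier L - {\<zero>}" "x \<oplus> y \<noteq> \<zero>" for x y
  proof -
    have e: "\<beta> (x \<oplus> y) = \<beta> x \<oplus> \<beta> y" using hb(3) xy by simp
    have "x \<oplus> y \<in> carrier L - {\<zero>}" using xy by simp
    from nz[OF this] have "\<beta> x \<oplus> \<beta> y \<noteq> \<zero>" unfolding e by simp
    then have "min (v (\<beta> x)) (v (\<beta> y)) \<le> v (\<beta> (x \<oplus> y))" unfolding e by (rule va[OF nz[OF xy(1)] nz[OF xy(2)]])
    then show ?thesis by (auto simp: u_def min_def of_rat_less_eq split: if_splits)
  qed
  have aB: "\<alpha> b \<in> B" if "b \<in> B" for b using automorphism_B[OF \<alpha> that] .
  have bB: "\<beta> b \<in> B" if "b \<in> B" for b using automorphism_B[OF \<beta>(1) that] .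
  have nP: "s \<in> carrier L - {\<zero>}" if "s \<in> B - P" for s using that P(2) B_carrier by auto
  show "{x \<in> carrier L. x = \<zero> \<or> u x \<ge> 0} = {a \<otimes> inv s | a s. a \<in> B \<and> s \<in> B - \<alpha> ` P}"
  proof (rule Set.set_eqI, rule iffI)
    fix x assume "x \<in> {x \<in> carrier L. x = \<zero> \<or> u x \<ge> 0}"
    then have x: "x \<in> carrier L" "x = \<zero> \<or> u x \<ge> 0" by auto
    have "\<beta> x \<in> {x \<in> carrier L. x = \<zero> \<or> v x \<ge> 0}" using x hb(1,5) by (auto simp: u_def)
    then obtain a s where as: "\<beta> x = a \<otimes> inv s" "a \<in> B" "s \<in> B - P" unfolding vr by blast
    have s: "s \<in> carrier L - {\<zero>}" by (rule nP[OF as(3)])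
    have invs: "inv s \<in> carrier L" using s field_Units by auto
    have "x = \<alpha> (\<beta> x)" using \<beta>(3)[OF x(1)] by simp
    also have "\<dots> = \<alpha> a \<otimes> inv (\<alpha> s)"
      unfolding as(1) using ha(2)[OF B_carrier[OF as(2)] invs] automorphism_inv[OF \<alpha> s] by simp
    finally have "x = \<alpha> a \<otimes> inv (\<alpha> s)" .
    moreover have "\<alpha> s \<in> B - \<alpha> ` P"
    proof
      show "\<alpha> s \<in> B" using aB as(3) by blast
      show "\<alpha> s \<notin> \<alpha> ` P"
      proof
        assume "\<alpha> s \<in> \<alpha> ` P"
        then obtain p where p: "p \<in> P" "\<alpha> s = \<alpha> p" by blast
        have "s = p" using automorphism_inj[OF \<alpha> _ _ p(2)] s p(1) P(1) B_carrier by blast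
        then show False using as(3) p(1) by blast
      qed
    qed
    ultimately show "x \<in> {a \<otimes> inv s | a s. a \<in> B \<and> s \<in> B - \<alpha> ` P}" using aB[OF as(2)] by blast
  next
    fix x assume "x \<in> {a \<otimes> inv s | a s. a \<in> B \<and> s \<in> B - \<alpha> ` P}"
    then obtain a s where as: "x = a \<otimes> inv s" "a \<in> B" "s \<in> B" "s \<notin> \<alpha> ` P" by blast
    have "\<zero> \<in> \<alpha> ` P" using P(2) ha(5) by (metis imageI)
    then have s: "s \<in> carrier L - {\<zero>}" using as(3,4) B_carrier by auto
    have invs: "inv s \<in> carrier L" using s field_Units by auto
    have x: "x \<in> carrier L" using as(1,2) invs B_carrier by simp
    have "\<beta> x = \<beta> a \<otimes> inv (\<beta> s)"
      unfolding as(1) using hb(2)[OF B_carrier[OF as(2)] invs] automorphism_inv[OF \<beta>(1) s] by simp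
    moreover have "\<beta> s \<in> B - P"
    proof
      show "\<beta> s \<in> B" using bB as(3) by blast
      show "\<beta> s \<notin> P" using as(4) \<beta>(3)[OF B_carrier[OF as(3)]] by (metis imageI)
    qed
    ultimately have "\<beta> x \<in> {x \<in> carrier L. x = \<zero> \<or> v x \<ge> 0}" unfolding vr using bB[OF as(2)] by blast
    then have "\<beta> x = \<zero> \<or> v (\<beta> x) \<ge> 0" by blast
    then have "x = \<zero> \<or> u x \<ge> 0"
      using automorphism_inj[OF \<beta>(1) x zero_closed] hb(5) by (auto simp: u_def)
    then show "x \<in> {x \<in> carrier L. x = \<zero> \<or> u x \<ge> 0}" using x by blast
  qed
  show "u ` (carrier L - {\<zero>}) = value_group L v"
  proof
    show "u ` (carrier L - {\<zero>}) \<subseteq> value_group L v" using nz by (auto simp: u_def value_group_def)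
    show "value_group L v \<subseteq> u ` (carrier L - {\<zero>})"
    proof
      fix g assume "g \<in> value_group L v"
      then obtain x where x: "x \<in> carrier L - {\<zero>}" "g = real_of_rat (v x)" by (auto simp: value_group_def)
      then have "g = u (\<alpha> x)" using \<beta>(2) by (simp add: u_def)
      then show "g \<in> u ` (carrier L - {\<zero>})" using nza[OF x(1)] by blast
    qed
  qed
qed

end

section \<open>The class monoid of the integral closure\<close>

lemma value_group_subset_Rats: "value_group L v \<subseteq> \<rat>"
  by (auto simp: value_group_def)

theorem corollary2p13:
  fixes L :: "('a, 'b) ring_scheme"
    and \<oo> K \<OO> :: "'a set"
    and \<pp>\<^sub>L :: "'a set \<Rightarrow> 'a set"
    and v :: "'a set \<Rightarrow> 'a \<Rightarrow> rat"
  assumes "field L"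
    and "dedekind_subring L \<oo>"
    and "\<not> field (L\<lparr>carrier := \<oo>\<rparr>)"
    and "K = fraction_field L \<oo>"
    and "galois_extension L K"
    and "\<OO> = integral_closure L \<oo>"
    and "\<And>\<pp>. maximalideal \<pp> (L\<lparr>carrier := \<oo>\<rparr>) \<Longrightarrow>
           maximalideal (\<pp>\<^sub>L \<pp>) (L\<lparr>carrier := \<OO>\<rparr>) \<and> \<pp>\<^sub>L \<pp> \<inter> \<oo> = \<pp>"
    and "\<And>\<pp>. maximalideal \<pp> (L\<lparr>carrier := \<oo>\<rparr>) \<Longrightarrow> normalized_valuation L K \<OO> (\<pp>\<^sub>L \<pp>) (v \<pp>)"
    and "finite_character (L\<lparr>carrier := \<OO>\<rparr>)"
  shows "regular_part (class_monoid L \<OO>) Mod carrier (picard_group L \<OO>) \<cong>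
         sum_monoid (nondiscrete_primes L \<oo> v) (\<lambda>\<pp>.
           sum_monoid (lcosets\<^bsub>galois_group L K\<^esub> decomposition_group L K (\<pp>\<^sub>L \<pp>)) (\<lambda>_.
             adjoin_identity (real_additive Mod value_group L (v \<pp>))))"
proof -
  interpret field L by fact
  have oo: "subring \<oo> L" using assms(2) by (simp add: dedekind_subring_def)
  have OO: "subring \<OO> L"
  proof -
    have "ideal {\<zero>\<^bsub>L\<^esub>} (L\<lparr>carrier := \<oo>\<rparr>)"
      using subringE(1,2)[OF oo] by (intro ideal_of_subringI[OF oo]) auto
    then obtain \<pp> where "maximalideal \<pp> (L\<lparr>carrier := \<oo>\<rparr>)"
      using cring.proper_ideal_in_maximalideal[OF subring_is_cring[OF oo], of "{\<zero>\<^bsub>L\<^esub>}"] one_not_zero by auto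
    then have "maximalideal (\<pp>\<^sub>L \<pp>) (L\<lparr>carrier := \<OO>\<rparr>)" using assms(7) by blast
    then have "ring (L\<lparr>carrier := \<OO>\<rparr>)" using maximalideal.axioms(1) ideal.axioms(2) by blast
    moreover have "\<OO> \<subseteq> carrier L" unfolding assms(6) integral_closure_def by blast
    ultimately show ?thesis using ring_incl_imp_subring by blast
  qed
  interpret Gal: galois_integral_closure L \<oo> K \<OO>
    by (intro galois_integral_closure.intro galois_integral_closure_axioms.intro) (fact assms OO)+
  let ?max = "\<lambda>M. maximalideal M (L\<lparr>carrier := \<OO>\<rparr>)"
  have above: "?max (\<pp>\<^sub>L \<pp>)" "\<pp>\<^sub>L \<pp> \<inter> \<oo> = \<pp>" "normalized_valuation L K \<OO> (\<pp>\<^sub>L \<pp>) (v \<pp>)"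
    if "maximalideal \<pp> (L\<lparr>carrier := \<oo>\<rparr>)" for \<pp> using assms(7,8)[OF that] by auto
  note below = Gal.contraction_maximal
  have "\<exists>\<alpha> \<beta>. \<alpha> \<in> Gal.G \<and> \<beta> \<in> Gal.G \<and> \<alpha> ` \<pp>\<^sub>L (M \<inter> \<oo>) = M \<and>
      (\<forall>x\<in>carrier L. \<beta> (\<alpha> x) = x) \<and> (\<forall>x\<in>carrier L. \<alpha> (\<beta> x) = x)" if M: "?max M" for M
  proof -
    obtain \<alpha> where \<alpha>: "\<alpha> \<in> Gal.G" "\<alpha> ` \<pp>\<^sub>L (M \<inter> \<oo>) = M"
      by (rule Gal.galois_transitive[OF above(1)[OF below[OF M]] M above(2)[OF below[OF M]]])
    moreover obtain \<beta> where "\<beta> \<in> Gal.G" "\<And>x. x \<in> carrier L \<Longrightarrow> \<beta> (\<alpha> x) = x" "\<And>x. x \<in> carrier L \<Longrightarrow> \<alpha> (\<beta> x) = x"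
      by (rule Gal.inverse_automorphism[OF \<alpha>(1)]) blast
    ultimately show ?thesis by blast
  qed
  then obtain \<alpha> \<beta> where \<alpha>\<beta>: "\<And>M. ?max M \<Longrightarrow> \<alpha> M \<in> Gal.G \<and> \<beta> M \<in> Gal.G \<and> \<alpha> M ` \<pp>\<^sub>L (M \<inter> \<oo>) = M \<and>
      (\<forall>x\<in>carrier L. \<beta> M (\<alpha> M x) = x) \<and> (\<forall>x\<in>carrier L. \<alpha> M (\<beta> M x) = x)"
    by metis
  \<comment> \<open>the valuation at the chosen prime above \<open>M \<inter> \<oo>\<close>, moved to \<open>M\<close>\<close>
  define w where "w M x = real_of_rat (v (M \<inter> \<oo>) (\<beta> M x))" for M x
  have w: "\<And>x y. x \<in> carrier L - {\<zero>\<^bsub>L\<^esub>} \<Longrightarrow> y \<in> carrier L - {\<zero>\<^bsub>L\<^esub>} \<Longrightarrow> w M (x \<otimes>\<^bsub>L\<^esub> y) = w M x + w M y"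
    "\<And>x y. x \<in> carrier L - {\<zero>\<^bsub>L\<^esub>} \<Longrightarrow> y \<in> carrier L - {\<zero>\<^bsub>L\<^esub>} \<Longrightarrow> x \<oplus>\<^bsub>L\<^esub> y \<noteq> \<zero>\<^bsub>L\<^esub> \<Longrightarrow> min (w M x) (w M y) \<le> w M (x \<oplus>\<^bsub>L\<^esub> y)"
    "{x \<in> carrier L. x = \<zero>\<^bsub>L\<^esub> \<or> w M x \<ge> 0} = {a \<otimes>\<^bsub>L\<^esub> inv\<^bsub>L\<^esub> s | a s. a \<in> \<OO> \<and> s \<in> \<OO> - M}"
    "w M ` (carrier L - {\<zero>\<^bsub>L\<^esub>}) = value_group L (v (M \<inter> \<oo>))"
    if M: "?max M" for M
  proof -
    note P = Gal.maximalideal_B[OF above(1)[OF below[OF M]]]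
    have im: "\<alpha> M ` \<pp>\<^sub>L (M \<inter> \<oo>) = M" using \<alpha>\<beta>[OF M] by blast
    have ab: "\<alpha> M \<in> Gal.G" "\<beta> M \<in> Gal.G" "\<And>x. x \<in> carrier L \<Longrightarrow> \<beta> M (\<alpha> M x) = x" "\<And>x. x \<in> carrier L \<Longrightarrow> \<alpha> M (\<beta> M x) = x"
      using \<alpha>\<beta>[OF M] by blast+
    note C = Gal.conjugate_valuation[OF ab P(1,2) above(3)[OF below[OF M]], folded w_def, unfolded im]
    show "\<And>x y. x \<in> carrier L - {\<zero>\<^bsub>L\<^esub>} \<Longrightarrow> y \<in> carrier L - {\<zero>\<^bsub>L\<^esub>} \<Longrightarrow> w M (x \<otimes>\<^bsub>L\<^esub> y) = w M x + w M y"
      by (rule C(1))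
    show "\<And>x y. x \<in> carrier L - {\<zero>\<^bsub>L\<^esub>} \<Longrightarrow> y \<in> carrier L - {\<zero>\<^bsub>L\<^esub>} \<Longrightarrow> x \<oplus>\<^bsub>L\<^esub> y \<noteq> \<zero>\<^bsub>L\<^esub> \<Longrightarrow> min (w M x) (w M y) \<le> w M (x \<oplus>\<^bsub>L\<^esub> y)"
      by (rule C(2))
    show "{x \<in> carrier L. x = \<zero>\<^bsub>L\<^esub> \<or> w M x \<ge> 0} = {a \<otimes>\<^bsub>L\<^esub> inv\<^bsub>L\<^esub> s | a s. a \<in> \<OO> \<and> s \<in> \<OO> - M}"
      by (rule C(3))
    show "w M ` (carrier L - {\<zero>\<^bsub>L\<^esub>}) = value_group L (v (M \<inter> \<oo>))" using C(4) by (simp add: w_def)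
  qed
  interpret Val: rank_one_finite_character L \<OO> w
  proof (intro rank_one_finite_character.intro rank_one_finite_character_axioms.intro)
    show "field L" "subring \<OO> L" "finite_character (L\<lparr>carrier := \<OO>\<rparr>)" by fact+
  qed (fact w Gal.maximalideal_nonzero)+
  have grp: "Val.value_grp M = value_group L (v (M \<inter> \<oo>))" if "M \<in> Val.max_ideals" for M
    using w(4) that by (simp add: Val.vals_def Val.max_ideals_def)
  let ?J = "nondiscrete_primes L \<oo> v"
  let ?C = "\<lambda>\<pp>. lcosets\<^bsub>galois_group L K\<^esub> decomposition_group L K (\<pp>\<^sub>L \<pp>)"
  define D where "D = {M \<in> Val.max_ideals. M \<inter> \<oo> \<in> ?J}"
  have "regular_part (class_monoid L \<OO>) Mod carrier (picard_group L \<OO>) \<cong>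
      sum_monoid D (\<lambda>M. adjoin_identity (real_additive Mod Val.value_grp M))"
  proof (rule Val.regular_class_monoid_iso)
    show "D \<subseteq> Val.max_ideals" by (auto simp: D_def)
    show "order_dense (Val.value_grp M)" if "M \<in> D" for M
      using that grp[of M] not_closed_order_dense[OF Val.value_grp_subgroup[of M]]
      by (simp add: D_def nondiscrete_primes_def)
    show "has_min S" if MS: "M \<in> Val.max_ideals - D" "cut (Val.value_grp M) S" for M S
    proof (rule closed_rational_has_min[OF Val.value_grp_subgroup _ _ MS(2)])
      show M: "M \<in> Val.max_ideals" using MS(1) by blast
      then have "maximalideal (M \<inter> \<oo>) (L\<lparr>carrier := \<oo>\<rparr>)" using below by (simp add: Val.max_ideals_def)
      then show "Val.value_grp M = closure (Val.value_grp M)"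
        using MS(1) grp[OF M] by (auto simp: D_def nondiscrete_primes_def)
      show "Val.value_grp M \<subseteq> \<rat>" using grp[OF M] value_group_subset_Rats by simp
    qed
  qed
  also have "\<dots> \<cong> sum_monoid ?J (\<lambda>\<pp>. sum_monoid (?C \<pp>) (\<lambda>_. adjoin_identity (real_additive Mod value_group L (v \<pp>))))"
  proof -
    \<comment> \<open>All elements of a coset of the decomposition group map the chosen prime to the same one, so the choice of a representative is immaterial.\<close>
    define e where "e = (\<lambda>(\<pp>, c :: ('a \<Rightarrow> 'a) set). (SOME \<rho>. \<rho> \<in> c) ` \<pp>\<^sub>L \<pp>)"
    have J: "maximalideal \<pp> (L\<lparr>carrier := \<oo>\<rparr>)" if "\<pp> \<in> ?J" for \<pp> using that by (simp add: nondiscrete_primes_def)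
    have sub: "\<pp>\<^sub>L \<pp> \<subseteq> \<OO>" if "\<pp> \<in> ?J" for \<pp> using Gal.maximalideal_B(1)[OF above(1)[OF J[OF that]]] .
    have cos: "\<rho> <#\<^bsub>galois_group L K\<^esub> decomposition_group L K (\<pp>\<^sub>L \<pp>) = {\<beta> \<in> Gal.G. \<beta> ` \<pp>\<^sub>L \<pp> = \<rho> ` \<pp>\<^sub>L \<pp>}"
      if "\<pp> \<in> ?J" "\<rho> \<in> Gal.G" for \<pp> \<rho>
    proof (rule Gal.decomposition_coset[OF that(2)])
      show "\<pp>\<^sub>L \<pp> \<subseteq> carrier L" using sub[OF that(1)] Gal.B_sub(1) by (rule subset_trans)
    qed
    have C: "?C \<pp> = {{\<beta> \<in> Gal.G. \<beta> ` \<pp>\<^sub>L \<pp> = \<rho> ` \<pp>\<^sub>L \<pp>} | \<rho>. \<rho> \<in> Gal.G}" if "\<pp> \<in> ?J" for \<pp>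
      using cos[OF that] by (auto simp: LCOSETS_def)
    have e: "c = {\<beta> \<in> Gal.G. \<beta> ` \<pp>\<^sub>L \<pp> = e (\<pp>, c)} \<and> (\<exists>\<rho>\<in>Gal.G. e (\<pp>, c) = \<rho> ` \<pp>\<^sub>L \<pp>)"
      if pc: "\<pp> \<in> ?J" "c \<in> ?C \<pp>" for \<pp> c
    proof -
      obtain \<rho> where \<rho>: "\<rho> \<in> Gal.G" "c = {\<beta> \<in> Gal.G. \<beta> ` \<pp>\<^sub>L \<pp> = \<rho> ` \<pp>\<^sub>L \<pp>}" using pc(2) unfolding C[OF pc(1)] by blast
      then have "\<rho> \<in> c" by simp
      then have "(SOME \<rho>. \<rho> \<in> c) \<in> c" by (rule someI[of "\<lambda>\<rho>. \<rho> \<in> c"])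
      then have "e (\<pp>, c) = \<rho> ` \<pp>\<^sub>L \<pp>" using \<rho>(2) by (simp add: e_def)
      then show ?thesis using \<rho> by auto
    qed
    have e_Int: "e (\<pp>, c) \<inter> \<oo> = \<pp>" if pc: "\<pp> \<in> ?J" "c \<in> ?C \<pp>" for \<pp> c
    proof -
      obtain \<rho> where \<rho>: "\<rho> \<in> Gal.G" "e (\<pp>, c) = \<rho> ` \<pp>\<^sub>L \<pp>" using e[OF pc] by blast
      show ?thesis unfolding \<rho>(2) Gal.image_Int_A[OF \<rho>(1) sub[OF pc(1)]] by (rule above(2)[OF J[OF pc(1)]])
    qed
    have e_max: "e (\<pp>, c) \<in> Val.max_ideals" if pc: "\<pp> \<in> ?J" "c \<in> ?C \<pp>" for \<pp> c
    proof -
      obtain \<rho> where \<rho>: "\<rho> \<in> Gal.G" "e (\<pp>, c) = \<rho> ` \<pp>\<^sub>L \<pp>" using e[OF pc] by blast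
      show ?thesis unfolding \<rho>(2) Val.max_ideals_def
        using Gal.maximalideal_image[OF \<rho>(1) above(1)[OF J[OF pc(1)]]] by simp
    qed
    show ?thesis
    proof (rule sum_monoid_Sigma_iso)
      show "bij_betw e (Sigma ?J ?C) D"
        unfolding bij_betw_def
      proof
        show "inj_on e (Sigma ?J ?C)"
        proof (rule inj_onI, clarify)
          fix \<pp> c \<qq> d assume p: "\<pp> \<in> ?J" "c \<in> ?C \<pp>" and q: "\<qq> \<in> ?J" "d \<in> ?C \<qq>" and eq: "e (\<pp>, c) = e (\<qq>, d)"
          have pq: "\<pp> = \<qq>" using e_Int[OF p] e_Int[OF q] eq by simp
          have "c = {\<beta> \<in> Gal.G. \<beta> ` \<pp>\<^sub>L \<pp> = e (\<pp>, c)}" using e[OF p] by blast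
          also have "\<dots> = {\<beta> \<in> Gal.G. \<beta> ` \<pp>\<^sub>L \<qq> = e (\<qq>, d)}" by (simp only: eq, simp only: pq)
          also have "\<dots> = d" using e[OF q] by blast
          finally show "\<pp> = \<qq> \<and> c = d" using pq by blast
        qed
        show "e ` Sigma ?J ?C = D"
        proof
          show "e ` Sigma ?J ?C \<subseteq> D" using e_Int e_max by (auto simp: D_def)
          show "D \<subseteq> e ` Sigma ?J ?C"
          proof
            fix M assume "M \<in> D"
            then have M: "?max M" "M \<inter> \<oo> \<in> ?J" by (auto simp: D_def Val.max_ideals_def)
            define c where "c = {\<beta> \<in> Gal.G. \<beta> ` \<pp>\<^sub>L (M \<inter> \<oo>) = \<alpha> M ` \<pp>\<^sub>L (M \<inter> \<oo>)}"
            have a: "\<alpha> M \<in> Gal.G" "\<alpha> M ` \<pp>\<^sub>L (M \<inter> \<oo>) = M" using \<alpha>\<beta>[OF M(1)] by blast+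
            have c: "c \<in> ?C (M \<inter> \<oo>)" unfolding C[OF M(2)] c_def using a(1) by blast
            have "\<alpha> M \<in> c" using a(1) by (simp add: c_def)
            then have "\<alpha> M ` \<pp>\<^sub>L (M \<inter> \<oo>) = e (M \<inter> \<oo>, c)" using e[OF M(2) c] by blast
            then have "M = e (M \<inter> \<oo>, c)" using a(2) by simp
            then show "M \<in> e ` Sigma ?J ?C" using M(2) c by blast
          qed
        qed
      qed
      show "adjoin_identity (real_additive Mod Val.value_grp (e (\<pp>, c))) = adjoin_identity (real_additive Mod value_group L (v \<pp>))"
        if "\<pp> \<in> ?J" "c \<in> ?C \<pp>" for \<pp> c
        using grp[OF e_max[OF that]] e_Int[OF that] by simp
    qed
  qed
  finally show ?thesis .
qed

end
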